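(* Let $n\ge2$ and let $\gamma:S^1\times[0,\omega)\to\mathbb{R}^n$ be a solution of curve shortening flow with a singularity forming at time $\omega$. Assume that $\{(p_j,t_j)\}$ is an essential blow-up sequence. Then there exists a subsequence of $\{(p_j,t_j)\}$ along which the rescaled solutions $\gamma_j$ converge to a smooth nontrivial limit $\gamma_\infty$ (that is, one which is not a straight line), which exists at least on the time interval $(-\infty,0]$.
   Context: A smooth family of immersions $\gamma:S^1\times[0,\omega)\to\mathbb{R}^n$ is a solution of curve shortening flow if $\partial\gamma/\partial t=\kappa N=\partial^2\gamma/\partial s^2$, where $s$ is arclength of $\gamma(\cdot,t)$, $\kappa=|\partial^2\gamma/\partial s^2|$ is the curvature and $N$ the unit normal. Set $K_t=\sup\kappa^2(\cdot,t)$. A singularity forms at time $\omega$ means that $\omega<\infty$ is the maximal time of smooth existence. A sequence $\{(p_j,t_j)\}\subset S^1\times[0,\omega)$ is a blow-up sequence if $t_j\to\omega$ and $\kappa^2(p_j,t_j)\to\infty$ as $j\to\infty$. It is essential if there is a constant $\rho>0$, independent of $j$, such that $\rho K_t\le\kappa^2(p_j,t_j)$ for all $t<t_j$. Rescaled solutions: put $\lambda_j=\kappa(p_j,t_j)$ and define $$\gamma_j(\cdot,\bar t)=\lambda_j\bigl(A_j\gamma(\cdot,t)+b_j\bigr),\qquad \bar t=\lambda_j^2(t-t_j)\in[-\lambda_j^2t_j,\ \lambda_j^2(\omega-t_j)),$$ where $A_j\in\mathrm{SO}(n)$ and $b_j\in\mathbb{R}^n$ are chosen so that $\gamma_j(p_j,0)=0$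 and the Frenet–Serret frame $(T,N,B_1,\dots,B_{n-2})$ of $\gamma_j(\cdot,0)$ at $p_j$ (as far as it is defined) is the standard basis $(e_1,\dots,e_n)$. Each $\gamma_j$ is again a solution of curve shortening flow. As limits may be noncompact, $\gamma_j$ is regarded as a family of curves on $\mathbb{R}$, periodic in space, parametrised by arclength with $0\in\mathbb{R}$ corresponding to $p_j$; convergence is smooth convergence, uniform on compact subsets of space-time. *)

theory Defs
  imports "HOL-Analysis.Analysis"
begin

text \<open>
  A family of curves is a map \<open>\<gamma> x t\<close> of a space variable \<open>x\<close> and a time \<open>t\<close> ranging over an
  interval \<open>J\<close>. The circle is \<open>\<real> / 2\<pi>\<int>\<close>: maps on it are \<open>2\<pi>\<close>-periodic maps on \<open>\<real>\<close>, and points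
  of it are given by real representatives. Time derivatives are taken within \<open>J\<close>, hence are
  one-sided at an endpoint belonging to \<open>J\<close>.
\<close>

definition dx :: "(real \<Rightarrow> real \<Rightarrow> 'a::real_normed_vector) \<Rightarrow> real \<Rightarrow> real \<Rightarrow> 'a" where
  "dx f = (\<lambda>x t. vector_derivative (\<lambda>y. f y t) (at x))"

definition dt :: "real set \<Rightarrow> (real \<Rightarrow> real \<Rightarrow> 'a::real_normed_vector) \<Rightarrow> real \<Rightarrow> real \<Rightarrow> 'a" where
  "dt J f = (\<lambda>x t. vector_derivative (f x) (at t within J))"

definition pd :: "real set \<Rightarrow> nat \<Rightarrow> nat \<Rightarrow> (real \<Rightarrow> real \<Rightarrow> 'a::real_normed_vector) \<Rightarrow> real \<Rightarrow> real \<Rightarrow> 'a"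
  where "pd J i k f = (dt J ^^ k) ((dx ^^ i) f)"

text \<open>
  Smoothness on \<open>\<real> \<times> J\<close>. One order of differentiation is enough: given continuity of all the
  \<open>pd J i k f\<close>, Schwarz's theorem yields the other mixed derivatives.
\<close>

definition smooth_family :: "real set \<Rightarrow> (real \<Rightarrow> real \<Rightarrow> 'a::real_normed_vector) \<Rightarrow> bool" where
  "smooth_family J f \<longleftrightarrow> (\<forall>i k.
     (\<forall>x. \<forall>t\<in>J. (\<lambda>y. pd J i k f y t) differentiable (at x) \<and>
                pd J i k f x differentiable (at t within J)) \<and>
     continuous_on (UNIV \<times> J) (\<lambda>(x, t). pd J i k f x t))"

definition immersed :: "real set \<Rightarrow> (real \<Rightarrow> real \<Rightarrow> 'a::real_normed_vector) \<Rightarrow> bool" where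
  "immersed J \<gamma> \<longleftrightarrow> (\<forall>x. \<forall>t\<in>J. dx \<gamma> x t \<noteq> 0)"

text \<open>The arclength derivative \<open>\<partial>/\<partial>s\<close> along the curves \<open>\<gamma> \<cdot> t\<close>.\<close>

definition ds :: "(real \<Rightarrow> real \<Rightarrow> 'a::real_normed_vector) \<Rightarrow> (real \<Rightarrow> real \<Rightarrow> 'a) \<Rightarrow> real \<Rightarrow> real \<Rightarrow> 'a" where
  "ds \<gamma> f = (\<lambda>x t. dx f x t /\<^sub>R norm (dx \<gamma> x t))"

text \<open>\<open>curv_vec \<gamma>\<close> is \<open>\<kappa>N = \<partial>\<^sup>2\<gamma>/\<partial>s\<^sup>2\<close>.\<close>

definition curv_vec :: "(real \<Rightarrow> real \<Rightarrow> 'a::real_normed_vector) \<Rightarrow> real \<Rightarrow> real \<Rightarrow> 'a" where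
  "curv_vec \<gamma> = ds \<gamma> (ds \<gamma> \<gamma>)"

definition curvature :: "(real \<Rightarrow> real \<Rightarrow> 'a::real_normed_vector) \<Rightarrow> real \<Rightarrow> real \<Rightarrow> real" where
  "curvature \<gamma> x t = norm (curv_vec \<gamma> x t)"

definition closed_csf :: "real set \<Rightarrow> (real \<Rightarrow> real \<Rightarrow> 'a::real_normed_vector) \<Rightarrow> bool" where
  "closed_csf J \<gamma> \<longleftrightarrow> smooth_family J \<gamma> \<and> immersed J \<gamma> \<and>
     (\<forall>x. \<forall>t\<in>J. \<gamma> (x + 2 * pi) t = \<gamma> x t) \<and>
     (\<forall>x. \<forall>t\<in>J. dt J \<gamma> x t = curv_vec \<gamma> x t)"

definition singularity_at :: "real \<Rightarrow> (real \<Rightarrow> real \<Rightarrow> 'a::real_normed_vector) \<Rightarrow> bool" where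
  "singularity_at \<omega> \<gamma> \<longleftrightarrow> 0 < \<omega> \<and> closed_csf {0..<\<omega>} \<gamma> \<and>
     \<not> (\<exists>\<omega>'>\<omega>. \<exists>\<gamma>'. closed_csf {0..<\<omega>'} \<gamma>' \<and> (\<forall>x. \<forall>t\<in>{0..<\<omega>}. \<gamma>' x t = \<gamma> x t))"

definition blow_up_sequence ::
    "real \<Rightarrow> (real \<Rightarrow> real \<Rightarrow> 'a::real_normed_vector) \<Rightarrow> (nat \<Rightarrow> real) \<Rightarrow> (nat \<Rightarrow> real) \<Rightarrow> bool" where
  "blow_up_sequence \<omega> \<gamma> p \<tau> \<longleftrightarrow> (\<forall>j. \<tau> j \<in> {0..<\<omega>}) \<and> \<tau> \<longlonglongrightarrow> \<omega> \<and>
     filterlim (\<lambda>j. (curvature \<gamma> (p j) (\<tau> j))\<^sup>2) at_top sequentially"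

definition essential_blow_up ::
    "real \<Rightarrow> (real \<Rightarrow> real \<Rightarrow> 'a::real_normed_vector) \<Rightarrow> (nat \<Rightarrow> real) \<Rightarrow> (nat \<Rightarrow> real) \<Rightarrow> bool" where
  "essential_blow_up \<omega> \<gamma> p \<tau> \<longleftrightarrow> blow_up_sequence \<omega> \<gamma> p \<tau> \<and>
     (\<exists>\<rho>>0. \<forall>j. \<forall>t\<in>{0..<\<tau> j}.
        \<rho> * (SUP x. (curvature \<gamma> x t)\<^sup>2) \<le> (curvature \<gamma> (p j) (\<tau> j))\<^sup>2)"

text \<open>
  Signed arclength of \<open>\<gamma> \<cdot> t\<close> measured from \<open>p\<close>, and the reparametrisation of every curve
  \<open>\<gamma> \<cdot> t\<close> by it. The inverse exists when the \<open>\<gamma> \<cdot> t\<close> are periodic immersions.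
\<close>

definition arclength :: "(real \<Rightarrow> real \<Rightarrow> 'a::real_normed_vector) \<Rightarrow> real \<Rightarrow> real \<Rightarrow> real \<Rightarrow> real" where
  "arclength \<gamma> p t x = (LBINT y=p..x. norm (dx \<gamma> y t))"

definition by_arclength ::
    "(real \<Rightarrow> real \<Rightarrow> 'a::real_normed_vector) \<Rightarrow> real \<Rightarrow> real \<Rightarrow> real \<Rightarrow> 'a" where
  "by_arclength \<gamma> p = (\<lambda>s t. \<gamma> (inv (arclength \<gamma> p t) s) t)"

text \<open>
  The rescaled solution based at \<open>(p, \<tau>)\<close>: the dilated, rotated and translated flow, with each of
  its curves parametrised by arclength starting at \<open>p\<close>.
\<close>

definition rescaled ::
    "(real \<Rightarrow> real \<Rightarrow> real ^ 'n) \<Rightarrow> real \<Rightarrow> real \<Rightarrow> real ^ 'n ^ 'n \<Rightarrow> real ^ 'n \<Rightarrow> real \<Rightarrow> real \<Rightarrow> real ^ 'n"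
  where
  "rescaled \<gamma> p \<tau> A b = (let l = curvature \<gamma> p \<tau> in
     by_arclength (\<lambda>x t. l *\<^sub>R (A *v \<gamma> x (\<tau> + t / l\<^sup>2) + b)) p)"

definition rescaled_times :: "real \<Rightarrow> (real \<Rightarrow> real \<Rightarrow> real ^ 'n) \<Rightarrow> real \<Rightarrow> real \<Rightarrow> real set" where
  "rescaled_times \<omega> \<gamma> p \<tau> =
     (let l = curvature \<gamma> p \<tau> in {- (l\<^sup>2) * \<tau> ..< l\<^sup>2 * (\<omega> - \<tau>)})"

text \<open>
  Gram--Schmidt on \<open>d 0, d 1, \<dots>\<close>; applied to the derivatives \<open>c', c'', \<dots>\<close> of an arclength
  parametrised curve it yields the Frenet--Serret vectors \<open>T, N, B\<^sub>1, \<dots>\<close>.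
\<close>

fun gram_schmidt_vec :: "(nat \<Rightarrow> 'a::real_inner) \<Rightarrow> nat \<Rightarrow> 'a" where
  "gram_schmidt_vec d k =
     sgn (d k - (\<Sum>i<k. (d k \<bullet> gram_schmidt_vec d i) *\<^sub>R gram_schmidt_vec d i))"

declare gram_schmidt_vec.simps [simp del]

text \<open>
  The curve \<open>c\<close> passes through the origin at parameter \<open>0\<close> with its Frenet--Serret frame there,
  as far as it is defined, the standard basis in the order given by \<open>e\<close>. The \<open>k\<close>-th frame vector is
  defined if the first \<open>k\<close> derivatives of \<open>c\<close> are linearly independent. As usual for
  Frenet--Serret frames in oriented \<open>n\<close>-space, the last vector is not obtained from the
  \<open>n\<close>-th derivative but completes the others to a positively oriented orthonormal basis; it
  is thus carried to the last basis vector by any rotation doing so for the others, and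
  imposes no condition. (For \<open>n = 2\<close> this means that \<open>N\<close> goes to \<open>e\<^sub>2\<close> or \<open>-e\<^sub>2\<close>, according to the sense
  in which the curve turns; no rotation could do better.)
\<close>

definition frame_normalised :: "(nat \<Rightarrow> 'n::finite) \<Rightarrow> (real \<Rightarrow> real ^ 'n) \<Rightarrow> bool" where
  "frame_normalised e c \<longleftrightarrow> c 0 = 0 \<and>
     (let d = (\<lambda>k. ((\<lambda>f x. vector_derivative f (at x)) ^^ Suc k) c 0)
      in \<forall>k. Suc k < CARD('n) \<longrightarrow> inj_on d {..k} \<longrightarrow> independent (d ` {..k}) \<longrightarrow>
           gram_schmidt_vec d k = axis (e k) 1)"

text \<open>
  Smooth convergence, uniform on compact subsets of \<open>\<real> \<times> J\<close>, of families \<open>f j\<close> defined for times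
  in \<open>I j\<close> to a family \<open>g\<close> defined for times in \<open>J\<close>.
\<close>

definition converges_smoothly ::
    "(nat \<Rightarrow> real set) \<Rightarrow> (nat \<Rightarrow> real \<Rightarrow> real \<Rightarrow> 'a::real_normed_vector) \<Rightarrow>
     real set \<Rightarrow> (real \<Rightarrow> real \<Rightarrow> 'a) \<Rightarrow> bool" where
  "converges_smoothly I f J g \<longleftrightarrow> (\<forall>C. compact C \<longrightarrow> C \<subseteq> UNIV \<times> J \<longrightarrow>
     (\<forall>\<^sub>F j in sequentially. C \<subseteq> UNIV \<times> I j) \<and>
     (\<forall>i k. uniform_limit C (\<lambda>j (s, t). pd (I j) i k (f j) s t)
                            (\<lambda>(s, t). pd J i k g s t) sequentially))"

text \<open>
  Smooth solutions, for curves on \<open>\<real>\<close> parametrised by arclength. Keeping every curve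
  parametrised by arclength adds a tangential term to \<open>\<partial>\<gamma>/\<partial>t\<close>, so the flow equation is
  imposed on the normal component of the velocity; this is curve shortening flow up to
  reparametrisation.
\<close>

definition arclength_csf :: "real set \<Rightarrow> (real \<Rightarrow> real \<Rightarrow> 'a::real_inner) \<Rightarrow> bool" where
  "arclength_csf J \<gamma> \<longleftrightarrow> smooth_family J \<gamma> \<and> (\<forall>s. \<forall>t\<in>J.
     norm (dx \<gamma> s t) = 1 \<and>
     dt J \<gamma> s t - (dt J \<gamma> s t \<bullet> dx \<gamma> s t) *\<^sub>R dx \<gamma> s t = curv_vec \<gamma> s t)"

end

theory Submission
  imports Defs "HOL-Complex_Analysis.Great_Picard" "HOL-Library.Diagonal_Subsequence"
begin

text \<open>
  The rescaled flows are compact because curve shortening flow smooths. Parametrised by arclength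
  from the base point, each of them solves
  \<open>f\<^sub>t = f\<^sub>s\<^sub>s + \<alpha> f\<^sub>s\<close> with \<open>\<bar>f\<^sub>s\<bar> = 1\<close>, where the tangential speed \<open>\<alpha>\<close> is determined by
  \<open>\<alpha>\<^sub>s = \<bar>f\<^sub>s\<^sub>s\<bar>\<^sup>2\<close> and \<open>\<alpha> = 0\<close> at \<open>s = 0\<close> (locale \<open>pinned_flow\<close>,
  \<open>closed_flow.pinned_flow_by_arclength\<close>). Rescaling turns the hypothesis that the blow-up
  sequence is essential into the bound \<open>\<bar>f\<^sub>s\<^sub>s\<bar>\<^sup>2 \<le> 1/\<rho>\<close> for all times up to \<open>0\<close>, the same for every member
  of the sequence, and the time intervals exhaust \<open>(-\<infinity>, 0]\<close>.

  A curvature bound controls everything else. Write \<open>D\<^sub>m\<close> for the \<open>m\<close>-th arclength derivative of \<open>f\<close>.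
  Then \<open>\<partial>\<^sub>t D\<^sub>m = D\<^sub>m\<^sub>+\<^sub>2 + \<alpha> D\<^sub>m\<^sub>+\<^sub>1 + R\<^sub>m\<close>, where \<open>R\<^sub>m\<close> is a sum of terms
  \<open>(D\<^sub>a \<bullet> D\<^sub>b) D\<^sub>c\<close> with \<open>a, b \<ge> 2\<close> and \<open>a + b + c = m + 4\<close>
  (\<open>pinned_flow.evolution\<close>, \<open>reaction_weight\<close>). Counting weights, \<open>2 D\<^sub>m \<bullet> R\<^sub>m\<close> is at most
  \<open>\<bar>D\<^sub>m\<^sub>+\<^sub>1\<bar>\<^sup>2 + C (1 + \<bar>D\<^sub>m\<bar>\<^sup>2)\<close> once the lower derivatives are bounded (\<open>reaction_bound\<close>), and the good
  term \<open>-2 \<bar>D\<^sub>m\<^sub>+\<^sub>1\<bar>\<^sup>2\<close> from diffusion absorbs the first summand. The maximum principle applied to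
  \<open>(t - a) \<bar>D\<^sub>m\<bar>\<^sup>2 + B \<bar>D\<^sub>m\<^sub>-\<^sub>1\<bar>\<^sup>2\<close> then bounds \<open>D\<^sub>m\<close> after one unit of time (\<open>pinned_flow.bernstein\<close>).
  The nonlocal coefficient \<open>\<alpha>\<close> does no harm there, since it multiplies a spatial derivative, which vanishes
  at a maximum; and waiting for \<open>m\<close> units of time costs nothing on intervals that exhaust \<open>(-\<infinity>, 0]\<close>
  (\<open>pinned_flow.derivative_estimate\<close>). Time derivatives are bounded through the equation, one order at a time:
  a bound on \<open>k\<close> time derivatives of \<open>f\<close> gives one on \<open>k\<close> time derivatives of \<open>\<bar>f\<^sub>s\<^sub>s\<bar>\<^sup>2\<close>, hence of
  its antiderivative \<open>\<alpha>\<close>, hence of \<open>f\<^sub>t\<close> (\<open>flow_sequence.bounded_all_derivs\<close>).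

  The theorem of Arzela and Ascoli and a diagonal argument give a subsequence along which all
  derivatives converge locally uniformly (\<open>flow_sequence.convergent_subsequence\<close>). Unit speed and the flow
  equation pass to the limit. So does \<open>\<bar>f\<^sub>s\<^sub>s\<bar> = 1\<close> at \<open>(0, 0)\<close>, which was the normalisation, and a unit
  speed curve with nonzero curvature somewhere is not contained in a line
  (\<open>curved_imp_not_collinear\<close>).
\<close>

section \<open>Smooth functions of space and time\<close>

abbreviation dT :: "(real \<Rightarrow> real \<Rightarrow> 'a::real_normed_vector) \<Rightarrow> real \<Rightarrow> real \<Rightarrow> 'a" where
  "dT \<equiv> dt UNIV"

text \<open>
  All functions are studied over open sets \<open>J\<close> of times, so that time derivatives are two-sided; nothing
  is assumed about their values at other times.
\<close>

definition cont :: "real set \<Rightarrow> (real \<Rightarrow> real \<Rightarrow> 'a::real_normed_vector) \<Rightarrow> bool" where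
  "cont J f \<longleftrightarrow> continuous_on (UNIV \<times> J) (\<lambda>(x, t). f x t)"

definition is_dx :: "real set \<Rightarrow> (real \<Rightarrow> real \<Rightarrow> 'a::real_normed_vector) \<Rightarrow> (real \<Rightarrow> real \<Rightarrow> 'a) \<Rightarrow> bool" where
  "is_dx J f g \<longleftrightarrow> (\<forall>x. \<forall>t\<in>J. ((\<lambda>y. f y t) has_vector_derivative g x t) (at x))"

definition is_dt :: "real set \<Rightarrow> (real \<Rightarrow> real \<Rightarrow> 'a::real_normed_vector) \<Rightarrow> (real \<Rightarrow> real \<Rightarrow> 'a) \<Rightarrow> bool" where
  "is_dt J f g \<longleftrightarrow> (\<forall>x. \<forall>t\<in>J. (f x has_vector_derivative g x t) (at t))"

text \<open>
  \<open>m\<close> times continuously differentiable, by recursion on \<open>m\<close>. In this form closure under a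
  nonlinear operation needs only its first derivative expressed through operations already treated.
\<close>

primrec Ck :: "real set \<Rightarrow> nat \<Rightarrow> (real \<Rightarrow> real \<Rightarrow> 'a::real_normed_vector) \<Rightarrow> bool" where
  "Ck J 0 f \<longleftrightarrow> cont J f"
| "Ck J (Suc m) f \<longleftrightarrow> cont J f \<and> (\<exists>g h. is_dx J f g \<and> is_dt J f h \<and> Ck J m g \<and> Ck J m h)"

definition smooth :: "real set \<Rightarrow> (real \<Rightarrow> real \<Rightarrow> 'a::real_normed_vector) \<Rightarrow> bool" where
  "smooth J f \<longleftrightarrow> (\<forall>m. Ck J m f)"

subsection \<open>Congruence\<close>

lemma dx_eqI: "is_dx J f g \<Longrightarrow> t \<in> J \<Longrightarrow> dx f x t = g x t"
  unfolding is_dx_def dx_def by (simp add: vector_derivative_at)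

lemma dT_eqI: "is_dt J f g \<Longrightarrow> t \<in> J \<Longrightarrow> dT f x t = g x t"
  unfolding is_dt_def dt_def by (simp add: vector_derivative_at)

lemma cont_cong: "(\<And>x t. t \<in> J \<Longrightarrow> f x t = g x t) \<Longrightarrow> cont J f \<Longrightarrow> cont J g"
  unfolding cont_def by (erule continuous_on_eq) auto

lemma is_dx_cong:
  assumes "\<And>x t. t \<in> J \<Longrightarrow> f x t = f' x t" "\<And>x t. t \<in> J \<Longrightarrow> g x t = g' x t" "is_dx J f g"
  shows "is_dx J f' g'"
  using assms by (auto simp: is_dx_def)

lemma is_dt_cong:
  assumes "open J" "\<And>x t. t \<in> J \<Longrightarrow> f x t = f' x t" "\<And>x t. t \<in> J \<Longrightarrow> g x t = g' x t" "is_dt J f g"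
  shows "is_dt J f' g'"
  unfolding is_dt_def
proof (intro allI ballI)
  fix x t assume t: "t \<in> J"
  have "(f x has_vector_derivative g' x t) (at t)" using assms t by (auto simp: is_dt_def)
  then show "(f' x has_vector_derivative g' x t) (at t)"
    by (rule has_vector_derivative_transform_within_open[OF _ \<open>open J\<close> t]) (use assms in auto)
qed

lemma Ck_cong:
  assumes "open J" "\<And>x t. t \<in> J \<Longrightarrow> f x t = g x t" "Ck J m f"
  shows "Ck J m g"
proof (cases m)
  case 0
  then show ?thesis using assms cont_cong[of J f g] by auto
next
  case (Suc n)
  then obtain u v where "cont J f" "is_dx J f u" "is_dt J f v" "Ck J n u" "Ck J n v"
    using assms by auto
  moreover have "cont J g" using cont_cong[of J f g] assms \<open>cont J f\<close> by auto
  moreover have "is_dx J g u" using is_dx_cong[of J f g u u] assms \<open>is_dx J f u\<close> by auto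
  moreover have "is_dt J g v" using is_dt_cong[of J f g v v] assms \<open>is_dt J f v\<close> by auto
  ultimately show ?thesis using Suc by auto
qed

lemma smooth_cong:
  assumes "open J" "\<And>x t. t \<in> J \<Longrightarrow> f x t = g x t" "smooth J f"
  shows "smooth J g"
  using Ck_cong[of J f g] assms unfolding smooth_def by blast

lemma dx_cong: "(\<And>x. f x t = g x t) \<Longrightarrow> dx f x t = dx g x t"
  by (simp add: dx_def)

lemma dT_cong:
  assumes "open J" "\<And>t. t \<in> J \<Longrightarrow> f x t = g x t" "t \<in> J"
  shows "dT f x t = dT g x t"
proof -
  have "(f x has_vector_derivative y) (at t) \<longleftrightarrow> (g x has_vector_derivative y) (at t)" for y
    using has_vector_derivative_transform_within_open[OF _ assms(1,3)] assms(2) by metis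
  then show ?thesis by (simp add: dt_def vector_derivative_def)
qed

lemma Ck_mono: "Ck J (Suc m) f \<Longrightarrow> Ck J m f"
proof (induction m arbitrary: f)
  case (Suc m)
  then obtain g h where "cont J f" "is_dx J f g" "is_dt J f h" "Ck J (Suc m) g" "Ck J (Suc m) h"
    unfolding Ck.simps(2)[of J "Suc m"] by blast
  moreover from this have "Ck J m g" "Ck J m h" using Suc.IH by blast+
  ultimately show ?case by auto
qed simp

subsection \<open>Derivatives of smooth functions\<close>

lemma smooth_cont: "smooth J f \<Longrightarrow> cont J f"
  unfolding smooth_def using Ck.simps(1) by blast

lemma smooth_is_dx: assumes "smooth J f" shows "is_dx J f (dx f)"
proof -
  have "Ck J (Suc 0) f" using assms unfolding smooth_def by blast
  then obtain g where g: "is_dx J f g" by auto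
  show ?thesis by (rule is_dx_cong[OF _ _ g]) (simp_all add: dx_eqI[OF g])
qed

lemma smooth_is_dt: assumes "open J" "smooth J f" shows "is_dt J f (dT f)"
proof -
  have "Ck J (Suc 0) f" using assms unfolding smooth_def by blast
  then obtain g where g: "is_dt J f g" by auto
  show ?thesis by (rule is_dt_cong[OF \<open>open J\<close> _ _ g]) (simp_all add: dT_eqI[OF g])
qed

lemma smooth_dx: assumes "open J" "smooth J f" shows "smooth J (dx f)"
  unfolding smooth_def
proof
  fix m
  have "Ck J (Suc m) f" using assms unfolding smooth_def by blast
  then obtain g where g: "is_dx J f g" "Ck J m g" by auto
  show "Ck J m (dx f)"
    by (rule Ck_cong[OF \<open>open J\<close> _ g(2)]) (simp add: dx_eqI[OF g(1)])
qed

lemma smooth_dT: assumes "open J" "smooth J f" shows "smooth J (dT f)"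
  unfolding smooth_def
proof
  fix m
  have "Ck J (Suc m) f" using assms unfolding smooth_def by blast
  then obtain g where g: "is_dt J f g" "Ck J m g" by auto
  show "Ck J m (dT f)"
    by (rule Ck_cong[OF \<open>open J\<close> _ g(2)]) (simp add: dT_eqI[OF g(1)])
qed

lemma smooth_dxD: "smooth J f \<Longrightarrow> t \<in> J \<Longrightarrow> ((\<lambda>y. f y t) has_vector_derivative dx f x t) (at x)"
  using smooth_is_dx by (auto simp: is_dx_def)

lemma smooth_dTD: "open J \<Longrightarrow> smooth J f \<Longrightarrow> t \<in> J \<Longrightarrow> (f x has_vector_derivative dT f x t) (at t)"
  using smooth_is_dt by (auto simp: is_dt_def)

text \<open>
  Differentiation never leaves the class \<open>X\<close>, so it can be repeated. This is the tool for operations whose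
  derivatives are again of the form considered.
\<close>

lemma smooth_coinduct:
  assumes "X f"
    and "\<And>f. X f \<Longrightarrow> cont J f \<and> (\<exists>g h. is_dx J f g \<and> is_dt J f h \<and> X g \<and> X h)"
  shows "smooth J f"
proof -
  have "\<forall>f. X f \<longrightarrow> Ck J m f" for m
  proof (induction m)
    case 0
    show ?case unfolding Ck.simps using assms(2) by blast
  next
    case (Suc m)
    show ?case unfolding Ck.simps using assms(2) Suc by meson
  qed
  then show ?thesis using assms(1) by (auto simp: smooth_def)
qed

subsection \<open>Closure properties\<close>

lemma cont_add: "cont J f \<Longrightarrow> cont J g \<Longrightarrow> cont J (\<lambda>x t. f x t + g x t)"
  unfolding cont_def case_prod_unfold by (intro continuous_intros)

lemma is_dx_add: "is_dx J f f' \<Longrightarrow> is_dx J g g' \<Longrightarrow> is_dx J (\<lambda>x t. f x t + g x t) (\<lambda>x t. f' x t + g' x t)"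
  unfolding is_dx_def by (auto intro!: derivative_intros)

lemma is_dt_add: "is_dt J f f' \<Longrightarrow> is_dt J g g' \<Longrightarrow> is_dt J (\<lambda>x t. f x t + g x t) (\<lambda>x t. f' x t + g' x t)"
  unfolding is_dt_def by (auto intro!: derivative_intros)

lemma Ck_add: "Ck J m f \<Longrightarrow> Ck J m g \<Longrightarrow> Ck J m (\<lambda>x t. f x t + g x t)"
proof (induction m arbitrary: f g)
  case (Suc m)
  obtain f1 f2 where f: "cont J f" "is_dx J f f1" "is_dt J f f2" "Ck J m f1" "Ck J m f2"
    using Suc.prems by auto
  obtain g1 g2 where g: "cont J g" "is_dx J g g1" "is_dt J g g2" "Ck J m g1" "Ck J m g2"
    using Suc.prems by auto
  show ?case
    using cont_add[OF f(1) g(1)] is_dx_add[OF f(2) g(2)] is_dt_add[OF f(3) g(3)]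
      Suc.IH[OF f(4) g(4)] Suc.IH[OF f(5) g(5)] unfolding Ck.simps by blast
qed (simp add: cont_add)

lemma smooth_add: "smooth J f \<Longrightarrow> smooth J g \<Longrightarrow> smooth J (\<lambda>x t. f x t + g x t)"
  unfolding smooth_def using Ck_add by blast

context bounded_bilinear
begin

lemma cont_prod: "cont J f \<Longrightarrow> cont J g \<Longrightarrow> cont J (\<lambda>x t. prod (f x t) (g x t))"
  unfolding cont_def case_prod_unfold by (intro continuous_on)

lemma is_dx_prod: "is_dx J f f' \<Longrightarrow> is_dx J g g' \<Longrightarrow>
    is_dx J (\<lambda>x t. prod (f x t) (g x t)) (\<lambda>x t. prod (f x t) (g' x t) + prod (f' x t) (g x t))"
  unfolding is_dx_def by (auto intro!: has_vector_derivative)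

lemma is_dt_prod: "is_dt J f f' \<Longrightarrow> is_dt J g g' \<Longrightarrow>
    is_dt J (\<lambda>x t. prod (f x t) (g x t)) (\<lambda>x t. prod (f x t) (g' x t) + prod (f' x t) (g x t))"
  unfolding is_dt_def by (auto intro!: has_vector_derivative)

lemma Ck_prod: "Ck J m f \<Longrightarrow> Ck J m g \<Longrightarrow> Ck J m (\<lambda>x t. prod (f x t) (g x t))"
proof (induction m arbitrary: f g)
  case 0
  then show ?case using cont_prod by auto
next
  case (Suc m)
  obtain f1 f2 where f: "cont J f" "is_dx J f f1" "is_dt J f f2" "Ck J m f1" "Ck J m f2"
    using Suc.prems by auto
  obtain g1 g2 where g: "cont J g" "is_dx J g g1" "is_dt J g g2" "Ck J m g1" "Ck J m g2"
    using Suc.prems by auto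
  have "Ck J m f" "Ck J m g" using Suc.prems Ck_mono by blast+
  then have "Ck J m (\<lambda>x t. prod (f x t) (g1 x t) + prod (f1 x t) (g x t))"
    "Ck J m (\<lambda>x t. prod (f x t) (g2 x t) + prod (f2 x t) (g x t))"
    using Suc.IH f g by (auto intro!: Ck_add)
  then show ?case
    using cont_prod[OF f(1) g(1)] is_dx_prod[OF f(2) g(2)] is_dt_prod[OF f(3) g(3)]
    unfolding Ck.simps by blast
qed

lemma smooth_prod: "smooth J f \<Longrightarrow> smooth J g \<Longrightarrow> smooth J (\<lambda>x t. prod (f x t) (g x t))"
  unfolding smooth_def using Ck_prod by blast

lemma dx_prod: "smooth J f \<Longrightarrow> smooth J g \<Longrightarrow> t \<in> J \<Longrightarrow>
    dx (\<lambda>x t. prod (f x t) (g x t)) x t = prod (f x t) (dx g x t) + prod (dx f x t) (g x t)"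
  by (rule dx_eqI[OF is_dx_prod]) (auto intro: smooth_is_dx)

lemma dT_prod: "open J \<Longrightarrow> smooth J f \<Longrightarrow> smooth J g \<Longrightarrow> t \<in> J \<Longrightarrow>
    dT (\<lambda>x t. prod (f x t) (g x t)) x t = prod (f x t) (dT g x t) + prod (dT f x t) (g x t)"
  by (rule dT_eqI[OF is_dt_prod]) (auto intro: smooth_is_dt)

end

lemmas smooth_scaleR = bounded_bilinear.smooth_prod[OF bounded_bilinear_scaleR]
lemmas smooth_mult = bounded_bilinear.smooth_prod[OF bounded_bilinear_mult]
lemmas smooth_inner = bounded_bilinear.smooth_prod[OF bounded_bilinear_inner]

lemma dx_add: "smooth J f \<Longrightarrow> smooth J g \<Longrightarrow> t \<in> J \<Longrightarrow>
    dx (\<lambda>x t. f x t + g x t) x t = dx f x t + dx g x t"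
  by (rule dx_eqI[OF is_dx_add]) (auto intro: smooth_is_dx)

lemma dT_add: "open J \<Longrightarrow> smooth J f \<Longrightarrow> smooth J g \<Longrightarrow> t \<in> J \<Longrightarrow>
    dT (\<lambda>x t. f x t + g x t) x t = dT f x t + dT g x t"
  by (rule dT_eqI[OF is_dt_add]) (auto intro: smooth_is_dt)

lemma smooth_const: "smooth J (\<lambda>x t. c)"
proof (rule smooth_coinduct[where X = "\<lambda>f. \<exists>c. f = (\<lambda>x t. c)"])
  show "\<exists>d. (\<lambda>x t. c) = (\<lambda>x t. d)" by blast
next
  fix f :: "real \<Rightarrow> real \<Rightarrow> 'a" assume "\<exists>c. f = (\<lambda>x t. c)"
  then obtain c where f: "f = (\<lambda>x t. c)" by blast
  have "cont J f" "is_dx J f (\<lambda>x t. 0)" "is_dt J f (\<lambda>x t. 0)"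
    unfolding f by (auto simp: cont_def is_dx_def is_dt_def case_prod_unfold)
  then show "cont J f \<and> (\<exists>g h. is_dx J f g \<and> is_dt J f h \<and> (\<exists>c. g = (\<lambda>x t. c)) \<and> (\<exists>c. h = (\<lambda>x t. c)))"
    by blast
qed

lemma smooth_linear:
  assumes "open J" "bounded_linear L" "smooth J f"
  shows "smooth J (\<lambda>x t. L (f x t))"
proof (rule smooth_coinduct[where X = "\<lambda>h. \<exists>f. smooth J f \<and> h = (\<lambda>x t. L (f x t))"])
  show "\<exists>g. smooth J g \<and> (\<lambda>x t. L (f x t)) = (\<lambda>x t. L (g x t))" using assms by blast
next
  fix h assume "\<exists>f. smooth J f \<and> h = (\<lambda>x t. L (f x t))"
  then obtain f where f: "smooth J f" "h = (\<lambda>x t. L (f x t))" by blast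
  have "cont J h" using smooth_cont[OF f(1)] unfolding f cont_def case_prod_unfold
    by (rule bounded_linear.continuous_on[OF assms(2)])
  moreover have "is_dx J h (\<lambda>x t. L (dx f x t))" "is_dt J h (\<lambda>x t. L (dT f x t))"
    unfolding is_dx_def is_dt_def f(2)
    using smooth_dxD[OF f(1)] smooth_dTD[OF assms(1) f(1)]
    by (auto intro: bounded_linear.has_vector_derivative[OF assms(2)])
  ultimately show "cont J h \<and> (\<exists>g k. is_dx J h g \<and> is_dt J h k \<and>
      (\<exists>f. smooth J f \<and> g = (\<lambda>x t. L (f x t))) \<and> (\<exists>f. smooth J f \<and> k = (\<lambda>x t. L (f x t))))"
    using smooth_dx[OF assms(1) f(1)] smooth_dT[OF assms(1) f(1)] by blast
qed

lemma smooth_uminus: "open J \<Longrightarrow> smooth J f \<Longrightarrow> smooth J (\<lambda>x t. - f x t)"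
  using smooth_linear[of J uminus f] bounded_linear_minus[OF bounded_linear_ident] by auto

lemma dx_linear: "smooth J f \<Longrightarrow> bounded_linear L \<Longrightarrow> t \<in> J \<Longrightarrow> dx (\<lambda>x t. L (f x t)) x t = L (dx f x t)"
  by (rule dx_eqI[where J=J])
     (auto simp: is_dx_def intro: bounded_linear.has_vector_derivative smooth_dxD)

text \<open>
  The derivatives of \<open>1/f\<close> are products of derivatives of \<open>f\<close> with \<open>1/f\<close> itself, whose
  regularity up to one order less is the induction hypothesis.
\<close>

lemma Ck_inverse:
  fixes f :: "real \<Rightarrow> real \<Rightarrow> real"
  assumes "\<And>x t. t \<in> J \<Longrightarrow> f x t \<noteq> 0"
  shows "Ck J m f \<Longrightarrow> Ck J m (\<lambda>x t. inverse (f x t))"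
proof (induction m)
  case 0
  then show ?case using assms unfolding Ck.simps cont_def case_prod_unfold
    by (intro continuous_intros) auto
next
  case (Suc m)
  let ?w = "\<lambda>x t. inverse (f x t)"
  obtain f1 f2 where f: "cont J f" "is_dx J f f1" "is_dt J f f2" "Ck J m f1" "Ck J m f2"
    using Suc.prems by auto
  have w: "Ck J m ?w" using Suc Ck_mono by blast
  have c: "cont J ?w" using f(1) assms unfolding cont_def case_prod_unfold
    by (intro continuous_intros) auto
  have C: "Ck J m (\<lambda>x t. (- 1) * (g x t * (?w x t * ?w x t)))" if "Ck J m g" for g
    using w that smooth_const[of J "-1 :: real"]
    by (intro bounded_bilinear.Ck_prod[OF bounded_bilinear_mult]) (auto simp: smooth_def)
  have "is_dx J ?w (\<lambda>x t. (- 1) * (f1 x t * (?w x t * ?w x t)))"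
    "is_dt J ?w (\<lambda>x t. (- 1) * (f2 x t * (?w x t * ?w x t)))"
    using f(2,3) assms unfolding is_dx_def is_dt_def
    by (auto simp: has_real_derivative_iff_has_vector_derivative[symmetric] power2_eq_square
        intro!: derivative_eq_intros)
  then show ?case using c C[OF f(4)] C[OF f(5)] unfolding Ck.simps by blast
qed

lemma smooth_inverse:
  fixes f :: "real \<Rightarrow> real \<Rightarrow> real"
  assumes "\<And>x t. t \<in> J \<Longrightarrow> f x t \<noteq> 0" "smooth J f"
  shows "smooth J (\<lambda>x t. inverse (f x t))"
  using assms(2) Ck_inverse[OF assms(1)] by (simp add: smooth_def)

lemma Ck_sqrt:
  fixes f :: "real \<Rightarrow> real \<Rightarrow> real"
  assumes "\<And>x t. t \<in> J \<Longrightarrow> f x t > 0"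
  shows "Ck J m f \<Longrightarrow> Ck J m (\<lambda>x t. sqrt (f x t))"
proof (induction m)
  case 0
  then show ?case unfolding Ck.simps cont_def case_prod_unfold
    by (intro continuous_intros)
next
  case (Suc m)
  let ?w = "\<lambda>x t. sqrt (f x t)"
  obtain f1 f2 where f: "cont J f" "is_dx J f f1" "is_dt J f f2" "Ck J m f1" "Ck J m f2"
    using Suc.prems by auto
  have "Ck J m ?w" using Suc Ck_mono by blast
  moreover have "?w x t \<noteq> 0" if "t \<in> J" for x t using assms[OF that, of x] by simp
  ultimately have w: "Ck J m (\<lambda>x t. inverse (?w x t))" by (intro Ck_inverse)
  have c: "cont J ?w" using f(1) unfolding cont_def case_prod_unfold
    by (intro continuous_intros)
  have C: "Ck J m (\<lambda>x t. (1/2) * (g x t * inverse (?w x t)))" if "Ck J m g" for g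
    using w that smooth_const[of J "1/2 :: real"]
    by (intro bounded_bilinear.Ck_prod[OF bounded_bilinear_mult]) (auto simp: smooth_def)
  have "is_dx J ?w (\<lambda>x t. (1/2) * (f1 x t * inverse (?w x t)))"
    "is_dt J ?w (\<lambda>x t. (1/2) * (f2 x t * inverse (?w x t)))"
    using f(2,3) assms unfolding is_dx_def is_dt_def has_real_derivative_iff_has_vector_derivative[symmetric]
    by (auto intro!: DERIV_cong[OF DERIV_chain2[OF DERIV_real_sqrt]])
  then show ?case using c C[OF f(4)] C[OF f(5)] unfolding Ck.simps by blast
qed

lemma smooth_norm:
  fixes f :: "real \<Rightarrow> real \<Rightarrow> 'a::real_inner"
  assumes "\<And>x t. t \<in> J \<Longrightarrow> f x t \<noteq> 0" "smooth J f"
  shows "smooth J (\<lambda>x t. norm (f x t))"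
  using Ck_sqrt[of J "\<lambda>x t. f x t \<bullet> f x t"] smooth_inner[OF assms(2,2)] assms(1)
  by (simp add: smooth_def norm_eq_sqrt_inner)

lemma smooth_time_affine:
  assumes "open J" "smooth J f"
  shows "smooth ((\<lambda>t. \<tau> + t * c) -` J) (\<lambda>x t. f x (\<tau> + t * c))"
    (is "smooth ?J _")
proof (rule smooth_coinduct[where X = "\<lambda>h. \<exists>f a. smooth J f \<and> h = (\<lambda>x t. a *\<^sub>R f x (\<tau> + t * c))"])
  show "\<exists>g a. smooth J g \<and> (\<lambda>x t. f x (\<tau> + t * c)) = (\<lambda>x t. a *\<^sub>R g x (\<tau> + t * c))"
    using assms by (intro exI[of _ f] exI[of _ 1]) auto
next
  fix h :: "real \<Rightarrow> real \<Rightarrow> 'a"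
  assume "\<exists>f a. smooth J f \<and> h = (\<lambda>x t. a *\<^sub>R f x (\<tau> + t * c))"
  then obtain f a where f: "smooth J f" "h = (\<lambda>x t. a *\<^sub>R f x (\<tau> + t * c))" by blast
  have "continuous_on (UNIV \<times> ?J) (\<lambda>z. (\<lambda>(x, t). f x t) (fst z, \<tau> + snd z * c))"
    by (rule continuous_on_compose2[OF smooth_cont[OF f(1), unfolded cont_def]])
       (auto intro!: continuous_intros)
  then have "cont ?J h"
    unfolding f cont_def case_prod_unfold fst_conv snd_conv by (intro continuous_intros)
  moreover have "is_dx ?J h (\<lambda>x t. a *\<^sub>R dx f x (\<tau> + t * c))"
    unfolding is_dx_def f(2)
    using smooth_dxD[OF f(1)] by (auto intro!: derivative_eq_intros)
  moreover have "is_dt ?J h (\<lambda>x t. (a * c) *\<^sub>R dT f x (\<tau> + t * c))"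
    unfolding is_dt_def f(2)
  proof (intro allI ballI)
    fix x t assume t: "t \<in> ?J"
    have "((\<lambda>t. \<tau> + t * c) has_vector_derivative c) (at t)"
      by (auto intro!: derivative_eq_intros)
    moreover have "(f x has_vector_derivative dT f x (\<tau> + t * c)) (at (\<tau> + t * c))"
      using smooth_dTD[OF assms(1) f(1)] t by auto
    ultimately have "(f x \<circ> (\<lambda>t. \<tau> + t * c) has_vector_derivative c *\<^sub>R dT f x (\<tau> + t * c)) (at t)"
      by (rule vector_diff_chain_at)
    from bounded_linear.has_vector_derivative[OF bounded_linear_scaleR_right[of a] this]
    show "((\<lambda>t. a *\<^sub>R f x (\<tau> + t * c)) has_vector_derivative (a * c) *\<^sub>R dT f x (\<tau> + t * c)) (at t)"
      by (simp add: o_def)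
  qed
  ultimately show "cont ?J h \<and> (\<exists>g k. is_dx ?J h g \<and> is_dt ?J h k \<and>
      (\<exists>f a. smooth J f \<and> g = (\<lambda>x t. a *\<^sub>R f x (\<tau> + t * c))) \<and>
      (\<exists>f a. smooth J f \<and> k = (\<lambda>x t. a *\<^sub>R f x (\<tau> + t * c))))"
    using smooth_dx[OF assms(1) f(1)] smooth_dT[OF assms(1) f(1)] by blast
qed

subsection \<open>Mixed partial derivatives and antiderivatives\<close>

lemma cont_compose:
  assumes "cont J f" "continuous_on S u" "continuous_on S v" "\<And>z. z \<in> S \<Longrightarrow> v z \<in> J"
  shows "continuous_on S (\<lambda>z. f (u z) (v z))"
proof -
  have "continuous_on S (\<lambda>z. (\<lambda>(x, t). f x t) (u z, v z))"
    by (rule continuous_on_compose2[OF assms(1)[unfolded cont_def]])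
       (use assms in \<open>auto intro!: continuous_intros\<close>)
  then show ?thesis by simp
qed

text \<open>
  Only the partial derivatives that occur are assumed to exist, because smoothness of a family is
  given by one order of differentiation only. Integrating \<open>gx\<close> in space recovers \<open>g\<close> up to a function
  of time; differentiating under the integral sign exhibits \<open>gt\<close> as an antiderivative of \<open>gxt\<close>.
\<close>

lemma mixed_partials:
  fixes g :: "real \<Rightarrow> real \<Rightarrow> 'a::euclidean_space"
  assumes U: "open U" and gx: "is_dx U g gx" and gt: "is_dt U g gt" and gxt: "is_dt U gx gxt"
    and cont: "cont U gx" "cont U gxt"
  shows "is_dx U gt gxt"
  unfolding is_dx_def
proof (intro allI ballI)
  fix x t :: real assume t: "t \<in> U"
  then obtain e where e: "e > 0" "ball t e \<subseteq> U" using U open_contains_ball by blast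
  define a where "a = x - 1"
  have eq: "gt y t = gt a t + integral {a..y} (\<lambda>z. gxt z t)" if y: "a \<le> y" for y
  proof -
    have g: "g y s = g a s + integral (cbox a y) (\<lambda>z. gx z s)" if "s \<in> U" for s
    proof -
      have "((\<lambda>z. gx z s) has_integral g y s - g a s) {a..y}"
        using gx that by (intro fundamental_theorem_of_calculus y)
          (auto simp: is_dx_def intro: has_vector_derivative_at_within)
      then show ?thesis by (simp add: integral_unique)
    qed
    have "((\<lambda>s. integral (cbox a y) (\<lambda>z. gx z s)) has_vector_derivative integral (cbox a y) (\<lambda>z. gxt z t)) (at t within ball t e)"
    proof (rule leibniz_rule_vector_derivative)
      show "((\<lambda>s. gx z s) has_vector_derivative gxt z s) (at s within ball t e)" if "s \<in> ball t e" for s z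
        using gxt e that by (intro has_vector_derivative_at_within[where S="ball t e"]) (auto simp: is_dt_def)
      show "(\<lambda>z. gx z s) integrable_on cbox a y" if "s \<in> ball t e" for s
        by (rule integrable_continuous) (intro cont_compose[OF cont(1)] continuous_intros, use e that in auto)
      show "continuous_on (ball t e \<times> cbox a y) (\<lambda>(s, z). gxt z s)"
        unfolding case_prod_unfold
        by (intro cont_compose[OF cont(2)] continuous_intros) (use e in auto)
    qed (use e in auto)
    then have "((\<lambda>s. integral (cbox a y) (\<lambda>z. gx z s)) has_vector_derivative integral (cbox a y) (\<lambda>z. gxt z t)) (at t)"
      by (simp only: at_within_open[OF centre_in_ball[THEN iffD2, OF e(1)] open_ball])
    then have "((\<lambda>s. g a s + integral (cbox a y) (\<lambda>z. gx z s)) has_vector_derivative gt a t + integral (cbox a y) (\<lambda>z. gxt z t)) (at t)"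
      using gt t by (intro has_vector_derivative_add) (auto simp: is_dt_def)
    then have "(g y has_vector_derivative gt a t + integral (cbox a y) (\<lambda>z. gxt z t)) (at t)"
      by (rule has_vector_derivative_transform_within_open[OF _ U t]) (rule g[symmetric])
    moreover have "(g y has_vector_derivative gt y t) (at t)" using gt t by (auto simp: is_dt_def)
    ultimately show ?thesis using vector_derivative_unique_at by (simp add: cbox_interval) blast
  qed
  have "((\<lambda>y. integral {a..y} (\<lambda>z. gxt z t)) has_vector_derivative gxt x t) (at x within {a..x + 1})"
    by (rule integral_has_vector_derivative) (intro cont_compose[OF cont(2)] continuous_intros t, auto simp: a_def)
  then have "((\<lambda>y. gt a t + integral {a..y} (\<lambda>z. gxt z t)) has_vector_derivative gxt x t) (at x within {a..x + 1})"
    by (auto intro!: derivative_eq_intros)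
  moreover have "at x within {a..x + 1} = at x"
    by (rule at_within_interior) (simp add: a_def interior_atLeastAtMost_real)
  ultimately have "((\<lambda>y. gt a t + integral {a..y} (\<lambda>z. gxt z t)) has_vector_derivative gxt x t) (at x)" by simp
  then show "((\<lambda>y. gt y t) has_vector_derivative gxt x t) (at x)"
  proof (rule has_vector_derivative_transform_within_open[of _ _ _ "{a<..}"])
    show "gt a t + integral {a..y} (\<lambda>z. gxt z t) = gt y t" if "y \<in> {a<..}" for y
      by (rule eq[symmetric]) (use that in simp)
  qed (simp_all add: a_def)
qed

lemma schwarz:
  fixes f :: "real \<Rightarrow> real \<Rightarrow> 'a::euclidean_space"
  assumes J: "open J" and f: "smooth J f" and t: "t \<in> J"
  shows "dT (dx f) x t = dx (dT f) x t"
proof -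
  note p = smooth_dx[OF J f]
  have "is_dx J (dT f) (dT (dx f))"
    by (rule mixed_partials[OF J smooth_is_dx[OF f] smooth_is_dt[OF J f] smooth_is_dt[OF J p]
          smooth_cont[OF p] smooth_cont[OF smooth_dT[OF J p]]])
  from dx_eqI[OF this t] show ?thesis by simp
qed

text \<open>
  The antiderivative of \<open>f\<close> in space that vanishes at \<open>a\<close>. Integrating over the fixed interval \<open>[0, 1]\<close>
  avoids a case distinction on the sign of \<open>x - a\<close> and makes joint continuity and
  differentiation in time immediate.
\<close>

definition prim :: "real \<Rightarrow> (real \<Rightarrow> real \<Rightarrow> 'a::euclidean_space) \<Rightarrow> real \<Rightarrow> real \<Rightarrow> 'a" where
  "prim a f = (\<lambda>x t. (x - a) *\<^sub>R integral {0..1} (\<lambda>u. f (a + u * (x - a)) t))"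

text \<open>
  Differentiating under the integral sign leaves the integral over \<open>u\<close> of the derivative of
  \<open>u * f (a + u * (x - a)) t\<close>.
\<close>

lemma is_dx_prim:
  assumes J: "open J" and f: "smooth J f"
  shows "is_dx J (prim a f) f"
  unfolding is_dx_def
proof (intro allI ballI)
  fix x t assume t: "t \<in> J"
  have cf: "cont J f" "cont J (dx f)" using smooth_cont smooth_dx[OF J f] f by blast+
  let ?I = "\<lambda>x. integral (cbox 0 1) (\<lambda>u. f (a + u * (x - a)) t)"
  let ?I' = "\<lambda>x. integral (cbox 0 1) (\<lambda>u. u *\<^sub>R dx f (a + u * (x - a)) t)"
  have 1: "(?I has_vector_derivative ?I' x) (at x within UNIV)"
  proof (rule leibniz_rule_vector_derivative)
    fix y u :: real
    have "((\<lambda>y. f y t) \<circ> (\<lambda>y. a + u * (y - a)) has_vector_derivative u *\<^sub>R dx f (a + u * (y - a)) t) (at y)"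
      by (rule vector_diff_chain_at)
        (auto intro!: derivative_eq_intros smooth_dxD[OF f t])
    then show "((\<lambda>y. f (a + u * (y - a)) t) has_vector_derivative u *\<^sub>R dx f (a + u * (y - a)) t) (at y within UNIV)"
      by (simp add: o_def)
  next
    show "(\<lambda>u. f (a + u * (y - a)) t) integrable_on cbox 0 1" for y
      by (rule integrable_continuous) (intro cont_compose[OF cf(1)] continuous_intros t)
    show "continuous_on (UNIV \<times> cbox 0 1) (\<lambda>(x, u). u *\<^sub>R dx f (a + u * (x - a)) t)"
      unfolding case_prod_unfold by (intro cont_compose[OF cf(2)] continuous_intros t)
  qed auto
  have 2: "((\<lambda>x. (x - a) *\<^sub>R ?I x) has_vector_derivative ((x - a) *\<^sub>R ?I' x + 1 *\<^sub>R ?I x)) (at x)"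
    by (rule has_vector_derivative_scaleR) (use 1 in \<open>auto intro!: derivative_eq_intros\<close>)
  have "((\<lambda>u. u *\<^sub>R ((x - a) *\<^sub>R dx f (a + u * (x - a)) t) + 1 *\<^sub>R f (a + u * (x - a)) t)
      has_integral 1 *\<^sub>R f (a + 1 * (x - a)) t - 0 *\<^sub>R f (a + 0 * (x - a)) t) {0..1}"
  proof (rule fundamental_theorem_of_calculus)
    fix u :: real
    have "((\<lambda>y. f y t) \<circ> (\<lambda>u. a + u * (x - a)) has_vector_derivative (x - a) *\<^sub>R dx f (a + u * (x - a)) t) (at u)"
      by (rule vector_diff_chain_at)
        (auto intro!: derivative_eq_intros smooth_dxD[OF f t])
    then have "((\<lambda>u. u *\<^sub>R f (a + u * (x - a)) t) has_vector_derivative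
       (u *\<^sub>R ((x - a) *\<^sub>R dx f (a + u * (x - a)) t) + 1 *\<^sub>R f (a + u * (x - a)) t)) (at u)"
      by (intro has_vector_derivative_scaleR) (auto intro!: derivative_eq_intros simp: o_def)
    then show "((\<lambda>u. u *\<^sub>R f (a + u * (x - a)) t) has_vector_derivative
       (u *\<^sub>R ((x - a) *\<^sub>R dx f (a + u * (x - a)) t) + 1 *\<^sub>R f (a + u * (x - a)) t)) (at u within {0..1})"
      by (rule has_vector_derivative_at_within)
  qed simp
  then have 3: "integral {0..1} (\<lambda>u. u *\<^sub>R ((x - a) *\<^sub>R dx f (a + u * (x - a)) t) + f (a + u * (x - a)) t) = f x t"
    by (simp add: integral_unique)
  have "integral {0..1} (\<lambda>u. u *\<^sub>R ((x - a) *\<^sub>R dx f (a + u * (x - a)) t) + f (a + u * (x - a)) t)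
     = integral {0..1} (\<lambda>u. u *\<^sub>R ((x - a) *\<^sub>R dx f (a + u * (x - a)) t)) + ?I x"
    unfolding cbox_interval
    by (rule integral_add; rule integrable_continuous_real)
       (intro cont_compose[OF cf(2)] cont_compose[OF cf(1)] continuous_intros t)+
  also have "integral {0..1} (\<lambda>u. u *\<^sub>R ((x - a) *\<^sub>R dx f (a + u * (x - a)) t)) = (x - a) *\<^sub>R ?I' x"
    unfolding cbox_interval integral_cmul[symmetric] by (simp add: mult.commute)
  finally have "(x - a) *\<^sub>R ?I' x + 1 *\<^sub>R ?I x = f x t" using 3 by simp
  with 2 show "((\<lambda>y. prim a f y t) has_vector_derivative f x t) (at x)"
    unfolding prim_def cbox_interval by simp
qed

lemma is_dt_prim:
  assumes J: "open J" and f: "smooth J f"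
  shows "is_dt J (prim a f) (prim a (dT f))"
  unfolding is_dt_def
proof (intro allI ballI)
  fix x t assume t: "t \<in> J"
  then obtain e where e: "e > 0" "ball t e \<subseteq> J" using J open_contains_ball by blast
  have cf: "cont J f" "cont J (dT f)" using smooth_cont smooth_dT[OF J f] f by blast+
  let ?I = "\<lambda>t. integral (cbox 0 1) (\<lambda>u. f (a + u * (x - a)) t)"
  let ?I' = "\<lambda>t. integral (cbox 0 1) (\<lambda>u. dT f (a + u * (x - a)) t)"
  have "(?I has_vector_derivative ?I' t) (at t within ball t e)"
  proof (rule leibniz_rule_vector_derivative)
    fix s u :: real assume "s \<in> ball t e"
    then have s: "s \<in> J" using e by auto
    show "(f (a + u * (x - a)) has_vector_derivative dT f (a + u * (x - a)) s) (at s within ball t e)"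
      by (rule has_vector_derivative_at_within[OF smooth_dTD[OF J f s]])
  next
    fix s assume "s \<in> ball t e"
    then have s: "s \<in> J" using e by auto
    show "(\<lambda>u. f (a + u * (x - a)) s) integrable_on cbox 0 1"
      by (rule integrable_continuous) (intro cont_compose[OF cf(1)] continuous_intros s)
  next
    show "continuous_on (ball t e \<times> cbox 0 1) (\<lambda>(s, u). dT f (a + u * (x - a)) s)"
      unfolding case_prod_unfold
      by (intro cont_compose[OF cf(2)] continuous_intros) (use e(2) in \<open>auto dest: subsetD\<close>)
  qed (use e in auto)
  then have "(?I has_vector_derivative ?I' t) (at t)"
    by (simp only: at_within_open[OF centre_in_ball[THEN iffD2, OF e(1)] open_ball])
  from bounded_linear.has_vector_derivative[OF bounded_linear_scaleR_right this]
  show "(prim a f x has_vector_derivative prim a (dT f) x t) (at t)"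
    unfolding prim_def cbox_interval .
qed

lemma cont_prim:
  assumes "cont J f" shows "cont J (prim a f)"
proof -
  have "continuous_on (UNIV \<times> J) (\<lambda>z. integral (cbox 0 1) (\<lambda>u. f (a + u * (fst z - a)) (snd z)))"
    by (rule integral_continuous_on_param, unfold case_prod_unfold)
       (intro cont_compose[OF assms] continuous_intros; auto)
  then show ?thesis unfolding cont_def prim_def case_prod_unfold cbox_interval
    by (intro continuous_intros)
qed

lemma smooth_prim:
  assumes J: "open J" and f: "smooth J f"
  shows "smooth J (prim a f)"
proof (rule smooth_coinduct[where X = "\<lambda>h. smooth J h \<or> (\<exists>f. smooth J f \<and> h = prim a f)"])
  show "smooth J (prim a f) \<or> (\<exists>g. smooth J g \<and> prim a f = prim a g)" using f by blast
next
  fix h :: "real \<Rightarrow> real \<Rightarrow> 'a" assume "smooth J h \<or> (\<exists>f. smooth J f \<and> h = prim a f)"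
  then show "cont J h \<and> (\<exists>g k. is_dx J h g \<and> is_dt J h k \<and>
      (smooth J g \<or> (\<exists>f. smooth J f \<and> g = prim a f)) \<and> (smooth J k \<or> (\<exists>f. smooth J f \<and> k = prim a f)))"
    using is_dx_prim[OF J] is_dt_prim[OF J] cont_prim smooth_cont smooth_is_dx smooth_is_dt[OF J]
      smooth_dx[OF J] smooth_dT[OF J] by metis
qed

lemma prim_base: "prim a f a t = 0" by (simp add: prim_def)

lemma zero_dx_imp_const:
  fixes f :: "real \<Rightarrow> 'a::real_normed_vector"
  assumes "\<And>x. (f has_vector_derivative 0) (at x)"
  shows "f x = f y"
  using has_vector_derivative_zero_constant[of UNIV f] assms by (metis UNIV_I convex_UNIV)

lemma total_derivative:
  fixes f :: "real \<Rightarrow> real \<Rightarrow> 'a::euclidean_space"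
  assumes J: "open J" and f: "smooth J f" and t: "t \<in> J"
  shows "((\<lambda>(x, t). f x t) has_derivative (\<lambda>(h, k). h *\<^sub>R dx f x t + k *\<^sub>R dT f x t)) (at (x, t))"
proof -
  obtain e where e: "e > 0" "ball t e \<subseteq> J" using J t open_contains_ball by blast
  have "((\<lambda>(x, t). f x t) has_derivative
     (\<lambda>(h, k). (\<lambda>h. h *\<^sub>R dx f x t) h + blinfun_apply (blinfun_scaleR_left (dT f x t)) k)) (at (x, t) within UNIV \<times> ball t e)"
  proof (rule has_derivative_partialsI[where fy = "\<lambda>x t. blinfun_scaleR_left (dT f x t)"])
    show "((\<lambda>x. f x t) has_derivative (\<lambda>h. h *\<^sub>R dx f x t)) (at x)"
      using smooth_dxD[OF f t] by (simp add: has_vector_derivative_def)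
    show "(f y has_derivative blinfun_apply (blinfun_scaleR_left (dT f y s))) (at s within ball t e)"
      if "s \<in> ball t e" for y s
      using has_derivative_at_withinI[OF smooth_dTD[OF J f, of s y, unfolded has_vector_derivative_def]] that e
      by auto
    have "continuous_on (UNIV \<times> ball t e) (\<lambda>z. blinfun_scaleR_left (dT f (fst z) (snd z)))"
      by (intro bounded_linear.continuous_on[OF bounded_linear_blinfun_scaleR_left] cont_compose[OF smooth_cont[OF smooth_dT[OF J f]]] continuous_intros)
         (use e in auto)
    then show "continuous (at (x, t) within UNIV \<times> ball t e) (\<lambda>(x, y). blinfun_scaleR_left (dT f x y))"
      using e by (auto simp: continuous_on_eq_continuous_within case_prod_unfold)
  qed (use e in auto)
  moreover have "at (x, t) within UNIV \<times> ball t e = at (x, t)"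
    by (rule at_within_open) (use e in \<open>auto intro: open_Times\<close>)
  ultimately show ?thesis by simp
qed

section \<open>Reparametrisation by arclength\<close>

text \<open>
  For an immersed curve \<open>\<gamma> \<cdot> t\<close> the speed \<open>v\<close> is \<open>\<bar>\<gamma>\<^sub>x\<bar>\<close>. Arclength from \<open>p\<close> is an antiderivative of \<open>v\<close>,
  and the lower bound on \<open>v\<close> makes it a bijection of the line.
\<close>

locale speed =
  fixes J :: "real set" and v :: "real \<Rightarrow> real \<Rightarrow> real" and p :: real
  assumes J: "open J" and v: "smooth J v"
    and v_bound: "\<And>t. t \<in> J \<Longrightarrow> \<exists>c>0. \<forall>x. c \<le> v x t"
begin

definition len :: "real \<Rightarrow> real \<Rightarrow> real" where "len = prim p v"

definition X :: "real \<Rightarrow> real \<Rightarrow> real" where "X s t = inv (\<lambda>x. len x t) s"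

text \<open>
  Passage from a function of the original parameter to one of arclength.
\<close>

definition sharp :: "(real \<Rightarrow> real \<Rightarrow> 'a) \<Rightarrow> real \<Rightarrow> real \<Rightarrow> 'a" where
  "sharp g = (\<lambda>s t. g (X s t) t)"

lemma v_pos: "t \<in> J \<Longrightarrow> v x t > 0"
  using v_bound by (meson less_le_trans)

lemma smooth_len: "smooth J len"
  unfolding len_def by (rule smooth_prim[OF J v])

lemma is_dx_len: "is_dx J len v"
  unfolding len_def by (rule is_dx_prim[OF J v])

lemma len_base [simp]: "len p t = 0" by (simp add: len_def prim_base)

lemma len_DERIV: "t \<in> J \<Longrightarrow> ((\<lambda>x. len x t) has_real_derivative v x t) (at x)"
  using is_dx_len by (simp add: is_dx_def has_real_derivative_iff_has_vector_derivative)

lemma len_strict_mono: assumes "t \<in> J" "x < y" shows "len x t < len y t"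
  using DERIV_pos_imp_increasing[OF assms(2), of "\<lambda>x. len x t"] len_DERIV[OF assms(1)] v_pos[OF assms(1)]
  by blast

lemma len_grow: assumes t: "t \<in> J" and c: "\<And>x. c \<le> v x t" and xy: "x \<le> y"
  shows "len y t - len x t \<ge> c * (y - x)"
proof (cases "x < y")
  case True
  obtain z where "len y t - len x t = (y - x) * v z t"
    using MVT2[OF True, of "\<lambda>x. len x t" "\<lambda>x. v x t"] len_DERIV[OF t] by blast
  then show ?thesis using c[of z] True by (simp add: mult.commute mult_left_mono)
qed (use xy in auto)

lemma bij_len: assumes t: "t \<in> J" shows "bij (\<lambda>x. len x t)"
proof (rule bijI)
  show "inj (\<lambda>x. len x t)"
    by (rule linorder_injI) (use len_strict_mono[OF t] less_imp_neq in blast)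
  show "surj (\<lambda>x. len x t)"
    unfolding surj_def
  proof
    fix s
    obtain c where c: "c > 0" "\<And>x. c \<le> v x t" using v_bound[OF t] by blast
    define d where "d = \<bar>s\<bar> / c"
    have d: "d \<ge> 0" "c * d = \<bar>s\<bar>" using c by (auto simp: d_def)
    have "len (p + d) t \<ge> s" "len (p - d) t \<le> s"
      using len_grow[OF t c(2), of p "p + d"] len_grow[OF t c(2), of "p - d" p] d by auto
    moreover have "continuous_on {p - d..p + d} (\<lambda>x. len x t)"
      using len_DERIV[OF t] by (intro continuous_at_imp_continuous_on) (blast intro: DERIV_isCont)
    ultimately have "\<exists>x\<ge>p - d. x \<le> p + d \<and> len x t = s"
      using d by (intro IVT') auto
    then show "\<exists>x. s = len x t" by blast
  qed
qed

lemma len_X: "t \<in> J \<Longrightarrow> len (X s t) t = s"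
  unfolding X_def using bij_len surj_f_inv_f[of "\<lambda>x. len x t"] by (auto simp: bij_is_surj)

lemma X_len: "t \<in> J \<Longrightarrow> X (len x t) t = x"
  unfolding X_def using bij_len inv_f_f[of "\<lambda>x. len x t"] by (auto simp: bij_is_inj)

lemma X_0: "t \<in> J \<Longrightarrow> X 0 t = p"
  using X_len[of t p] by simp

lemma less_X: "t \<in> J \<Longrightarrow> x < X s t \<longleftrightarrow> len x t < s"
  using len_strict_mono[of t] len_X[of t s] by (metis less_asym less_linear)

lemma X_less: "t \<in> J \<Longrightarrow> X s t < x \<longleftrightarrow> s < len x t"
  using len_strict_mono[of t] len_X[of t s] by (metis less_asym less_linear)

text \<open>
  Since arclength is strictly increasing, \<open>x < X s t\<close> means \<open>len x t < s\<close>, an open condition on \<open>(s, t)\<close>.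
\<close>

lemma X_tendsto:
  assumes t: "t \<in> J"
  shows "((\<lambda>z. X (fst z) (snd z)) \<longlongrightarrow> X s t) (at (s, t))"
proof -
  have evJ: "\<forall>\<^sub>F z in at (s, t). snd z \<in> J"
    using eventually_at_in_open'[of "UNIV \<times> J" "(s, t)"] J t
    by (auto simp: open_Times mem_Times_iff elim: eventually_mono)
  have lim: "((\<lambda>z. len x (snd z) - fst z) \<longlongrightarrow> len x t - s) (at (s, t))" for x
  proof -
    have "continuous_on (UNIV \<times> J) (\<lambda>z. len x (snd z) - fst z)"
      by (intro cont_compose[OF smooth_cont[OF smooth_len]] continuous_intros) auto
    then have "isCont (\<lambda>z. len x (snd z) - fst z) (s, t)"
      using continuous_on_eq_continuous_at[of "UNIV \<times> J"] J t by (auto simp: open_Times)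
    then show ?thesis by (simp add: isCont_def)
  qed
  show ?thesis
  proof (rule order_tendstoI)
    fix x assume "x < X s t"
    then have "len x t - s < 0" using less_X[OF t] by simp
    from order_tendstoD(2)[OF lim this] evJ
    show "\<forall>\<^sub>F z in at (s, t). x < X (fst z) (snd z)"
      by eventually_elim (simp add: less_X)
  next
    fix x assume "X s t < x"
    then have "len x t - s > 0" using X_less[OF t] by simp
    from order_tendstoD(1)[OF lim this] evJ
    show "\<forall>\<^sub>F z in at (s, t). X (fst z) (snd z) < x"
      by eventually_elim (simp add: X_less)
  qed
qed

lemma cont_X: "cont J X"
  unfolding cont_def continuous_on_def
  using X_tendsto by (auto simp: case_prod_unfold intro: tendsto_within_subset)

text \<open>
  The map \<open>(s, t) \<mapsto> (X s t, t)\<close> is the continuous inverse of \<open>(x, t) \<mapsto> (len x t, t)\<close>, whose derivative is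
  invertible because \<open>v\<close> does not vanish.
\<close>

lemma X_derivative:
  assumes t: "t \<in> J"
  shows "((\<lambda>z. (X (fst z) (snd z), snd z)) has_derivative
     (\<lambda>(h, k). ((h - k * dT len (X s t) t) / v (X s t) t, k))) (at (s, t))"
proof (rule has_derivative_inverse_basic[where T = "UNIV \<times> J"])
  let ?x = "X s t"
  have "((\<lambda>(x, t). len x t) has_derivative (\<lambda>(h, k). h *\<^sub>R dx len ?x t + k *\<^sub>R dT len ?x t)) (at (?x, t))"
    by (rule total_derivative[OF J smooth_len t])
  moreover have "dx len ?x t = v ?x t" by (rule dx_eqI[OF is_dx_len t])
  ultimately have "((\<lambda>z. (len (fst z) (snd z), snd z)) has_derivative
     (\<lambda>z. (fst z * v ?x t + snd z * dT len ?x t, snd z))) (at (?x, t))"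
    by (intro has_derivative_Pair) (auto simp: case_prod_unfold intro!: derivative_eq_intros)
  then show "((\<lambda>z. (len (fst z) (snd z), snd z)) has_derivative
     (\<lambda>z. (fst z * v ?x t + snd z * dT len ?x t, snd z))) (at ((\<lambda>z. (X (fst z) (snd z), snd z)) (s, t)))"
    by simp
  have "bounded_linear (\<lambda>z. ((fst z - snd z * dT len ?x t) / v ?x t, snd z))"
    unfolding divide_inverse
    by (intro bounded_linear_Pair bounded_linear_intros)
  then show "bounded_linear (\<lambda>(h, k). ((h - k * dT len ?x t) / v ?x t, k))"
    by (simp add: case_prod_unfold)
  show "(\<lambda>(h, k). ((h - k * dT len ?x t) / v ?x t, k)) \<circ> (\<lambda>z. (fst z * v ?x t + snd z * dT len ?x t, snd z)) = id"
    using v_pos[OF t, of ?x] by (auto simp: fun_eq_iff)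
  show "isCont (\<lambda>z. (X (fst z) (snd z), snd z)) (s, t)"
    unfolding isCont_def using X_tendsto[OF t, of s] tendsto_snd[OF tendsto_ident_at, of "(s, t)" UNIV]
    by (auto intro!: tendsto_Pair)
qed (use J t len_X in \<open>auto intro: open_Times\<close>)

text \<open>
  \<open>P\<close> is the arclength derivative \<open>\<partial>/\<partial>s\<close> and \<open>Q\<close> the time derivative at fixed arclength, both expressed
  in the original parameter. They preserve smoothness there, so the functions \<open>sharp g\<close> with \<open>g\<close> smooth form
  a class closed under both partial derivatives.
\<close>

definition P :: "(real \<Rightarrow> real \<Rightarrow> 'a::euclidean_space) \<Rightarrow> real \<Rightarrow> real \<Rightarrow> 'a" where
  "P g = (\<lambda>x t. inverse (v x t) *\<^sub>R dx g x t)"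

definition Q :: "(real \<Rightarrow> real \<Rightarrow> 'a::euclidean_space) \<Rightarrow> real \<Rightarrow> real \<Rightarrow> 'a" where
  "Q g = (\<lambda>x t. dT g x t + (- dT len x t) *\<^sub>R P g x t)"

lemma smooth_P: "smooth J g \<Longrightarrow> smooth J (P g)"
  unfolding P_def
  by (intro smooth_scaleR smooth_inverse v smooth_dx J) (use v_pos less_irrefl in metis)+

lemma smooth_Q: "smooth J g \<Longrightarrow> smooth J (Q g)"
  unfolding Q_def
  by (intro smooth_scaleR smooth_add smooth_P smooth_dT J smooth_uminus smooth_len)

lemma sharp_derivs:
  assumes g: "smooth J g"
  shows "is_dx J (sharp g) (sharp (P g))" "is_dt J (sharp g) (sharp (Q g))"
proof -
  have D: "((\<lambda>z. g (X (fst z) (snd z)) (snd z)) has_derivative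
     (\<lambda>z. ((fst z - snd z * dT len (X s t) t) / v (X s t) t) *\<^sub>R dx g (X s t) t + snd z *\<^sub>R dT g (X s t) t)) (at (s, t))"
    if t: "t \<in> J" for s t
  proof -
    have "((\<lambda>(x, t). g x t) has_derivative (\<lambda>(h, k). h *\<^sub>R dx g (X s t) t + k *\<^sub>R dT g (X s t) t))
        (at ((\<lambda>z. (X (fst z) (snd z), snd z)) (s, t)))"
      using total_derivative[OF J g t, of "X s t"] by (simp only: fst_conv snd_conv)
    from diff_chain_at[OF X_derivative[OF t, of s] this]
    show ?thesis by (simp add: case_prod_unfold o_def)
  qed
  have "((\<lambda>s. sharp g s t) has_vector_derivative sharp (P g) s t) (at s)"
     "(sharp g s has_vector_derivative sharp (Q g) s t) (at t)" if t: "t \<in> J" for s t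
  proof -
    have "((\<lambda>s. (s, t)) has_derivative (\<lambda>h. (h, 0))) (at s)"
      "((\<lambda>t. (s, t)) has_derivative (\<lambda>h. (0, h))) (at t)"
      by (intro has_derivative_Pair has_derivative_ident has_derivative_const)+
    from diff_chain_at[OF this(1) D[OF t, of s]] diff_chain_at[OF this(2) D[OF t, of s]]
    show "((\<lambda>s. sharp g s t) has_vector_derivative sharp (P g) s t) (at s)"
      "(sharp g s has_vector_derivative sharp (Q g) s t) (at t)"
      unfolding has_vector_derivative_def sharp_def P_def Q_def
      by (simp_all add: o_def divide_inverse algebra_simps)
  qed
  then show "is_dx J (sharp g) (sharp (P g))" "is_dt J (sharp g) (sharp (Q g))"
    unfolding is_dx_def is_dt_def by auto
qed

lemma cont_sharp: assumes "cont J g" shows "cont J (sharp g)"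
  unfolding cont_def sharp_def case_prod_unfold
  by (intro cont_compose[OF assms] cont_compose[OF cont_X] continuous_intros) auto

lemma smooth_sharp:
  fixes g :: "real \<Rightarrow> real \<Rightarrow> 'a::euclidean_space"
  assumes "smooth J g" shows "smooth J (sharp g)"
proof (rule smooth_coinduct[where X = "\<lambda>h. \<exists>g. smooth J g \<and> h = sharp g"])
  show "\<exists>h. smooth J h \<and> sharp g = sharp h" using assms by blast
next
  fix h :: "real \<Rightarrow> real \<Rightarrow> 'a" assume "\<exists>g. smooth J g \<and> h = sharp g"
  then obtain g where "smooth J g" "h = sharp g" by blast
  then show "cont J h \<and> (\<exists>g k. is_dx J h g \<and> is_dt J h k \<and>
     (\<exists>h. smooth J h \<and> g = sharp h) \<and> (\<exists>h. smooth J h \<and> k = sharp h))"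
    using sharp_derivs[of g] smooth_P[of g] smooth_Q[of g] cont_sharp[of g] smooth_cont[of J g] by blast
qed

end

section \<open>A maximum principle\<close>

lemma second_derivative_at_max:
  fixes u :: "real \<Rightarrow> real"
  assumes u: "\<And>x. (u has_real_derivative u' x) (at x)" and u': "(u' has_real_derivative u'') (at x)"
    and max: "\<And>y. u y \<le> u x"
  shows "u' x = 0" "u'' \<le> 0"
proof -
  show 0: "u' x = 0" by (rule DERIV_local_max[OF u, of 1 x]) (use max in auto)
  show "u'' \<le> 0"
  proof (rule ccontr)
    assume "\<not> u'' \<le> 0"
    then obtain d where d: "d > 0" "\<And>h. 0 < h \<Longrightarrow> h < d \<Longrightarrow> u' x < u' (x + h)"
      using DERIV_pos_inc_right[OF u'] by auto
    obtain z where z: "x < z" "z < x + d/2" "u (x + d/2) - u x = (x + d/2 - x) * u' z"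
      using MVT2[of x "x + d/2" u u'] u d by auto
    have "u' z > 0" using d(2)[of "z - x"] z d 0 by auto
    then have "(x + d/2 - x) * u' z > 0" using d(1) by (intro mult_pos_pos) auto
    then have "u (x + d/2) > u x" using z(3) by linarith
    then show False using max[of "x + d/2"] by simp
  qed
qed

text \<open>
  Spatial maxima exist because the values at each time are taken on the compact interval \<open>[0, M]\<close>; the
  period of the curves may vary with time. The differential inequality is only required where the
  first derivative vanishes and the second is not positive, so drift terms need no
  control.
\<close>

lemma maximum_principle:
  fixes u us uss ut :: "real \<Rightarrow> real \<Rightarrow> real"
  assumes cont: "continuous_on (UNIV \<times> {a..b}) (\<lambda>(s, t). u s t)"
    and us: "\<And>s t. t \<in> {a..b} \<Longrightarrow> ((\<lambda>s. u s t) has_real_derivative us s t) (at s)"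
    and uss: "\<And>s t. t \<in> {a..b} \<Longrightarrow> ((\<lambda>s. us s t) has_real_derivative uss s t) (at s)"
    and ut: "\<And>s t. t \<in> {a..b} \<Longrightarrow> (u s has_real_derivative ut s t) (at t)"
    and per: "\<And>s t. t \<in> {a..b} \<Longrightarrow> \<exists>s'\<in>{0..M}. u s' t = u s t"
    and ineq: "\<And>s t. t \<in> {a..b} \<Longrightarrow> us s t = 0 \<Longrightarrow> uss s t \<le> 0 \<Longrightarrow> ut s t \<le> C"
    and init: "\<And>s. u s a \<le> c"
    and t: "t \<in> {a..b}"
  shows "u s t \<le> c + C * (t - a)"
proof (rule ccontr)
  assume neg: "\<not> ?thesis"
  then have "t > a" using init[of s] t by (cases "t = a") auto
  \<comment> \<open>Half of the excess, as a rate: the strict barrier \<open>c + (C + e) (t - a)\<close> is still violated.\<close>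
  define e where "e = (u s t - c - C * (t - a)) / (2 * (t - a))"
  have e: "e > 0" using neg \<open>t > a\<close> by (auto simp: e_def intro!: divide_pos_pos)
  have "e * (t - a) = (u s t - c - C * (t - a)) / 2"
    using \<open>t > a\<close> by (simp add: e_def field_simps)
  then have big: "u s t - (C + e) * (t - a) > c" using neg by (simp add: algebra_simps)
  define w where "w = (\<lambda>s t. u s t - (C + e) * (t - a))"
  obtain s0 where s0: "s0 \<in> {0..M}" "u s0 t = u s t" using per[OF t] by blast
  have "continuous_on ({0..M} \<times> {a..b}) (\<lambda>z. (\<lambda>(s, t). u s t) z - (C + e) * (snd z - a))"
    by (intro continuous_intros continuous_on_subset[OF cont]) auto
  then have wc: "continuous_on ({0..M} \<times> {a..b}) (\<lambda>z. w (fst z) (snd z))"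
    by (simp add: w_def case_prod_unfold)
  have "compact ({0..M} \<times> {a..b})" by (intro compact_Times compact_Icc)
  then obtain z where z: "z \<in> {0..M} \<times> {a..b}"
      "\<And>y. y \<in> {0..M} \<times> {a..b} \<Longrightarrow> w (fst y) (snd y) \<le> w (fst z) (snd z)"
    using continuous_attains_sup[OF _ _ wc] s0(1) t by blast
  obtain S T where ST: "z = (S, T)" by (cases z)
  have T: "T \<in> {a..b}" using z ST by auto
  have max: "w s' t' \<le> w S T" if t': "t' \<in> {a..b}" for s' t'
  proof -
    obtain s1 where s1: "s1 \<in> {0..M}" "u s1 t' = u s' t'" using per[OF t'] by blast
    have "w s1 t' \<le> w S T" using z(2)[of "(s1, t')"] s1 t' by (simp add: ST)
    then show ?thesis using s1 by (simp add: w_def)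
  qed
  have "w S T > c" using max[OF t, of s] big by (simp add: w_def)
  then have "T > a" using init[of S] T by (cases "T = a") (auto simp: w_def)
  have "u s' T \<le> u S T" for s' using max[OF T, of s'] by (simp add: w_def)
  then have "us S T = 0" "uss S T \<le> 0"
    using second_derivative_at_max[of "\<lambda>s. u s T" "\<lambda>s. us s T" "uss S T" S] us[OF T] uss[OF T] by auto
  then have "ut S T - (C + e) < 0" using ineq[OF T, of S] e by simp
  moreover have "(w S has_real_derivative ut S T - (C + e)) (at T)"
    unfolding w_def using ut[OF T, of S] by (auto intro!: derivative_eq_intros)
  ultimately obtain d where d: "d > 0" "\<And>h. 0 < h \<Longrightarrow> h < d \<Longrightarrow> w S T < w S (T - h)"
    using DERIV_neg_dec_left by blast
  define h where "h = min (d/2) (T - a)"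
  have "0 < h" "h < d" "T - h \<in> {a..b}" using d \<open>T > a\<close> T by (auto simp: h_def min_def)
  then show False using d(2)[of h] max[of "T - h" S] by simp
qed

section \<open>Flows parametrised by arclength\<close>

subsection \<open>The reaction terms\<close>

text \<open>
  The reaction terms are represented by lists of index triples \<open>(a, b, c)\<close>, standing for
  \<open>(d\<^sub>a \<bullet> d\<^sub>b) d\<^sub>c\<close>, with integer coefficients encoded by repetition. The lists depend on the order of
  differentiation only, which is what makes the estimates below uniform over all flows.
\<close>

definition teval :: "(nat \<times> nat \<times> nat) list \<Rightarrow> (nat \<Rightarrow> 'a::real_inner) \<Rightarrow> 'a" where
  "teval xs d = (\<Sum>(a, b, c)\<leftarrow>xs. (d a \<bullet> d b) *\<^sub>R d c)"

definition tderiv :: "(nat \<times> nat \<times> nat) list \<Rightarrow> (nat \<times> nat \<times> nat) list" where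
  "tderiv xs = concat (map (\<lambda>(a, b, c). [(Suc a, b, c), (a, Suc b, c), (a, b, Suc c)]) xs)"

text \<open>
  Differentiating \<open>\<partial>\<^sub>t D\<^sub>m = D\<^sub>m\<^sub>+\<^sub>2 + \<alpha> D\<^sub>m\<^sub>+\<^sub>1 + R\<^sub>m\<close> in space gives \<open>R\<^sub>m\<^sub>+\<^sub>1\<close> as the derivative of \<open>R\<^sub>m\<close> plus
  \<open>\<alpha>\<^sub>s D\<^sub>m\<^sub>+\<^sub>1\<close>, and \<open>\<alpha>\<^sub>s = D\<^sub>2 \<bullet> D\<^sub>2\<close>.
\<close>

primrec reaction :: "nat \<Rightarrow> (nat \<times> nat \<times> nat) list" where
  "reaction 0 = []"
| "reaction (Suc m) = tderiv (reaction m) @ [(2, 2, Suc m)]"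

lemma teval_Nil [simp]: "teval [] d = 0"
  and teval_Cons: "teval ((a, b, c) # xs) d = (d a \<bullet> d b) *\<^sub>R d c + teval xs d"
  and teval_append: "teval (xs @ ys) d = teval xs d + teval ys d"
  by (simp_all add: teval_def)

lemma tderiv_Nil [simp]: "tderiv [] = []"
  and tderiv_Cons: "tderiv ((a, b, c) # xs) = [(Suc a, b, c), (a, Suc b, c), (a, b, Suc c)] @ tderiv xs"
  by (simp_all add: tderiv_def)

lemma teval_has_vector_derivative:
  assumes "\<And>i. ((\<lambda>s. d i s) has_vector_derivative d (Suc i) s) (at s)"
  shows "((\<lambda>s. teval xs (\<lambda>i. d i s)) has_vector_derivative teval (tderiv xs) (\<lambda>i. d i s)) (at s)"
proof (induction xs)
  case (Cons x xs)
  obtain a b c where x: "x = (a, b, c)" by (cases x)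
  have "((\<lambda>s. d a s \<bullet> d b s) has_vector_derivative (d a s \<bullet> d (Suc b) s + d (Suc a) s \<bullet> d b s)) (at s)"
    by (rule bounded_bilinear.has_vector_derivative[OF bounded_bilinear_inner]) (rule assms)+
  then have "((\<lambda>s. (d a s \<bullet> d b s) *\<^sub>R d c s) has_vector_derivative
     ((d a s \<bullet> d b s) *\<^sub>R d (Suc c) s + (d a s \<bullet> d (Suc b) s + d (Suc a) s \<bullet> d b s) *\<^sub>R d c s)) (at s)"
    by (rule bounded_bilinear.has_vector_derivative[OF bounded_bilinear_scaleR]) (rule assms)
  from has_vector_derivative_add[OF this Cons.IH] show ?case
    by (simp add: x teval_Cons tderiv_Cons algebra_simps)
qed simp

lemma reaction_weight:
  "(a, b, c) \<in> set (reaction m) \<Longrightarrow> 2 \<le> a \<and> 2 \<le> b \<and> 1 \<le> c \<and> a + b + c = m + 4"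
proof (induction m arbitrary: a b c)
  case (Suc m)
  then consider "(a, b, c) = (2, 2, Suc m)" | "(a, b, c) \<in> set (tderiv (reaction m))" by auto
  then show ?case
  proof cases
    case 2
    then obtain a' b' c' where "(a', b', c') \<in> set (reaction m)"
      "(a, b, c) \<in> {(Suc a', b', c'), (a', Suc b', c'), (a', b', Suc c')}"
      by (auto simp: tderiv_def)
    then show ?thesis using Suc.IH[of a' b' c'] by auto
  qed auto
qed simp

text \<open>
  The weight leaves few possibilities. An index \<open>m + 1\<close> can occur only as \<open>(m + 1, 2, 1)\<close> up to symmetry. An index
  \<open>m\<close> in the inner product forces \<open>(m, 2, 2)\<close> or \<open>(m, 3, 1)\<close>, and as the last index it forces
  \<open>(2, 2, m)\<close>. For \<open>m \<ge> 3\<close> the only term that is not at most quadratic in \<open>d m\<close> on the face of it is \<open>(3, 3, 1)\<close> for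
  \<open>m = 3\<close>, a cubic one; there the bound on \<open>d 3 \<bullet> d 1\<close> helps, which for a unit speed curve is \<open>- \<bar>d 2\<bar>\<^sup>2\<close>.
\<close>

lemma reaction_term_bound:
  fixes d :: "nat \<Rightarrow> 'a::real_inner"
  assumes w: "2 \<le> a" "2 \<le> b" "1 \<le> c" "a + b + c = m + 4" and m: "2 \<le> m" and K: "1 \<le> K"
    and low: "\<And>i. 1 \<le> i \<Longrightarrow> i < m \<Longrightarrow> norm (d i) \<le> K" and d2: "norm (d 2) \<le> K"
    and d31: "\<bar>d 3 \<bullet> d 1\<bar> \<le> K\<^sup>2"
  shows "\<bar>d m \<bullet> ((d a \<bullet> d b) *\<^sub>R d c)\<bar> \<le> K^4 * (1 + (norm (d m))\<^sup>2 + norm (d m) * norm (d (Suc m)))"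
proof -
  define x where "x = norm (d m)"
  define y where "y = norm (d (Suc m))"
  have xy: "0 \<le> x" "0 \<le> y" by (auto simp: x_def y_def)
  have K24: "K\<^sup>2 \<le> K^4" "K^3 \<le> K^4" "0 \<le> K^4" using K by (auto intro: power_increasing)
  have x1: "x \<le> 1 + x\<^sup>2" using sum_squares_bound[of 1 x] xy by (simp add: power2_eq_square)
  have x2: "x \<le> 1 + x\<^sup>2 + x * y" using x1 mult_nonneg_nonneg[OF xy] by linarith
  have d1: "norm (d 1) \<le> K" using low[of 1] m by simp
  have N: "\<bar>d m \<bullet> ((d a \<bullet> d b) *\<^sub>R d c)\<bar> \<le> norm (d a) * norm (d b) * norm (d c) * x"
  proof -
    have "\<bar>d m \<bullet> ((d a \<bullet> d b) *\<^sub>R d c)\<bar> = \<bar>d a \<bullet> d b\<bar> * \<bar>d m \<bullet> d c\<bar>" by (simp add: abs_mult)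
    also have "\<dots> \<le> (norm (d a) * norm (d b)) * (x * norm (d c))"
      unfolding x_def by (intro mult_mono Cauchy_Schwarz_ineq2) auto
    finally show ?thesis by (simp add: mult_ac)
  qed
  have final: "z \<le> K^4 * (1 + x\<^sup>2 + x * y)"
    if "z \<le> K\<^sup>2 * (x * y) \<or> z \<le> K\<^sup>2 * x\<^sup>2 \<or> z \<le> K^3 * x" for z
  proof -
    have "K\<^sup>2 * (x * y) \<le> K^4 * (1 + x\<^sup>2 + x * y)" "K\<^sup>2 * x\<^sup>2 \<le> K^4 * (1 + x\<^sup>2 + x * y)"
      "K^3 * x \<le> K^4 * (1 + x\<^sup>2 + x * y)"
      using K24 xy x2 by (auto intro!: mult_mono)
    then show ?thesis using that by linarith
  qed
  have p4: "norm p * norm q * norm r * x \<le> P * Q * R * x"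
    if "norm p \<le> P" "norm q \<le> Q" "norm r \<le> R" for p q r :: 'a and P Q R
    using that xy order_trans[OF norm_ge_zero] by (intro mult_mono) (auto intro!: mult_nonneg_nonneg)
  have "\<bar>d m \<bullet> ((d a \<bullet> d b) *\<^sub>R d c)\<bar> \<le> K\<^sup>2 * (x * y) \<or>
    \<bar>d m \<bullet> ((d a \<bullet> d b) *\<^sub>R d c)\<bar> \<le> K\<^sup>2 * x\<^sup>2 \<or> \<bar>d m \<bullet> ((d a \<bullet> d b) *\<^sub>R d c)\<bar> \<le> K^3 * x"
  proof -
    consider "a \<ge> Suc m" | "b \<ge> Suc m" | "a = m" "b = 2" | "b = m" "a = 2" | "a = m" "b = 3" "m \<noteq> 2"
      | "b = m" "a = 3" "m \<noteq> 2" | "a < m" "b < m" "c = m" | "a < m" "b < m" "c < m"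
    proof -
      consider "a > m" | "b > m" | "a = m" "b \<le> m" | "b = m" "a \<le> m" | "a < m" "b < m"
        by (meson le_neq_implies_less not_less)
      then show thesis
      proof cases
        case 3
        then have "b = 2 \<or> b = 3" using w by auto
        then show thesis using 3 that by (cases "b = 2") auto
      next
        case 4
        then have "a = 2 \<or> a = 3" using w by auto
        then show thesis using 4 that by (cases "a = 2") auto
      next
        case 5
        then have "c \<le> m" using w by auto
        then show thesis using 5 that(7,8) by (cases "c = m") auto
      qed (use that(1,2) in auto)
    qed
    then show ?thesis
    proof cases
      case 1
      then have "a = Suc m" "b = 2" "c = 1" using w by auto
      then have "norm (d a) * norm (d b) * norm (d c) * x \<le> y * K * K * x"
        using d1 d2 by (intro p4) (auto simp: y_def)
      then show ?thesis using N by (auto simp: power2_eq_square mult_ac)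
    next
      case 2
      then have "b = Suc m" "a = 2" "c = 1" using w by auto
      then have "norm (d a) * norm (d b) * norm (d c) * x \<le> K * y * K * x"
        using d1 d2 by (intro p4) (auto simp: y_def)
      then show ?thesis using N by (auto simp: power2_eq_square mult_ac)
    next
      case 3
      then have "c = 2" using w by auto
      then have "norm (d a) * norm (d b) * norm (d c) * x \<le> x * K * K * x"
        using 3 d2 by (intro p4) (auto simp: x_def)
      then show ?thesis using N by (auto simp: power2_eq_square mult_ac)
    next
      case 4
      then have "c = 2" using w by auto
      then have "norm (d a) * norm (d b) * norm (d c) * x \<le> K * x * K * x"
        using 4 d2 by (intro p4) (auto simp: x_def)
      then show ?thesis using N by (auto simp: power2_eq_square mult_ac)
    next
      case 5
      then have c: "c = 1" using w by auto
      show ?thesis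
      proof (cases "m = 3")
        case True
        have "\<bar>d m \<bullet> ((d a \<bullet> d b) *\<^sub>R d c)\<bar> = x\<^sup>2 * \<bar>d 3 \<bullet> d 1\<bar>"
          using True 5 c by (simp add: abs_mult x_def dot_square_norm)
        also have "\<dots> \<le> x\<^sup>2 * K\<^sup>2" using d31 by (intro mult_left_mono) auto
        finally show ?thesis by (simp add: mult_ac)
      next
        case False
        then have "norm (d a) * norm (d b) * norm (d c) * x \<le> x * K * K * x"
          using 5 c d1 m low[of 3] by (intro p4) (auto simp: x_def)
        then show ?thesis using N by (auto simp: power2_eq_square mult_ac)
      qed
    next
      case 6
      then have c: "c = 1" using w by auto
      show ?thesis
      proof (cases "m = 3")
        case True
        have "\<bar>d m \<bullet> ((d a \<bullet> d b) *\<^sub>R d c)\<bar> = x\<^sup>2 * \<bar>d 3 \<bullet> d 1\<bar>"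
          using True 6 c by (simp add: abs_mult x_def dot_square_norm)
        also have "\<dots> \<le> x\<^sup>2 * K\<^sup>2" using d31 by (intro mult_left_mono) auto
        finally show ?thesis by (simp add: mult_ac)
      next
        case False
        then have "norm (d a) * norm (d b) * norm (d c) * x \<le> K * x * K * x"
          using 6 c d1 m low[of 3] by (intro p4) (auto simp: x_def)
        then show ?thesis using N by (auto simp: power2_eq_square mult_ac)
      qed
    next
      case 7
      then have "norm (d a) * norm (d b) * norm (d c) * x \<le> K * K * x * x"
        using w low[of a] low[of b] by (intro p4) (auto simp: x_def)
      then show ?thesis using N by (auto simp: power2_eq_square mult_ac)
    next
      case 8
      then have "norm (d a) * norm (d b) * norm (d c) * x \<le> K * K * K * x"
        using w low[of a] low[of b] low[of c] by (intro p4) auto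
      then show ?thesis using N by (auto simp: power3_eq_cube mult_ac)
    qed
  qed
  from final[OF this] show ?thesis by (simp add: x_def y_def)
qed

text \<open>
  By the inequality of the geometric and arithmetic mean, the coefficient of \<open>\<bar>d (m + 1)\<bar>\<^sup>2\<close> can be made \<open>1\<close>, less
  than the \<open>2\<close> that diffusion provides.
\<close>

lemma reaction_bound:
  fixes d :: "nat \<Rightarrow> 'a::real_inner"
  assumes m: "2 \<le> m" and K: "1 \<le> K"
    and low: "\<And>i. 1 \<le> i \<Longrightarrow> i < m \<Longrightarrow> norm (d i) \<le> K" and d2: "norm (d 2) \<le> K"
    and d31: "\<bar>d 3 \<bullet> d 1\<bar> \<le> K\<^sup>2"
  defines "L \<equiv> real (length (reaction m)) * K^4"
  shows "2 * (d m \<bullet> teval (reaction m) d) \<le> (2 * L + L\<^sup>2) * (1 + (norm (d m))\<^sup>2) + (norm (d (Suc m)))\<^sup>2"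
proof -
  define x where "x = norm (d m)"
  define y where "y = norm (d (Suc m))"
  have *: "\<bar>d m \<bullet> teval xs d\<bar> \<le> real (length xs) * (K^4 * (1 + x\<^sup>2 + x * y))"
    if "set xs \<subseteq> set (reaction m)" for xs using that
  proof (induction xs)
    case (Cons z xs)
    obtain a b c where z: "z = (a, b, c)" by (cases z)
    have "\<bar>d m \<bullet> ((d a \<bullet> d b) *\<^sub>R d c)\<bar> \<le> K^4 * (1 + x\<^sup>2 + x * y)"
      unfolding x_def y_def using reaction_weight[of a b c m] Cons.prems z
      by (intro reaction_term_bound m K low d2 d31) auto
    with Cons show ?case
      by (simp add: z teval_Cons inner_add_right algebra_simps)
  qed simp
  have L: "0 \<le> L" using K by (simp add: L_def)
  have "2 * (d m \<bullet> teval (reaction m) d) \<le> 2 * (L * (1 + x\<^sup>2 + x * y))"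
    using *[of "reaction m"] by (simp add: L_def mult_ac)
  also have "\<dots> = 2 * L * (1 + x\<^sup>2) + 2 * (L * x) * y" by (simp add: algebra_simps)
  also have "2 * (L * x) * y \<le> (L * x)\<^sup>2 + y\<^sup>2" by (rule sum_squares_bound)
  also have "(L * x)\<^sup>2 \<le> L\<^sup>2 * (1 + x\<^sup>2)" by (simp add: power_mult_distrib mult_left_mono)
  finally show ?thesis by (simp add: x_def y_def algebra_simps)
qed

subsection \<open>The evolution of the derivatives\<close>

lemma periodic_iterate:
  fixes g :: "real \<Rightarrow> 'b" assumes "\<And>s. g (s + P) = g s" shows "g (s + real n * P) = g s"
proof (induction n)
  case (Suc n)
  have "g (s + real (Suc n) * P) = g (s + real n * P + P)" by (simp add: algebra_simps)
  then show ?case using assms Suc by simp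
qed simp

lemma periodic_reduce:
  fixes g :: "real \<Rightarrow> 'b" assumes per: "\<And>s. g (s + P) = g s" and P: "P > 0"
  shows "\<exists>s'\<in>{0..P}. g s' = g s"
proof -
  define n where "n = \<lfloor>s / P\<rfloor>"
  define s' where "s' = s - of_int n * P"
  have "of_int n \<le> s / P" "s / P < of_int n + 1" unfolding n_def by linarith+
  then have s': "s' \<in> {0..P}" using P by (auto simp: s'_def field_simps)
  have "g s' = g s"
  proof (cases "n \<ge> 0")
    case True
    then show ?thesis using periodic_iterate[of g P s' "nat n", OF per] by (simp add: s'_def)
  next
    case False
    then show ?thesis using periodic_iterate[of g P s "nat (- n)", OF per] by (simp add: s'_def)
  qed
  then show ?thesis using s' by blast
qed

text \<open>
  Curve shortening flow with every curve parametrised by arclength and the parameter \<open>0\<close> following the normal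
  velocity, so that the tangential speed vanishes there. Periodicity records that the curves are
  closed; time derivatives of \<open>f\<close> are in general not periodic.
\<close>

locale pinned_flow =
  fixes J :: "real set" and f :: "real \<Rightarrow> real \<Rightarrow> 'a::euclidean_space"
  assumes J: "open J" and f: "smooth J f"
    and unit: "\<And>s t. t \<in> J \<Longrightarrow> norm (dx f s t) = 1"
    and flow: "\<And>s t. t \<in> J \<Longrightarrow> dT f s t = dx (dx f) s t + (dT f s t \<bullet> dx f s t) *\<^sub>R dx f s t"
    and pinned: "\<And>t. t \<in> J \<Longrightarrow> dT f 0 t \<bullet> dx f 0 t = 0"
    and periodic: "\<And>a b. {a..b} \<subseteq> J \<Longrightarrow> \<exists>M. \<forall>t\<in>{a..b}. \<exists>P. 0 < P \<and> P \<le> M \<and> (\<forall>s. f (s + P) t = f s t)"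
begin

definition D :: "nat \<Rightarrow> real \<Rightarrow> real \<Rightarrow> 'a" where "D i = (dx ^^ i) f"

definition \<alpha> :: "real \<Rightarrow> real \<Rightarrow> real" where "\<alpha> s t = dT f s t \<bullet> dx f s t"

lemma D_0: "D 0 = f" and D_Suc: "D (Suc i) = dx (D i)"
  by (simp_all add: D_def)

lemma D_smooth: "smooth J (D i)"
  by (induction i) (simp_all add: D_0 D_Suc f smooth_dx[OF J])

lemma D_deriv: "t \<in> J \<Longrightarrow> ((\<lambda>s. D i s t) has_vector_derivative D (Suc i) s t) (at s)"
  unfolding D_Suc by (rule smooth_dxD[OF D_smooth])

lemma D_dt: "t \<in> J \<Longrightarrow> (D i s has_vector_derivative dT (D i) s t) (at t)"
  by (rule smooth_dTD[OF J D_smooth])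

lemma D_inner_deriv:
  "t \<in> J \<Longrightarrow> ((\<lambda>s. D i s t \<bullet> D j s t) has_real_derivative (D i s t \<bullet> D (Suc j) s t + D (Suc i) s t \<bullet> D j s t)) (at s)"
  unfolding has_real_derivative_iff_has_vector_derivative
  by (rule bounded_bilinear.has_vector_derivative[OF bounded_bilinear_inner D_deriv D_deriv])

lemma D_inner_dt:
  "t \<in> J \<Longrightarrow> ((\<lambda>t. D i s t \<bullet> D j s t) has_real_derivative (D i s t \<bullet> dT (D j) s t + dT (D i) s t \<bullet> D j s t)) (at t)"
  unfolding has_real_derivative_iff_has_vector_derivative
  by (rule bounded_bilinear.has_vector_derivative[OF bounded_bilinear_inner D_dt D_dt])

lemma norm_D1: "t \<in> J \<Longrightarrow> norm (D 1 s t) = 1"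
  using unit by (simp add: D_def)

lemma D1_D1: "t \<in> J \<Longrightarrow> D 1 s t \<bullet> D 1 s t = 1"
  using norm_D1[of t s] by (simp add: norm_eq_1)

lemma D1_D2: assumes t: "t \<in> J" shows "D 1 s t \<bullet> D 2 s t = 0"
proof -
  have "((\<lambda>s. D 1 s t \<bullet> D 1 s t) has_real_derivative 0) (at s)"
    using D1_D1[OF t] by simp
  from DERIV_unique[OF this D_inner_deriv[OF t, of 1 1 s]] show ?thesis
    by (simp add: inner_commute numeral_2_eq_2)
qed

lemma D1_D3: assumes t: "t \<in> J" shows "D 3 s t \<bullet> D 1 s t = - (norm (D 2 s t))\<^sup>2"
proof -
  have "((\<lambda>s. D 1 s t \<bullet> D 2 s t) has_real_derivative 0) (at s)"
    using D1_D2[OF t] by simp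
  from DERIV_unique[OF this D_inner_deriv[OF t, of 1 2 s]]
  have "D 1 s t \<bullet> D 3 s t + D 2 s t \<bullet> D 2 s t = 0"
    by (simp add: numeral_2_eq_2 numeral_3_eq_3)
  then show ?thesis by (simp add: power2_norm_eq_inner inner_commute)
qed

lemma smooth_alpha: "smooth J \<alpha>"
  unfolding \<alpha>_def by (intro smooth_inner smooth_dT smooth_dx J f)

lemma flow': "t \<in> J \<Longrightarrow> dT f s t = D 2 s t + \<alpha> s t *\<^sub>R D 1 s t"
  using flow[of t s] by (simp add: \<alpha>_def D_def numeral_2_eq_2)

text \<open>
  Keeping unit speed requires \<open>f\<^sub>s \<bullet> f\<^sub>s\<^sub>t = 0\<close>. Expanding the derivative of \<open>f\<^sub>t \<bullet> f\<^sub>s\<close> therefore leaves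
  \<open>f\<^sub>t \<bullet> f\<^sub>s\<^sub>s\<close>, which is \<open>\<bar>f\<^sub>s\<^sub>s\<bar>\<^sup>2\<close> by the flow equation.
\<close>

lemma dx_alpha: assumes t: "t \<in> J" shows "dx \<alpha> s t = D 2 s t \<bullet> D 2 s t"
proof -
  have "((\<lambda>t. D 1 s t \<bullet> D 1 s t) has_real_derivative 0) (at t)"
  proof (rule has_field_derivative_transform_within_open[OF _ J t])
    show "((\<lambda>t. 1) has_real_derivative 0) (at t)" by simp
  qed (use D1_D1 in simp)
  from DERIV_unique[OF this D_inner_dt[OF t, of 1 s 1]]
  have 0: "dT (D 1) s t \<bullet> D 1 s t = 0" by (simp add: inner_commute)
  have "dx \<alpha> s t = dT f s t \<bullet> dx (dx f) s t + dx (dT f) s t \<bullet> dx f s t"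
    unfolding \<alpha>_def
    by (rule bounded_bilinear.dx_prod[OF bounded_bilinear_inner _ _ t])
       (intro smooth_inner smooth_dT smooth_dx J f)+
  also have "dx (dT f) s t = dT (D 1) s t" using schwarz[OF J f t, of s] by (simp add: D_def)
  also have "dT f s t \<bullet> dx (dx f) s t = D 2 s t \<bullet> D 2 s t"
    using flow'[OF t, of s] D1_D2[OF t, of s] by (simp add: D_def numeral_2_eq_2 inner_add_left)
  finally show ?thesis using 0 by (simp add: D_def)
qed

lemma alpha_0: "t \<in> J \<Longrightarrow> \<alpha> 0 t = 0"
  using pinned by (simp add: \<alpha>_def)

lemma alpha_deriv: "t \<in> J \<Longrightarrow> ((\<lambda>s. \<alpha> s t) has_vector_derivative D 2 s t \<bullet> D 2 s t) (at s)"
  using smooth_dxD[OF smooth_alpha] dx_alpha by metis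

text \<open>
  The term \<open>\<alpha> D\<^sub>m\<^sub>+\<^sub>1\<close> reproduces itself under differentiation up to \<open>\<alpha>\<^sub>s D\<^sub>m\<^sub>+\<^sub>1\<close>, which is again cubic, so \<open>\<alpha>\<close> never
  enters the reaction terms.
\<close>

lemma evolution:
  "t \<in> J \<Longrightarrow> dT (D m) s t = D (m + 2) s t + \<alpha> s t *\<^sub>R D (Suc m) s t + teval (reaction m) (\<lambda>i. D i s t)"
proof (induction m arbitrary: s)
  case 0
  then show ?case using flow' by (simp add: D_0 numeral_2_eq_2)
next
  case (Suc m)
  note t = Suc.prems
  have "dT (D (Suc m)) s t = dx (dT (D m)) s t" unfolding D_Suc by (rule schwarz[OF J D_smooth t])
  also have "\<dots> = dx (\<lambda>s t. D (m + 2) s t + \<alpha> s t *\<^sub>R D (Suc m) s t + teval (reaction m) (\<lambda>i. D i s t)) s t"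
    by (rule dx_cong) (rule Suc.IH[OF t])
  also have "\<dots> = vector_derivative (\<lambda>s. D (m + 2) s t + \<alpha> s t *\<^sub>R D (Suc m) s t + teval (reaction m) (\<lambda>i. D i s t)) (at s)"
    by (simp add: dx_def)
  also have "\<dots> = D (Suc (m + 2)) s t + (\<alpha> s t *\<^sub>R D (Suc (Suc m)) s t + (D 2 s t \<bullet> D 2 s t) *\<^sub>R D (Suc m) s t)
     + teval (tderiv (reaction m)) (\<lambda>i. D i s t)"
    by (intro vector_derivative_at has_vector_derivative_add D_deriv[OF t]
        bounded_bilinear.has_vector_derivative[OF bounded_bilinear_scaleR]
        alpha_deriv[OF t] teval_has_vector_derivative)
  finally show ?case by (simp add: teval_append teval_Cons)
qed

lemma D_periodic:
  assumes "t \<in> J" "\<And>s. f (s + P) t = f s t" shows "D i (s + P) t = D i s t"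
proof (induction i arbitrary: s)
  case (Suc i)
  have "((\<lambda>s. D i s t) \<circ> (\<lambda>s. s + P) has_vector_derivative 1 *\<^sub>R D (Suc i) (s + P) t) (at s)"
    by (rule vector_diff_chain_at) (auto intro!: derivative_eq_intros D_deriv[OF assms(1)])
  then have "((\<lambda>s. D i s t) has_vector_derivative D (Suc i) (s + P) t) (at s)"
    using Suc by (simp add: o_def)
  then show ?case using D_deriv[OF assms(1)] vector_derivative_unique_at by blast
qed (simp add: D_0 assms)

lemma spatial_period:
  assumes "{a..b} \<subseteq> J"
  obtains M where "\<And>s t. t \<in> {a..b} \<Longrightarrow> \<exists>s'\<in>{0..M}. \<forall>i. D i s' t = D i s t"
proof -
  obtain M where M: "\<forall>t\<in>{a..b}. \<exists>P. 0 < P \<and> P \<le> M \<and> (\<forall>s. f (s + P) t = f s t)"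
    using periodic[OF assms] by blast
  have "\<exists>s'\<in>{0..M}. \<forall>i. D i s' t = D i s t" if t: "t \<in> {a..b}" for s t
  proof -
    obtain P where P: "0 < P" "P \<le> M" "\<And>s. f (s + P) t = f s t" using M t by blast
    have "(\<lambda>i. D i (s + P) t) = (\<lambda>i. D i s t)" for s
      using D_periodic[of t P] P(3) t assms by blast
    from periodic_reduce[of "\<lambda>s i. D i s t", OF this P(1)]
    obtain s' where "s' \<in> {0..P}" "(\<lambda>i. D i s' t) = (\<lambda>i. D i s t)" by blast
    then show ?thesis using P(2) by (intro bexI[of _ s']) (auto dest: fun_cong)
  qed
  then show ?thesis using that by blast
qed

end

subsection \<open>Interior estimates\<close>

text \<open>
  The constants of the interior estimates. They are explicit only to make visible that they do not depend on the
  flow.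
\<close>

definition reaction_const :: "nat \<Rightarrow> real \<Rightarrow> real" where
  "reaction_const m K = (let L = real (length (reaction m)) * K^4 in 2 * L + L\<^sup>2)"

definition bernstein_const :: "nat \<Rightarrow> real \<Rightarrow> real" where
  "bernstein_const m K = sqrt ((1 + reaction_const m K) * K\<^sup>2 +
     (reaction_const m K + (1 + reaction_const m K) * (reaction_const (m - 1) K * (1 + K\<^sup>2))))"

lemma reaction_const_nonneg: "0 \<le> K \<Longrightarrow> 0 \<le> reaction_const m K"
  by (simp add: reaction_const_def Let_def)

context pinned_flow
begin

lemma D_reaction_bound:
  assumes "t \<in> J" "2 \<le> m" "1 \<le> K" "\<And>i. 1 \<le> i \<Longrightarrow> i < m \<Longrightarrow> norm (D i s t) \<le> K" "norm (D 2 s t) \<le> K"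
  shows "2 * (D m s t \<bullet> teval (reaction m) (\<lambda>i. D i s t)) \<le>
     reaction_const m K * (1 + (norm (D m s t))\<^sup>2) + (norm (D (Suc m) s t))\<^sup>2"
  unfolding reaction_const_def Let_def
proof (rule reaction_bound)
  show "\<bar>D 3 s t \<bullet> D 1 s t\<bar> \<le> K\<^sup>2"
    using assms D1_D3[of t s] power_mono[of "norm (D 2 s t)" K 2] by simp
qed (use assms in auto)

text \<open>
  The maximum principle for \<open>u = (t - a) \<bar>D\<^sub>m\<bar>\<^sup>2 + B \<bar>D\<^sub>m\<^sub>-\<^sub>1\<bar>\<^sup>2\<close> on \<open>[a, b]\<close> with \<open>a = b - 1\<close>. The factor \<open>t - a\<close>
  removes the unknown initial value of \<open>D\<^sub>m\<close> at the price of a term \<open>\<bar>D\<^sub>m\<bar>\<^sup>2\<close>; with \<open>B = 1 + C1\<close> the term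
  \<open>- B \<bar>D\<^sub>m\<bar>\<^sup>2\<close> left over from the diffusion of \<open>D\<^sub>m\<^sub>-\<^sub>1\<close> pays for it and for the reaction terms of \<open>D\<^sub>m\<close>.
\<close>

lemma bernstein:
  assumes m: "3 \<le> m" and K: "1 \<le> K" and J': "{b - 1..b} \<subseteq> J"
    and low: "\<And>i s t. 1 \<le> i \<Longrightarrow> i < m \<Longrightarrow> t \<in> {b - 1..b} \<Longrightarrow> norm (D i s t) \<le> K"
  shows "norm (D m s b) \<le> bernstein_const m K"
proof -
  define a where "a = b - 1"
  define C1 where "C1 = reaction_const m K"
  define C2 where "C2 = reaction_const (m - 1) K"
  define B where "B = 1 + C1"
  define k where "k = m - 1"
  have k: "Suc k = m" "2 \<le> k" using m by (auto simp: k_def)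
  have C: "0 \<le> C1" "0 \<le> C2" "0 \<le> B" using K by (auto simp: C1_def C2_def B_def reaction_const_nonneg)
  define R where "R = (\<lambda>m s t. D m s t \<bullet> teval (reaction m) (\<lambda>i. D i s t))"
  define u where "u = (\<lambda>s t. (t - a) * (D m s t \<bullet> D m s t) + B * (D k s t \<bullet> D k s t))"
  define us where "us = (\<lambda>s t. (t - a) * (2 * (D m s t \<bullet> D (Suc m) s t)) + B * (2 * (D k s t \<bullet> D m s t)))"
  define uss where "uss = (\<lambda>s t. (t - a) * (2 * (D m s t \<bullet> D (m + 2) s t + D (Suc m) s t \<bullet> D (Suc m) s t))
     + B * (2 * (D k s t \<bullet> D (Suc m) s t + D m s t \<bullet> D m s t)))"
  define ut where "ut = (\<lambda>s t. D m s t \<bullet> D m s t + (t - a) * (2 * (D m s t \<bullet> dT (D m) s t)) + B * (2 * (D k s t \<bullet> dT (D k) s t)))"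
  have J2: "t \<in> J" if "t \<in> {a..b}" for t using that J' by (auto simp: a_def)
  have Jab: "{a..b} \<subseteq> J" using J2 by auto
  obtain M where M: "\<And>s t. t \<in> {a..b} \<Longrightarrow> \<exists>s'\<in>{0..M}. \<forall>i. D i s' t = D i s t"
    using spatial_period[OF Jab] by blast
  have "u s b \<le> B * K\<^sup>2 + (C1 + B * (C2 * (1 + K\<^sup>2))) * (b - a)"
  proof (rule maximum_principle[where u=u and s=s and us=us and uss=uss and ut=ut and M=M and a=a and b=b])
    show "continuous_on (UNIV \<times> {a..b}) (\<lambda>(s, t). u s t)"
      unfolding u_def case_prod_unfold
      by (intro continuous_intros cont_compose[OF smooth_cont[OF D_smooth]]) (use J2 in auto)
  next
    fix s t assume "t \<in> {a..b}"
    then have t: "t \<in> J" using J2 by blast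
    show "((\<lambda>s. u s t) has_real_derivative us s t) (at s)"
      unfolding u_def us_def
      by (rule derivative_eq_intros D_inner_deriv[OF t] refl)+ (simp add: k inner_commute algebra_simps)
    show "((\<lambda>s. us s t) has_real_derivative uss s t) (at s)"
      unfolding us_def uss_def
      by (rule derivative_eq_intros D_inner_deriv[OF t] refl)+ (simp add: k inner_commute algebra_simps)
    show "(u s has_real_derivative ut s t) (at t)"
      unfolding u_def ut_def
      by (rule derivative_eq_intros D_inner_dt[OF t] refl)+ (simp add: inner_commute algebra_simps)
  next
    fix s t assume "t \<in> {a..b}"
    from M[OF this, of s] obtain s' where "s' \<in> {0..M}" "\<forall>i. D i s' t = D i s t" by blast
    then show "\<exists>s'\<in>{0..M}. u s' t = u s t"
      by (intro bexI[of _ s']) (auto simp: u_def)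
  next
    fix s t assume t': "t \<in> {a..b}" and us0: "us s t = 0" and uss0: "uss s t \<le> 0"
    have t: "t \<in> J" "t - a \<le> 1" "0 \<le> t - a" using J2 t' by (auto simp: a_def)
    have lo: "norm (D i s t) \<le> K" if "1 \<le> i" "i < m" for i using low t' that by (auto simp: a_def)
    define x where "x = norm (D m s t)"
    define y where "y = norm (D (Suc m) s t)"
    define z where "z = norm (D k s t)"
    have z: "z\<^sup>2 \<le> K\<^sup>2" unfolding z_def using lo[of k] k by (intro power_mono) auto
    have 1: "2 * R m s t \<le> C1 * (1 + x\<^sup>2) + y\<^sup>2"
      unfolding R_def x_def y_def C1_def
      by (rule D_reaction_bound[OF t(1)]) (use m K lo in auto)
    have "2 * R k s t \<le> reaction_const k K * (1 + (norm (D k s t))\<^sup>2) + (norm (D (Suc k) s t))\<^sup>2"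
      unfolding R_def by (rule D_reaction_bound[OF t(1)]) (use k K lo in auto)
    then have "2 * R k s t \<le> C2 * (1 + z\<^sup>2) + x\<^sup>2"
      unfolding C2_def k_def[symmetric] by (simp add: x_def z_def k(1))
    also have "\<dots> \<le> C2 * (1 + K\<^sup>2) + x\<^sup>2"
      using z C by (intro add_mono mult_left_mono) auto
    finally have 2: "2 * R k s t \<le> C2 * (1 + K\<^sup>2) + x\<^sup>2" .
    have em: "D m s t \<bullet> dT (D m) s t = D m s t \<bullet> D (m + 2) s t + \<alpha> s t * (D m s t \<bullet> D (Suc m) s t) + R m s t"
      unfolding R_def evolution[OF t(1)] by (simp add: inner_add_right)
    have ek: "D k s t \<bullet> dT (D k) s t = D k s t \<bullet> D (Suc m) s t + \<alpha> s t * (D k s t \<bullet> D m s t) + R k s t"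
      unfolding R_def evolution[OF t(1)] by (simp add: inner_add_right k(1)[symmetric])
    \<comment> \<open>The drift enters only through \<open>us\<close>, which vanishes here.\<close>
    have "ut s t = uss s t + \<alpha> s t * us s t + x\<^sup>2 + (t - a) * (2 * R m s t - 2 * y\<^sup>2) + B * (2 * R k s t - 2 * x\<^sup>2)"
      unfolding ut_def em ek us_def uss_def x_def y_def power2_norm_eq_inner
      by (simp add: algebra_simps)
    also have "\<dots> \<le> x\<^sup>2 + (t - a) * (2 * R m s t - 2 * y\<^sup>2) + B * (2 * R k s t - 2 * x\<^sup>2)"
      using us0 uss0 by simp
    also have "(t - a) * (2 * R m s t - 2 * y\<^sup>2) \<le> (t - a) * (C1 * (1 + x\<^sup>2))"
      using 1 zero_le_power2[of y] t(3) by (intro mult_left_mono) linarith+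
    also have "(t - a) * (C1 * (1 + x\<^sup>2)) \<le> 1 * (C1 * (1 + x\<^sup>2))"
      using t C by (intro mult_right_mono) auto
    also have "B * (2 * R k s t - 2 * x\<^sup>2) \<le> B * (C2 * (1 + K\<^sup>2) - x\<^sup>2)"
      using 2 C by (intro mult_left_mono) auto
    finally show "ut s t \<le> C1 + B * (C2 * (1 + K\<^sup>2))"
      by (simp add: B_def algebra_simps)
  next
    fix s
    have "norm (D k s a) \<le> K" using low[of k a s] k by (auto simp: a_def)
    then have "(norm (D k s a))\<^sup>2 \<le> K\<^sup>2" by (intro power_mono) auto
    then show "u s a \<le> B * K\<^sup>2"
      using C by (simp add: u_def power2_norm_eq_inner mult_left_mono)
  next
    show "b \<in> {a..b}" by (simp add: a_def)
  qed
  moreover have "(norm (D m s b))\<^sup>2 \<le> u s b"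
    using C by (simp add: u_def a_def power2_norm_eq_inner)
  ultimately have "(norm (D m s b))\<^sup>2 \<le> B * K\<^sup>2 + (C1 + B * (C2 * (1 + K\<^sup>2)))"
    by (simp add: a_def)
  then show ?thesis
    unfolding bernstein_const_def C1_def[symmetric] C2_def[symmetric] B_def[symmetric]
    by (rule real_le_rsqrt)
qed

end

primrec derivative_bound :: "real \<Rightarrow> nat \<Rightarrow> real" where
  "derivative_bound K 0 = max 1 K"
| "derivative_bound K (Suc m) = max (derivative_bound K m) (bernstein_const (m + 3) (derivative_bound K m))"

lemma derivative_bound_ge: "1 \<le> derivative_bound K m" "K \<le> derivative_bound K m"
  by (induction m) (auto simp: le_max_iff_disj)

text \<open>
  Each derivative beyond the second costs one unit of time, so the flow must exist for \<open>m\<close> units of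
  time before \<open>t\<close>.
\<close>

lemma (in pinned_flow) derivative_estimate:
  assumes K: "\<And>s t. t \<in> J \<Longrightarrow> t \<le> 0 \<Longrightarrow> norm (D 2 s t) \<le> K"
  shows "{t - real m..t} \<subseteq> J \<Longrightarrow> t \<le> 0 \<Longrightarrow> 1 \<le> i \<Longrightarrow> i \<le> m + 2 \<Longrightarrow>
     norm (D i s t) \<le> derivative_bound K m"
proof (induction m arbitrary: t i s)
  case 0
  then have "i = 1 \<or> i = 2" "t \<in> J" by auto
  then show ?case using K[of t s] norm_D1[of t s] 0 by (auto simp: le_max_iff_disj)
next
  case (Suc m)
  have sub: "{t' - real m..t'} \<subseteq> J" "t' \<le> 0" if "t' \<in> {t - 1..t}" for t'
    using Suc.prems(1,2) that by auto
  show ?case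
  proof (cases "i \<le> m + 2")
    case True
    then show ?thesis using Suc.IH[of t i s] sub[of t] Suc.prems by (auto simp: le_max_iff_disj)
  next
    case False
    then have i: "i = m + 3" using Suc.prems by simp
    have "norm (D (m + 3) s t) \<le> bernstein_const (m + 3) (derivative_bound K m)"
    proof (rule bernstein)
      show "{t - 1..t} \<subseteq> J" using Suc.prems(1) by auto
      show "norm (D j s' t') \<le> derivative_bound K m" if "1 \<le> j" "j < m + 3" "t' \<in> {t - 1..t}" for j s' t'
        using Suc.IH[of t' j s'] sub[OF that(3)] that by auto
    qed (use derivative_bound_ge in auto)
    then show ?thesis by (simp add: i le_max_iff_disj)
  qed
qed

section \<open>Locally bounded sequences of functions\<close>

abbreviation pD :: "nat \<Rightarrow> nat \<Rightarrow> (real \<Rightarrow> real \<Rightarrow> 'a::real_normed_vector) \<Rightarrow> real \<Rightarrow> real \<Rightarrow> 'a" where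
  "pD \<equiv> pd UNIV"

lemma pD_simps: "pD 0 0 f = f" "pD i (Suc k) f = dT (pD i k f)" "pD (Suc i) 0 f = dx (pD i 0 f)"
  by (simp_all add: pd_def)

lemma pD_dx: "pD i k (dx f) = pD (Suc i) k f"
  by (simp add: pd_def funpow_swap1)

lemma smooth_pD: "open J \<Longrightarrow> smooth J f \<Longrightarrow> smooth J (pD i k f)"
proof (induction k)
  case 0
  then show ?case by (induction i) (auto simp: pD_simps smooth_dx)
qed (auto simp: pD_simps smooth_dT)

lemma pD_cong:
  assumes J: "open J" and fg: "\<And>s t. t \<in> J \<Longrightarrow> f s t = g s t" and t: "t \<in> J"
  shows "pD i k f s t = pD i k g s t"
proof -
  have 1: "pD i 0 f s t = pD i 0 g s t" if "t \<in> J" for s t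
    by (induction i arbitrary: s) (auto simp: pD_simps fg that intro: dx_cong)
  have "\<And>s t. t \<in> J \<Longrightarrow> pD i k f s t = pD i k g s t"
    by (induction k) (auto simp: pD_simps 1 intro: dT_cong[OF J])
  then show ?thesis using t .
qed

lemma dx_pD:
  fixes f :: "real \<Rightarrow> real \<Rightarrow> 'a::euclidean_space"
  assumes J: "open J" and f: "smooth J f"
  shows "t \<in> J \<Longrightarrow> dx (pD i k f) s t = pD (Suc i) k f s t"
proof (induction k arbitrary: s t)
  case (Suc k)
  have "dx (pD i (Suc k) f) s t = dT (dx (pD i k f)) s t"
    using schwarz[OF J smooth_pD[OF J f] Suc.prems, of i k s] by (simp add: pD_simps)
  also have "\<dots> = dT (pD (Suc i) k f) s t"
    by (rule dT_cong[OF J _ Suc.prems]) (rule Suc.IH)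
  finally show ?case by (simp add: pD_simps)
qed (simp add: pD_simps)

lemma pD_dT:
  fixes f :: "real \<Rightarrow> real \<Rightarrow> 'a::euclidean_space"
  assumes J: "open J" and f: "smooth J f" and t: "t \<in> J"
  shows "pD i k (dT f) s t = pD i (Suc k) f s t"
proof -
  have 1: "pD i 0 (dT f) s t = dT (pD i 0 f) s t" if t: "t \<in> J" for s t
  proof (induction i arbitrary: s)
    case (Suc i)
    have "pD (Suc i) 0 (dT f) s t = dx (dT (pD i 0 f)) s t"
      unfolding pD_simps by (rule dx_cong) (rule Suc.IH)
    also have "\<dots> = dT (dx (pD i 0 f)) s t"
      using schwarz[OF J smooth_pD[OF J f] t] by metis
    finally show ?case by (simp add: pD_simps)
  qed (simp add: pD_simps)
  have "\<And>s t. t \<in> J \<Longrightarrow> pD i k (dT f) s t = pD i (Suc k) f s t"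
    by (induction k) (auto simp: pD_simps 1 intro: dT_cong[OF J])
  then show ?thesis using t .
qed

lemma pD_add:
  assumes J: "open J" and f: "smooth J f" and g: "smooth J g" and t: "t \<in> J"
  shows "pD i k (\<lambda>s t. f s t + g s t) s t = pD i k f s t + pD i k g s t"
proof -
  note sm = smooth_pD[OF J f] smooth_pD[OF J g]
  have 1: "pD i 0 (\<lambda>s t. f s t + g s t) s t = pD i 0 f s t + pD i 0 g s t" if t: "t \<in> J" for s t
  proof (induction i arbitrary: s)
    case (Suc i)
    have "pD (Suc i) 0 (\<lambda>s t. f s t + g s t) s t = dx (\<lambda>s t. pD i 0 f s t + pD i 0 g s t) s t"
      unfolding pD_simps by (rule dx_cong) (rule Suc.IH)
    then show ?case by (simp add: pD_simps dx_add[OF sm t])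
  qed (simp add: pD_simps)
  have "\<And>s t. t \<in> J \<Longrightarrow> pD i k (\<lambda>s t. f s t + g s t) s t = pD i k f s t + pD i k g s t"
  proof (induction k)
    case (Suc k)
    have "pD i (Suc k) (\<lambda>s t. f s t + g s t) s t = dT (\<lambda>s t. pD i k f s t + pD i k g s t) s t"
      unfolding pD_simps by (rule dT_cong[OF J _ Suc.prems]) (rule Suc.IH)
    then show ?case by (simp add: pD_simps dT_add[OF J sm Suc.prems])
  qed (simp add: 1)
  then show ?thesis using t .
qed

lemma pd_eq_pD:
  assumes U: "open U" "U \<subseteq> I" and t: "t \<in> U"
  shows "pd I i k f s t = pD i k f s t"
proof -
  have "\<And>s t. t \<in> U \<Longrightarrow> pd I i k f s t = pD i k f s t"
  proof (induction k)
    case (Suc k)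
    have "at t within I = at t"
      by (rule at_within_nhd[OF Suc.prems U(1)]) (use U in auto)
    then have "pd I i (Suc k) f s t = dT (pd I i k f) s t"
      by (simp add: pd_def dt_def)
    also have "\<dots> = dT (pD i k f) s t"
      by (rule dT_cong[OF U(1) _ Suc.prems]) (rule Suc.IH)
    finally show ?case by (simp add: pD_simps)
  qed (simp add: pd_def)
  then show ?thesis using t .
qed

lemma vector_lipschitz:
  fixes f :: "real \<Rightarrow> 'a::real_normed_vector"
  assumes "convex S" "\<And>x. x \<in> S \<Longrightarrow> (f has_vector_derivative f' x) (at x)"
    and "\<And>x. x \<in> S \<Longrightarrow> norm (f' x) \<le> B" "x \<in> S" "y \<in> S"
  shows "norm (f x - f y) \<le> B * \<bar>x - y\<bar>"
proof -
  have "norm (f x - f y) \<le> B * norm (x - y)"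
  proof (rule differentiable_bound[OF assms(1) _ _ assms(4,5)])
    show "(f has_derivative (\<lambda>h. h *\<^sub>R f' z)) (at z within S)" if "z \<in> S" for z
      using assms(2)[OF that] by (simp add: has_vector_derivative_def has_derivative_at_withinI)
    show "onorm (\<lambda>h. h *\<^sub>R f' z) \<le> B" if "z \<in> S" for z
      by (rule onorm_le) (simp add: mult.commute[of B] mult_left_mono assms(3)[OF that])
  qed
  then show ?thesis by simp
qed

text \<open>
  Every compact subset of \<open>\<real> \<times> (-\<infinity>, 0]\<close> lies in one of these rectangles.
\<close>

definition window :: "nat \<Rightarrow> (real \<times> real) set" where
  "window n = {- real n..real n} \<times> {- real n..0}"

text \<open>
  The bound is required for late members only, since the time domain of an early one need not contain the
  window.
\<close>

definition locally_bounded :: "(nat \<Rightarrow> real \<Rightarrow> real \<Rightarrow> 'a::real_normed_vector) \<Rightarrow> bool" where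
  "locally_bounded \<phi> \<longleftrightarrow> (\<forall>n. \<exists>C. \<forall>\<^sub>F j in sequentially. \<forall>(s, t)\<in>window n. norm (\<phi> j s t) \<le> C)"

text \<open>
  All spatial derivatives are included, whatever the number \<open>k\<close> of time derivatives: the flow equation trades one
  time derivative for two spatial ones.
\<close>

definition bounded_derivs :: "nat \<Rightarrow> (nat \<Rightarrow> real \<Rightarrow> real \<Rightarrow> 'a::real_normed_vector) \<Rightarrow> bool" where
  "bounded_derivs k \<phi> \<longleftrightarrow> (\<forall>i. \<forall>l\<le>k. locally_bounded (\<lambda>j. pD i l (\<phi> j)))"

lemma locally_bounded_add:
  assumes "locally_bounded \<phi>" "locally_bounded \<psi>" shows "locally_bounded (\<lambda>j s t. \<phi> j s t + \<psi> j s t)"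
  unfolding locally_bounded_def
proof
  fix n
  obtain C D where "\<forall>\<^sub>F j in sequentially. \<forall>(s, t)\<in>window n. norm (\<phi> j s t) \<le> C"
     "\<forall>\<^sub>F j in sequentially. \<forall>(s, t)\<in>window n. norm (\<psi> j s t) \<le> D"
    using assms unfolding locally_bounded_def by blast
  then have "\<forall>\<^sub>F j in sequentially. \<forall>(s, t)\<in>window n. norm (\<phi> j s t + \<psi> j s t) \<le> C + D"
    by eventually_elim (auto intro: norm_triangle_mono)
  then show "\<exists>C. \<forall>\<^sub>F j in sequentially. \<forall>(s, t)\<in>window n. norm (\<phi> j s t + \<psi> j s t) \<le> C" by blast
qed

lemma locally_bounded_prod:
  assumes "bounded_bilinear pr" "locally_bounded \<phi>" "locally_bounded \<psi>" shows "locally_bounded (\<lambda>j s t. pr (\<phi> j s t) (\<psi> j s t))"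
  unfolding locally_bounded_def
proof
  fix n
  obtain K where K: "0 \<le> K" "\<And>a b. norm (pr a b) \<le> norm a * norm b * K"
    using bounded_bilinear.nonneg_bounded[OF assms(1)] by blast
  obtain C D where "\<forall>\<^sub>F j in sequentially. \<forall>(s, t)\<in>window n. norm (\<phi> j s t) \<le> C"
     "\<forall>\<^sub>F j in sequentially. \<forall>(s, t)\<in>window n. norm (\<psi> j s t) \<le> D"
    using assms(2,3) unfolding locally_bounded_def by blast
  then have "\<forall>\<^sub>F j in sequentially. \<forall>(s, t)\<in>window n. norm (pr (\<phi> j s t) (\<psi> j s t)) \<le> C * D * K"
  proof eventually_elim
    case (elim j)
    show ?case
    proof clarify
      fix s t assume "(s, t) \<in> window n"
      then have *: "norm (\<phi> j s t) \<le> C" "norm (\<psi> j s t) \<le> D" using elim by auto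
      have "norm (\<phi> j s t) * norm (\<psi> j s t) * K \<le> C * D * K"
        using * K(1) order_trans[OF norm_ge_zero *(1)] by (intro mult_right_mono mult_mono) auto
      then show "norm (pr (\<phi> j s t) (\<psi> j s t)) \<le> C * D * K"
        using K(2) order_trans by blast
    qed
  qed
  then show "\<exists>C. \<forall>\<^sub>F j in sequentially. \<forall>(s, t)\<in>window n. norm (pr (\<phi> j s t) (\<psi> j s t)) \<le> C" by blast
qed

locale exhausting =
  fixes J :: "nat \<Rightarrow> real set"
  assumes J: "\<And>j. open (J j)" and exhaust: "\<And>n. \<forall>\<^sub>F j in sequentially. {- real n..0} \<subseteq> J j"
begin

lemma locally_bounded_cong:
  assumes "\<And>j s t. t \<in> J j \<Longrightarrow> \<phi> j s t = \<psi> j s t" "locally_bounded \<phi>" shows "locally_bounded \<psi>"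
  unfolding locally_bounded_def
proof
  fix n
  obtain C where "\<forall>\<^sub>F j in sequentially. \<forall>(s, t)\<in>window n. norm (\<phi> j s t) \<le> C"
    using assms(2) unfolding locally_bounded_def by blast
  with exhaust[of n] have "\<forall>\<^sub>F j in sequentially. \<forall>(s, t)\<in>window n. norm (\<psi> j s t) \<le> C"
  proof eventually_elim
    case (elim j)
    show ?case
    proof clarify
      fix s t assume st: "(s, t) \<in> window n"
      then have "t \<in> J j" using elim(1) by (auto simp: window_def)
      then show "norm (\<psi> j s t) \<le> C" using assms(1)[of t j s] elim(2) st by auto
    qed
  qed
  then show "\<exists>C. \<forall>\<^sub>F j in sequentially. \<forall>(s, t)\<in>window n. norm (\<psi> j s t) \<le> C" by blast
qed

lemma bounded_derivs_cong:
  assumes "\<And>j s t. t \<in> J j \<Longrightarrow> \<phi> j s t = \<psi> j s t" "bounded_derivs k \<phi>"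
  shows "bounded_derivs k \<psi>"
  unfolding bounded_derivs_def
proof (intro allI impI)
  fix i l assume "l \<le> k"
  then have "locally_bounded (\<lambda>j. pD i l (\<phi> j))" using assms(2) by (auto simp: bounded_derivs_def)
  then show "locally_bounded (\<lambda>j. pD i l (\<psi> j))"
    by (rule locally_bounded_cong[rotated]) (rule pD_cong[OF J assms(1)])
qed

lemma bounded_derivs_dx: "bounded_derivs k \<phi> \<Longrightarrow> bounded_derivs k (\<lambda>j. dx (\<phi> j))"
  unfolding bounded_derivs_def pD_dx by blast

lemma bounded_derivs_mono: "l \<le> k \<Longrightarrow> bounded_derivs k \<phi> \<Longrightarrow> bounded_derivs l \<phi>"
  unfolding bounded_derivs_def by auto

lemma bounded_derivs_dT:
  fixes \<phi> :: "nat \<Rightarrow> real \<Rightarrow> real \<Rightarrow> 'a::euclidean_space"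
  assumes "\<And>j. smooth (J j) (\<phi> j)" "bounded_derivs (Suc k) \<phi>"
  shows "bounded_derivs k (\<lambda>j. dT (\<phi> j))"
  unfolding bounded_derivs_def
proof (intro allI impI)
  fix i l assume "l \<le> k"
  then have "locally_bounded (\<lambda>j. pD i (Suc l) (\<phi> j))" using assms(2) by (auto simp: bounded_derivs_def)
  then show "locally_bounded (\<lambda>j. pD i l (dT (\<phi> j)))"
    by (rule locally_bounded_cong[rotated]) (rule pD_dT[OF J assms(1), symmetric])
qed

lemma locally_bounded_pD_add:
  assumes "\<And>j. smooth (J j) (\<phi> j)" "\<And>j. smooth (J j) (\<psi> j)"
    "locally_bounded (\<lambda>j. pD i l (\<phi> j))" "locally_bounded (\<lambda>j. pD i l (\<psi> j))"
  shows "locally_bounded (\<lambda>j. pD i l (\<lambda>s t. \<phi> j s t + \<psi> j s t))"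
  by (rule locally_bounded_cong[OF _ locally_bounded_add[OF assms(3,4)]]) (rule pD_add[OF J assms(1,2), symmetric])

lemma bounded_derivs_add:
  assumes "\<And>j. smooth (J j) (\<phi> j)" "\<And>j. smooth (J j) (\<psi> j)" "bounded_derivs k \<phi>" "bounded_derivs k \<psi>"
  shows "bounded_derivs k (\<lambda>j s t. \<phi> j s t + \<psi> j s t)"
  using assms locally_bounded_pD_add unfolding bounded_derivs_def by blast

text \<open>
  Induction on the number of time derivatives, and on the number of spatial ones when there are none, with the
  innermost derivative distributed over the product by the product rule.
\<close>

lemma bounded_derivs_prod:
  fixes pr :: "'a::euclidean_space \<Rightarrow> 'b::euclidean_space \<Rightarrow> 'c::euclidean_space"
  assumes bb: "bounded_bilinear pr"
    and sm: "\<And>j. smooth (J j) (\<phi> j)" "\<And>j. smooth (J j) (\<psi> j)"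
    and bd: "bounded_derivs k \<phi>" "bounded_derivs k \<psi>"
  shows "bounded_derivs k (\<lambda>j s t. pr (\<phi> j s t) (\<psi> j s t))"
proof -
  note bsm = bounded_bilinear.smooth_prod[OF bb]
  have x: "locally_bounded (\<lambda>j. pD i 0 (\<lambda>s t. pr (\<phi> j s t) (\<psi> j s t)))"
    if "\<And>j. smooth (J j) (\<phi> j)" "\<And>j. smooth (J j) (\<psi> j)" "bounded_derivs 0 \<phi>" "bounded_derivs 0 \<psi>" for i \<phi> \<psi>
    using that
  proof (induction i arbitrary: \<phi> \<psi>)
    case 0
    then have "locally_bounded (\<lambda>j. pD 0 0 (\<phi> j))" "locally_bounded (\<lambda>j. pD 0 0 (\<psi> j))" unfolding bounded_derivs_def by blast+
    then show ?case unfolding pD_simps by (rule locally_bounded_prod[OF bb])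
  next
    case (Suc i)
    note dxs = smooth_dx[OF J Suc.prems(1)] smooth_dx[OF J Suc.prems(2)]
    have "locally_bounded (\<lambda>j. pD i 0 (\<lambda>s t. pr (\<phi> j s t) (dx (\<psi> j) s t) + pr (dx (\<phi> j) s t) (\<psi> j s t)))"
      by (intro locally_bounded_pD_add bsm Suc.IH Suc.prems dxs bounded_derivs_dx)
    then have "locally_bounded (\<lambda>j. pD i 0 (dx (\<lambda>s t. pr (\<phi> j s t) (\<psi> j s t))))"
    proof (rule locally_bounded_cong[rotated])
      fix j s t assume t: "t \<in> J j"
      show "pD i 0 (\<lambda>s t. pr (\<phi> j s t) (dx (\<psi> j) s t) + pr (dx (\<phi> j) s t) (\<psi> j s t)) s t =
         pD i 0 (dx (\<lambda>s t. pr (\<phi> j s t) (\<psi> j s t))) s t"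
        by (rule pD_cong[OF J _ t]) (simp add: bounded_bilinear.dx_prod[OF bb Suc.prems(1,2)])
    qed
    then show ?case unfolding pD_dx .
  qed
  have "locally_bounded (\<lambda>j. pD i l (\<lambda>s t. pr (\<phi> j s t) (\<psi> j s t)))" if "l \<le> k" for i l
    using sm bd that
  proof (induction l arbitrary: \<phi> \<psi> k)
    case 0
    have "bounded_derivs 0 \<phi>" "bounded_derivs 0 \<psi>"
      using bounded_derivs_mono[OF le0] 0(3,4) by auto
    then show ?case by (rule x[OF 0(1,2)])
  next
    case (Suc l)
    obtain k' where k': "k = Suc k'" "l \<le> k'" using Suc.prems(5) by (cases k) auto
    note sms = Suc.prems(1,2) smooth_dT[OF J Suc.prems(1)] smooth_dT[OF J Suc.prems(2)]
    have bds: "bounded_derivs k' \<phi>" "bounded_derivs k' \<psi>" "bounded_derivs k' (\<lambda>j. dT (\<phi> j))"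
      "bounded_derivs k' (\<lambda>j. dT (\<psi> j))"
      using bounded_derivs_dT[OF Suc.prems(1), of k'] bounded_derivs_dT[OF Suc.prems(2), of k']
        bounded_derivs_mono[of k' "Suc k'" \<phi>] bounded_derivs_mono[of k' "Suc k'" \<psi>]
        Suc.prems(3,4) unfolding k'(1) by simp_all
    have "locally_bounded (\<lambda>j. pD i l (\<lambda>s t. pr (\<phi> j s t) (dT (\<psi> j) s t) + pr (dT (\<phi> j) s t) (\<psi> j s t)))"
      by (intro locally_bounded_pD_add bsm sms Suc.IH[where k=k'] bds k'(2))
    then show ?case
    proof (rule locally_bounded_cong[rotated])
      fix j s t assume t: "t \<in> J j"
      have "pD i l (\<lambda>s t. pr (\<phi> j s t) (dT (\<psi> j) s t) + pr (dT (\<phi> j) s t) (\<psi> j s t)) s t =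
         pD i l (dT (\<lambda>s t. pr (\<phi> j s t) (\<psi> j s t))) s t"
        by (rule pD_cong[OF J _ t]) (simp add: bounded_bilinear.dT_prod[OF bb J Suc.prems(1,2)])
      then show "pD i l (\<lambda>s t. pr (\<phi> j s t) (dT (\<psi> j) s t) + pr (dT (\<phi> j) s t) (\<psi> j s t)) s t =
         pD i (Suc l) (\<lambda>s t. pr (\<phi> j s t) (\<psi> j s t)) s t"
        by (simp add: pD_dT[OF J bsm[OF sms(1,2)] t])
    qed
  qed
  then show ?thesis by (simp add: bounded_derivs_def)
qed

text \<open>
  A spatial derivative of \<open>a j\<close> is one of \<open>g j\<close>. A pure time derivative vanishes at \<open>s = 0\<close>, and its spatial
  derivative is a time derivative of \<open>g j\<close>; so it grows at most linearly in \<open>s\<close>.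
\<close>

lemma bounded_derivs_antiderivative:
  fixes a :: "nat \<Rightarrow> real \<Rightarrow> real \<Rightarrow> 'a::euclidean_space"
  assumes sm: "\<And>j. smooth (J j) (a j)" and dx: "\<And>j s t. t \<in> J j \<Longrightarrow> dx (a j) s t = g j s t"
    and base: "\<And>j t. t \<in> J j \<Longrightarrow> a j 0 t = 0" and bd: "bounded_derivs k g"
  shows "bounded_derivs k a"
  unfolding bounded_derivs_def
proof (intro allI impI)
  fix i l assume l: "l \<le> k"
  have dxa: "bounded_derivs k (\<lambda>j. dx (a j))"
    by (rule bounded_derivs_cong[OF _ bd]) (simp add: dx)
  show "locally_bounded (\<lambda>j. pD i l (a j))"
  proof (cases i)
    case (Suc i')
    then show ?thesis using dxa l by (auto simp: bounded_derivs_def pD_dx)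
  next
    case 0
    have zero: "pD 0 l (a j) 0 t = 0" if "t \<in> J j" for j t l using that
    proof (induction l arbitrary: t)
      case (Suc l)
      have "dT (pD 0 l (a j)) 0 t = dT (\<lambda>s t. 0) 0 t"
        by (rule dT_cong[OF J _ Suc.prems]) (rule Suc.IH)
      then show ?case by (simp add: pD_simps dt_def)
    qed (simp add: pD_simps base)
    have "locally_bounded (\<lambda>j. pD 0 l (a j))"
      unfolding locally_bounded_def
    proof
      fix n
      have "locally_bounded (\<lambda>j. pD 0 l (dx (a j)))" using dxa l by (auto simp: bounded_derivs_def)
      then obtain C where "\<forall>\<^sub>F j in sequentially. \<forall>(s, t)\<in>window n. norm (pD 0 l (dx (a j)) s t) \<le> C"
        unfolding locally_bounded_def by blast
      with exhaust[of n] have "\<forall>\<^sub>F j in sequentially. \<forall>(s, t)\<in>window n. norm (pD 0 l (a j) s t) \<le> C * real n"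
      proof eventually_elim
        case (elim j)
        show ?case
        proof clarify
          fix s t assume st: "(s, t) \<in> window n"
          then have t: "t \<in> J j" using elim(1) by (auto simp: window_def)
          have C: "norm (dx (pD 0 l (a j)) r t) \<le> C" if "r \<in> {- real n..real n}" for r
            using elim(2) st that by (auto simp: dx_pD[OF J sm t] pD_dx window_def)
          have "norm (pD 0 l (a j) s t - pD 0 l (a j) 0 t) \<le> C * \<bar>s - 0\<bar>"
            by (rule vector_lipschitz[OF convex_real_interval(5)[of "- real n" "real n"] _ C])
               (use st smooth_dxD[OF smooth_pD[OF J sm] t] in \<open>auto simp: window_def\<close>)
          also have "\<dots> \<le> C * real n"
            using st order_trans[OF norm_ge_zero C[of 0]] by (intro mult_left_mono) (auto simp: window_def)
          finally show "norm (pD 0 l (a j) s t) \<le> C * real n" by (simp add: zero[OF t])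
        qed
      qed
      then show "\<exists>C. \<forall>\<^sub>F j in sequentially. \<forall>(s, t)\<in>window n. norm (pD 0 l (a j) s t) \<le> C" by blast
    qed
    then show ?thesis by (simp add: 0)
  qed
qed

end

section \<open>Bounds for sequences of flows\<close>

locale flow_sequence = exhausting J for J :: "nat \<Rightarrow> real set" +
  fixes f :: "nat \<Rightarrow> real \<Rightarrow> real \<Rightarrow> 'a::euclidean_space" and K :: real
  assumes flows: "\<And>j. pinned_flow (J j) (f j)"
    and origin: "\<And>j. f j 0 0 = 0"
    and curv: "\<And>j s t. t \<in> J j \<Longrightarrow> t \<le> 0 \<Longrightarrow> norm (dx (dx (f j)) s t) \<le> K"
begin

lemma smooth_flow: "smooth (J j) (f j)"
  using flows[of j] by (simp add: pinned_flow_def)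

text \<open>
  For \<open>f\<close> itself: at \<open>s = 0\<close> the curve moves with speed equal to its curvature and is at the origin at time \<open>0\<close>, and away
  from \<open>s = 0\<close> it has unit speed.
\<close>

lemma bounded_space_derivs: "bounded_derivs 0 f"
  unfolding bounded_derivs_def
proof (intro allI impI)
  fix i l :: nat assume "l \<le> 0"
  have "locally_bounded (\<lambda>j. pD i 0 (f j))"
    unfolding locally_bounded_def
  proof
    fix n
    from exhaust[of "n + i"]
    have "\<forall>\<^sub>F j in sequentially. \<forall>(s, t)\<in>window n. norm (pD i 0 (f j) s t) \<le>
        (if i = 0 then real n + K * real n else derivative_bound K i)"
    proof eventually_elim
      case (elim j)
      interpret pinned_flow "J j" "f j" by (rule flows)
      have D: "D i = pD i 0 (f j)" for i by (simp add: D_def pd_def)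
      have K2: "norm (D 2 s t) \<le> K" if "t \<in> J j" "t \<le> 0" for s t
        using curv[OF that] by (simp add: D_def numeral_2_eq_2)
      show ?case
      proof clarify
        fix s t assume st: "(s, t) \<in> window n"
        then have t: "t \<in> {- real n..0}" "\<bar>s\<bar> \<le> real n" "t \<le> 0" by (auto simp: window_def)
        have sub: "{t - real i..t} \<subseteq> J j" "{t..0} \<subseteq> J j" "t \<in> J j"
          using elim t by (auto simp: subset_iff)
        show "norm (pD i 0 (f j) s t) \<le> (if i = 0 then real n + K * real n else derivative_bound K i)"
        proof (cases "i = 0")
          case False
          then show ?thesis
            using derivative_estimate[OF K2 sub(1) t(3), of i s] by (simp add: D)
        next
          case True
          have K0: "0 \<le> K" using order_trans[OF norm_ge_zero K2[of t s]] sub t by auto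
          have "norm (f j s t - f j 0 t) \<le> 1 * \<bar>s - 0\<bar>"
            by (rule vector_lipschitz[where S=UNIV and f' = "\<lambda>s. D 1 s t"])
               (use D_deriv[OF sub(3), of 0] norm_D1[OF sub(3)] in \<open>auto simp: D_0\<close>)
          moreover have "norm (f j 0 t - f j 0 0) \<le> K * \<bar>t - 0\<bar>"
          proof (rule vector_lipschitz[where S="{t..0}" and f' = "\<lambda>t. dT (f j) 0 t"])
            show "(f j 0 has_vector_derivative dT (f j) 0 x) (at x)" if "x \<in> {t..0}" for x
              using D_dt[of x 0 0] that sub by (auto simp: D_0)
            show "norm (dT (f j) 0 x) \<le> K" if "x \<in> {t..0}" for x
              using flow'[of x 0] alpha_0[of x] K2[of x 0] that sub by auto
          qed (use t in auto)
          moreover have "K * \<bar>t - 0\<bar> \<le> K * real n" using K0 t by (intro mult_left_mono) auto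
          ultimately have "norm (f j s t) \<le> real n + K * real n"
            using norm_triangle_ineq[of "f j s t - f j 0 t" "f j 0 t"] origin[of j] t by simp
          then show ?thesis by (simp add: True pD_simps)
        qed
      qed
    qed
    then show "\<exists>C. \<forall>\<^sub>F j in sequentially. \<forall>(s, t)\<in>window n. norm (pD i 0 (f j) s t) \<le> C" by blast
  qed
  then show "locally_bounded (\<lambda>j. pD i l (f j))" using \<open>l \<le> 0\<close> by simp
qed

text \<open>
  The tangential speed is treated as the antiderivative of \<open>\<bar>f\<^sub>s\<^sub>s\<bar>\<^sup>2\<close>. Its expression \<open>f\<^sub>t \<bullet> f\<^sub>s\<close> would be circular,
  as it involves the time derivative about to be estimated.
\<close>

lemma bounded_all_derivs: "bounded_derivs k f"
proof (induction k)
  case (Suc k)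
  let ?\<alpha> = "\<lambda>j s t. dT (f j) s t \<bullet> dx (f j) s t"
  let ?q = "\<lambda>j s t. dx (dx (f j)) s t \<bullet> dx (dx (f j)) s t"
  note s = smooth_flow smooth_dx[OF J] smooth_dT[OF J] smooth_inner smooth_scaleR
  have q: "bounded_derivs k ?q"
    by (intro bounded_derivs_prod[OF bounded_bilinear_inner] s bounded_derivs_dx Suc.IH)
  have \<alpha>: "bounded_derivs k ?\<alpha>"
  proof (rule bounded_derivs_antiderivative[OF _ _ _ q])
    show "smooth (J j) (?\<alpha> j)" for j by (intro s)
    fix j s t assume t: "t \<in> J j"
    interpret pinned_flow "J j" "f j" by (rule flows)
    have a: "?\<alpha> j = \<alpha>" by (simp add: fun_eq_iff \<alpha>_def)
    show "dx (?\<alpha> j) s t = ?q j s t"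
      using dx_alpha[OF t, of s] unfolding a by (simp add: D_def numeral_2_eq_2)
  next
    fix j t assume t: "t \<in> J j"
    interpret pinned_flow "J j" "f j" by (rule flows)
    show "?\<alpha> j 0 t = 0" by (rule pinned[OF t])
  qed
  have "bounded_derivs k (\<lambda>j s t. dx (dx (f j)) s t + ?\<alpha> j s t *\<^sub>R dx (f j) s t)"
    by (intro bounded_derivs_add bounded_derivs_prod[OF bounded_bilinear_scaleR] \<alpha> s bounded_derivs_dx Suc.IH)
  then have ft: "bounded_derivs k (\<lambda>j. dT (f j))"
    by (rule bounded_derivs_cong[rotated]) (use flows in \<open>simp add: pinned_flow_def\<close>)
  show ?case
    unfolding bounded_derivs_def
  proof (intro allI impI)
    fix i l assume "l \<le> Suc k"
    show "locally_bounded (\<lambda>j. pD i l (f j))"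
    proof (cases l)
      case 0
      then show ?thesis using bounded_space_derivs by (simp add: bounded_derivs_def)
    next
      case (Suc m)
      then have "locally_bounded (\<lambda>j. pD i m (dT (f j)))" using ft \<open>l \<le> Suc k\<close> by (simp add: bounded_derivs_def)
      then show ?thesis unfolding Suc by (rule locally_bounded_cong[rotated]) (rule pD_dT[OF J smooth_flow])
    qed
  qed
qed (rule bounded_space_derivs)

end

section \<open>Compactness\<close>

text \<open>
  Uniform convergence of the derivatives allows the limit to be differentiated; they are assumed to exist
  eventually only, so finitely many terms have to be dropped first.
\<close>

lemma uniform_limit_derivative:
  fixes F F' :: "nat \<Rightarrow> real \<Rightarrow> 'a::banach"
  assumes "convex S"
    and der: "\<forall>\<^sub>F n in sequentially. \<forall>x\<in>S. (F n has_vector_derivative F' n x) (at x within S)"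
    and F: "\<And>x. x \<in> S \<Longrightarrow> (\<lambda>n. F n x) \<longlonglongrightarrow> G x" and F': "uniform_limit S F' G' sequentially"
    and x: "x \<in> S"
  shows "(G has_vector_derivative G' x) (at x within S)"
proof -
  obtain N where N: "\<And>n x. n \<ge> N \<Longrightarrow> x \<in> S \<Longrightarrow> (F n has_vector_derivative F' n x) (at x within S)"
    using der unfolding eventually_sequentially by blast
  have "\<exists>g. \<forall>x\<in>S. (\<lambda>n. F (n + N) x) \<longlonglongrightarrow> g x \<and> (g has_derivative (\<lambda>h. h *\<^sub>R G' x)) (at x within S)"
  proof (rule has_derivative_sequence[OF \<open>convex S\<close>])
    show "(F (n + N) has_derivative (\<lambda>h. h *\<^sub>R F' (n + N) x)) (at x within S)" if "x \<in> S" for n x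
      using N[of "n + N" x] that by (simp add: has_vector_derivative_def)
    fix e :: real assume "e > 0"
    then have "\<forall>\<^sub>F n in sequentially. \<forall>x\<in>S. dist (F' n x) (G' x) < e"
      using F' by (auto simp: uniform_limit_iff)
    then have "\<forall>\<^sub>F n in sequentially. \<forall>x\<in>S. dist (F' (n + N) x) (G' x) < e"
      by (rule sequentially_offset)
    then show "\<forall>\<^sub>F n in sequentially. \<forall>x\<in>S. \<forall>h. norm (h *\<^sub>R F' (n + N) x - h *\<^sub>R G' x) \<le> e * norm h"
    proof eventually_elim
      case (elim n)
      show ?case
      proof (intro ballI allI)
        fix x h assume "x \<in> S"
        then have "norm (F' (n + N) x - G' x) \<le> e" using elim by (auto simp: dist_norm less_imp_le)
        then have "\<bar>h\<bar> * norm (F' (n + N) x - G' x) \<le> \<bar>h\<bar> * e" by (intro mult_left_mono) auto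
        then show "norm (h *\<^sub>R F' (n + N) x - h *\<^sub>R G' x) \<le> e * norm h"
          by (simp add: scaleR_diff_right[symmetric] mult.commute)
      qed
    qed
  next
    show "x \<in> S" by (rule x)
    show "(\<lambda>n. F (n + N) x) \<longlonglongrightarrow> G x" by (rule LIMSEQ_ignore_initial_segment[OF F[OF x]])
  qed
  then obtain g where g: "\<And>x. x \<in> S \<Longrightarrow> (\<lambda>n. F (n + N) x) \<longlonglongrightarrow> g x"
     "\<And>x. x \<in> S \<Longrightarrow> (g has_derivative (\<lambda>h. h *\<^sub>R G' x)) (at x within S)" by blast
  have "g y = G y" if "y \<in> S" for y
    using LIMSEQ_unique[OF g(1)[OF that] LIMSEQ_ignore_initial_segment[OF F[OF that]]] .
  then show ?thesis
    unfolding has_vector_derivative_def by (intro has_derivative_transform[OF x _ g(2)[OF x]]) simp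
qed

lemma compact_window: "compact (window n)" and convex_window: "convex (window n)"
  unfolding window_def by (auto intro: compact_Times convex_Times)

lemma window_exhausts:
  assumes "bounded C" "C \<subseteq> UNIV \<times> {..0}"
  obtains n where "C \<subseteq> window n"
proof -
  obtain B where B: "\<And>z. z \<in> C \<Longrightarrow> norm z \<le> B" using assms(1) by (auto simp: bounded_iff)
  obtain n :: nat where n: "B \<le> real n" using real_arch_simple by blast
  have "z \<in> window n" if "z \<in> C" for z
  proof -
    have "\<bar>fst z\<bar> \<le> n" "\<bar>snd z\<bar> \<le> n" "snd z \<le> 0"
      using norm_fst_le[of "fst z" "snd z"] norm_snd_le[of "snd z" "fst z"] B[OF that] n assms(2) that by auto
    then show ?thesis by (cases z) (auto simp: window_def)
  qed
  then show ?thesis using that by blast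
qed

context flow_sequence
begin

lemma locally_bounded_pD: "locally_bounded (\<lambda>j. pD i k (f j))"
  using bounded_all_derivs[of k] by (simp add: bounded_derivs_def)

text \<open>
  Bounds on the next spatial and time derivative make the sequence uniformly Lipschitz on the convex window.
\<close>

lemma subsequence_on_window:
  assumes "strict_mono (s :: nat \<Rightarrow> nat)"
  shows "\<exists>r g. strict_mono (r :: nat \<Rightarrow> nat) \<and> uniform_limit (window n) (\<lambda>j (x, t). pD i k (f (s (r j))) x t) g sequentially"
proof -
  obtain C0 C1 C2 where
    "\<forall>\<^sub>F j in sequentially. \<forall>(x, t)\<in>window n. norm (pD i k (f j) x t) \<le> C0"
    "\<forall>\<^sub>F j in sequentially. \<forall>(x, t)\<in>window n. norm (pD (Suc i) k (f j) x t) \<le> C1"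
    "\<forall>\<^sub>F j in sequentially. \<forall>(x, t)\<in>window n. norm (pD i (Suc k) (f j) x t) \<le> C2"
    using locally_bounded_pD[of i k] locally_bounded_pD[of "Suc i" k] locally_bounded_pD[of i "Suc k"] unfolding locally_bounded_def by blast
  with exhaust[of n] have "\<forall>\<^sub>F j in sequentially. {- real n..0} \<subseteq> J j \<and> (\<forall>(x, t)\<in>window n.
     norm (pD i k (f j) x t) \<le> C0 \<and> norm (pD (Suc i) k (f j) x t) \<le> C1 \<and> norm (pD i (Suc k) (f j) x t) \<le> C2)"
    by eventually_elim auto
  then obtain N where N0: "\<forall>j\<ge>N. {- real n..0} \<subseteq> J j \<and> (\<forall>(x, t)\<in>window n.
     norm (pD i k (f j) x t) \<le> C0 \<and> norm (pD (Suc i) k (f j) x t) \<le> C1 \<and> norm (pD i (Suc k) (f j) x t) \<le> C2)"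
    unfolding eventually_sequentially by blast
  have N: "\<And>j x t. j \<ge> N \<Longrightarrow> (x, t) \<in> window n \<Longrightarrow> t \<in> J j \<and>
     norm (pD i k (f j) x t) \<le> C0 \<and> norm (pD (Suc i) k (f j) x t) \<le> C1 \<and> norm (pD i (Suc k) (f j) x t) \<le> C2"
    using N0 unfolding window_def by blast
  have sN: "s (j + N) \<ge> N" for j using seq_suble[OF assms, of "j + N"] by simp
  define F where "F = (\<lambda>j z. pD i k (f (s (j + N))) (fst z) (snd z))"
  \<comment> \<open>The summand \<open>1\<close> only serves to make \<open>L\<close> positive.\<close>
  define L where "L = \<bar>C1\<bar> + \<bar>C2\<bar> + 1"
  have lip: "norm (F j z - F j y) \<le> L * norm (z - y)" if zy: "z \<in> window n" "y \<in> window n" for j z y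
  proof -
    obtain x t x' t' where e: "z = (x, t)" "y = (x', t')" by (cases z; cases y)
    have w: "(r, t) \<in> window n" if "r \<in> {- real n..real n}" for r using zy that by (auto simp: e window_def)
    have w': "(x', r) \<in> window n" if "r \<in> {- real n..0}" for r using zy that by (auto simp: e window_def)
    let ?g = "pD i k (f (s (j + N)))"
    have t: "t \<in> J (s (j + N))" using N[OF sN] zy e by blast
    have 1: "norm (?g x t - ?g x' t) \<le> C1 * \<bar>x - x'\<bar>"
    proof (rule vector_lipschitz[OF convex_real_interval(5)[of "- real n" "real n"]])
      show "((\<lambda>x. ?g x t) has_vector_derivative dx ?g r t) (at r)" for r
        by (rule smooth_dxD[OF smooth_pD[OF J smooth_flow] t])
      show "norm (dx ?g r t) \<le> C1" if "r \<in> {- real n..real n}" for r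
        using N[OF sN w[OF that]] by (simp add: dx_pD[OF J smooth_flow t])
    qed (use zy e in \<open>auto simp: window_def\<close>)
    have 2: "norm (?g x' t - ?g x' t') \<le> C2 * \<bar>t - t'\<bar>"
    proof (rule vector_lipschitz[OF convex_real_interval(5)[of "- real n" 0]])
      fix r assume "r \<in> {- real n..0}"
      note w = N[OF sN w'[OF this]]
      show "(?g x' has_vector_derivative dT ?g x' r) (at r)"
        using w by (intro smooth_dTD[OF J smooth_pD[OF J smooth_flow]]) auto
      show "norm (dT ?g x' r) \<le> C2" using w by (simp add: pD_simps)
    qed (use zy e in \<open>auto simp: window_def\<close>)
    have "\<bar>x - x'\<bar> \<le> norm (z - y)" "\<bar>t - t'\<bar> \<le> norm (z - y)"
      using norm_fst_le[of "x - x'" "t - t'"] norm_snd_le[of "t - t'" "x - x'"] by (auto simp: e)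
    then have "C1 * \<bar>x - x'\<bar> \<le> \<bar>C1\<bar> * norm (z - y)" "C2 * \<bar>t - t'\<bar> \<le> \<bar>C2\<bar> * norm (z - y)"
      by (auto intro!: mult_mono)
    then have "norm (?g x t - ?g x' t) + norm (?g x' t - ?g x' t') \<le> L * norm (z - y)"
      using 1 2 by (simp add: L_def algebra_simps) (smt (verit) norm_ge_zero)
    moreover have "norm (F j z - F j y) \<le> norm (?g x t - ?g x' t) + norm (?g x' t - ?g x' t')"
      using norm_triangle_ineq[of "?g x t - ?g x' t" "?g x' t - ?g x' t'"] by (simp add: F_def e)
    ultimately show ?thesis by linarith
  qed
  have L: "L > 0" by (simp add: L_def)
  have eq: "\<exists>d>0. \<forall>j y. y \<in> window n \<and> norm (z - y) < d \<longrightarrow> norm (F j z - F j y) < e"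
    if "z \<in> window n" "0 < e" for z e
  proof (intro exI[of _ "e / L"] conjI allI impI)
    show "0 < e / L" using L that by simp
    fix j y assume "y \<in> window n \<and> norm (z - y) < e / L"
    then have "norm (F j z - F j y) \<le> L * norm (z - y)" "L * norm (z - y) < e"
      using lip[OF that(1)] L by (auto simp: field_simps)
    then show "norm (F j z - F j y) < e" by linarith
  qed
  have bd: "norm (F j z) \<le> C0" if "z \<in> window n" for j z
    using N[OF sN, of "fst z" "snd z" j] that by (simp add: F_def)
  obtain g r where g: "strict_mono (r :: nat \<Rightarrow> nat)"
     "\<And>e. 0 < e \<Longrightarrow> \<exists>M. \<forall>j z. j \<ge> M \<and> z \<in> window n \<longrightarrow> norm (F (r j) z - g z) < e"
    by (rule Arzela_Ascoli[OF compact_window bd eq]) blast+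
  have "uniform_limit (window n) (\<lambda>j. F (r j)) g sequentially"
    unfolding uniform_limit_iff eventually_sequentially dist_norm using g(2) by blast
  moreover have "strict_mono (\<lambda>j. r j + N)" using g(1) by (simp add: strict_mono_def)
  ultimately show ?thesis unfolding F_def case_prod_unfold
    by (intro exI[of _ "\<lambda>j. r j + N"] exI[of _ g]) simp
qed

text \<open>
  There are countably many pairs of a derivative and a window, so a diagonal sequence converges for all of them.
\<close>

lemma convergent_subsequence:
  obtains r G where "strict_mono (r :: nat \<Rightarrow> nat)"
    "\<And>i k n. uniform_limit (window n) (\<lambda>j (x, t). pD i k (f (r j)) x t) (\<lambda>(x, t). G i k x t) sequentially"
proof -
  define P where "P = (\<lambda>m s. case from_nat m of (i :: nat, k :: nat, n :: nat) \<Rightarrow>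
     \<exists>g. uniform_limit (window n) (\<lambda>j (x, t). pD i k (f (s j)) x t) g sequentially)"
  interpret subseqs P
  proof
    fix m and s :: "nat \<Rightarrow> nat" assume s: "strict_mono s"
    obtain i k n :: nat where m: "from_nat m = (i, k, n)" by (rule prod_cases3)
    show "\<exists>r. strict_mono r \<and> P m (s \<circ> r)"
      using subsequence_on_window[OF s, where n=n and i=i and k=k] by (simp add: P_def m o_def)
  qed
  have stable: "P m (s \<circ> r)" if r: "strict_mono r" and Pm: "P m s" for m s r
  proof -
    obtain i k n :: nat where m: "from_nat m = (i, k, n)" by (rule prod_cases3)
    have "filterlim r sequentially sequentially" by (rule filterlim_subseq[OF r])
    moreover obtain g where "uniform_limit (window n) (\<lambda>j (x, t). pD i k (f (s j)) x t) g sequentially"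
      using Pm by (auto simp: P_def m)
    ultimately have "uniform_limit (window n) (\<lambda>j (x, t). pD i k (f (s (r j))) x t) g sequentially"
      using filterlim_compose by blast
    then show ?thesis by (auto simp: P_def m)
  qed
  have conv: "\<exists>g. uniform_limit (window n) (\<lambda>j (x, t). pD i k (f (diagseq j)) x t) g sequentially" for i k n
  proof -
    define m where "m = to_nat (i, k, n)"
    have "P m (diagseq \<circ> (+) (Suc m))" by (rule diagseq_holds) (rule stable)
    then obtain g where "uniform_limit (window n) (\<lambda>j (x, t). pD i k (f (diagseq (Suc m + j))) x t) g sequentially"
      by (auto simp: P_def m_def)
    then have *: "\<forall>\<^sub>F j in sequentially. \<forall>z\<in>window n. dist (case z of (x, t) \<Rightarrow> pD i k (f (diagseq (j + Suc m))) x t) (g z) < e"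
      if "e > 0" for e using that unfolding uniform_limit_iff by (simp add: add.commute)
    have "\<forall>\<^sub>F j in sequentially. \<forall>z\<in>window n. dist (case z of (x, t) \<Rightarrow> pD i k (f (diagseq j)) x t) (g z) < e"
      if e: "e > 0" for e
      by (rule eventually_sequentially_seg[THEN iffD1, of _ "Suc m"]) (rule *[OF e])
    then show ?thesis unfolding uniform_limit_iff by blast
  qed
  define G where "G = (\<lambda>i k x t. lim (\<lambda>j. pD i k (f (diagseq j)) x t))"
  have "uniform_limit (window n) (\<lambda>j (x, t). pD i k (f (diagseq j)) x t) (\<lambda>(x, t). G i k x t) sequentially" for i k n
  proof -
    obtain g where g: "uniform_limit (window n) (\<lambda>j (x, t). pD i k (f (diagseq j)) x t) g sequentially"
      using conv by blast
    have "g z = (case z of (x, t) \<Rightarrow> G i k x t)" if "z \<in> window n" for z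
      using limI[OF tendsto_uniform_limitI[OF g that]] by (simp add: G_def case_prod_unfold)
    with g show ?thesis by (simp cong: uniform_limit_cong')
  qed
  then show ?thesis using that subseq_diagseq by blast
qed

end

lemma at_within_nonpos: "t \<le> (0::real) \<Longrightarrow> at t within {..0} \<noteq> bot"
proof -
  assume "t \<le> 0"
  then have "at_left t \<le> at t within {..0}" by (intro at_le) auto
  then show ?thesis using trivial_limit_at_left_real[of t] by (auto simp: bot_unique)
qed

text \<open>
  The limits \<open>G i k\<close> of the derivatives are at first unrelated functions. Locally uniform convergence makes them the
  derivatives of \<open>G 0 0\<close>, one-sided in time at \<open>0\<close>.
\<close>

locale smooth_limit =
  fixes h :: "nat \<Rightarrow> real \<Rightarrow> real \<Rightarrow> 'a::euclidean_space" and J :: "nat \<Rightarrow> real set"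
    and G :: "nat \<Rightarrow> nat \<Rightarrow> real \<Rightarrow> real \<Rightarrow> 'a"
  assumes J: "\<And>j. open (J j)" and exhaust: "\<And>n. \<forall>\<^sub>F j in sequentially. {- real n..0} \<subseteq> J j"
    and h: "\<And>j. smooth (J j) (h j)"
    and lim: "\<And>i k n. uniform_limit (window n) (\<lambda>j (x, t). pD i k (h j) x t) (\<lambda>(x, t). G i k x t) sequentially"
begin

lemma pointwise:
  assumes "t \<le> 0" shows "(\<lambda>j. pD i k (h j) x t) \<longlonglongrightarrow> G i k x t"
proof -
  obtain n where "{(x, t)} \<subseteq> window n" using window_exhausts[of "{(x, t)}"] assms by auto
  then show ?thesis using tendsto_uniform_limitI[OF lim[of i k n], of "(x, t)"] by simp
qed

lemma ev_in: assumes "t \<le> 0" shows "\<forall>\<^sub>F j in sequentially. t \<in> J j"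
proof -
  obtain n :: nat where "- t \<le> real n" using real_arch_simple by blast
  with exhaust[of n] show ?thesis using assms by (auto elim!: eventually_mono)
qed

lemma G_dx: assumes t: "t \<le> 0"
  shows "((\<lambda>x. G i k x t) has_vector_derivative G (Suc i) k x t) (at x)"
proof -
  obtain n where n: "{(\<bar>x\<bar> + 1, t)} \<subseteq> window n" using window_exhausts[of "{(\<bar>x\<bar> + 1, t)}"] t by auto
  let ?S = "{- real n..real n}"
  have "((\<lambda>x. G i k x t) has_vector_derivative G (Suc i) k x t) (at x within ?S)"
  proof (rule uniform_limit_derivative[where F = "\<lambda>j x. pD i k (h j) x t" and F' = "\<lambda>j x. pD (Suc i) k (h j) x t"])
    show "\<forall>\<^sub>F j in sequentially. \<forall>x\<in>?S. ((\<lambda>x. pD i k (h j) x t) has_vector_derivative pD (Suc i) k (h j) x t) (at x within ?S)"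
      using ev_in[OF t]
    proof eventually_elim
      case (elim j)
      show ?case
        using smooth_dxD[OF smooth_pD[OF J h] elim, of i k] dx_pD[OF J h elim, of i k]
        by (intro ballI has_vector_derivative_at_within[where S="{- real n..real n}"]) simp
    qed
    have "uniform_limit ((\<lambda>x. (x, t)) ` ?S) (\<lambda>j (x, t). pD (Suc i) k (h j) x t) (\<lambda>(x, t). G (Suc i) k x t) sequentially"
      by (rule uniform_limit_on_subset[OF lim[where n=n]]) (use n in \<open>auto simp: window_def\<close>)
    then show "uniform_limit ?S (\<lambda>j x. pD (Suc i) k (h j) x t) (\<lambda>x. G (Suc i) k x t) sequentially"
      by (auto simp: uniform_limit_iff)
  qed (use n t pointwise in \<open>auto simp: window_def\<close>)
  moreover have "at x within ?S = at x"
    by (rule at_within_interior) (use n in \<open>auto simp: window_def interior_atLeastAtMost_real\<close>)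
  ultimately show ?thesis by simp
qed

lemma G_dt: assumes t: "t \<le> 0"
  shows "(G i k x has_vector_derivative G i (Suc k) x t) (at t within {..0})"
proof -
  obtain n where n: "{(x, t - 1)} \<subseteq> window n" using window_exhausts[of "{(x, t - 1)}"] t by auto
  let ?S = "{- real n..0}"
  have "(G i k x has_vector_derivative G i (Suc k) x t) (at t within ?S)"
  proof (rule uniform_limit_derivative[where F = "\<lambda>j. pD i k (h j) x" and F' = "\<lambda>j. pD i (Suc k) (h j) x"])
    show "\<forall>\<^sub>F j in sequentially. \<forall>t\<in>?S. (pD i k (h j) x has_vector_derivative pD i (Suc k) (h j) x t) (at t within ?S)"
      using exhaust[of n]
    proof eventually_elim
      case (elim j)
      then show ?case
        using smooth_dTD[OF J smooth_pD[OF J h], of _ j i k x]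
        by (intro ballI has_vector_derivative_at_within[where S="{- real n..0}"]) (auto simp: pD_simps)
    qed
    have "uniform_limit (Pair x ` ?S) (\<lambda>j (x, t). pD i (Suc k) (h j) x t) (\<lambda>(x, t). G i (Suc k) x t) sequentially"
      by (rule uniform_limit_on_subset[OF lim[where n=n]]) (use n in \<open>auto simp: window_def\<close>)
    then show "uniform_limit ?S (\<lambda>j. pD i (Suc k) (h j) x) (G i (Suc k) x) sequentially"
      by (auto simp: uniform_limit_iff)
  qed (use n t pointwise in \<open>auto simp: window_def\<close>)
  moreover have "at t within ?S = at t within {..0}"
    by (rule at_within_nhd[of _ "{- real n<..}"]) (use n t in \<open>auto simp: window_def\<close>)
  ultimately show ?thesis by simp
qed

lemma G_cont: "continuous_on (UNIV \<times> {..0}) (\<lambda>(x, t). G i k x t)"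
proof -
  have cw: "continuous_on (window n) (\<lambda>(x, t). G i k x t)" for n
  proof (rule uniform_limit_theorem[OF _ lim])
    show "\<forall>\<^sub>F j in sequentially. continuous_on (window n) (\<lambda>(x, t). pD i k (h j) x t)"
      using exhaust[of n]
    proof eventually_elim
      case (elim j)
      show ?case
        by (rule continuous_on_subset[OF smooth_cont[OF smooth_pD[OF J h], unfolded cont_def]])
           (use elim in \<open>auto simp: window_def\<close>)
    qed
  qed simp
  show ?thesis
    unfolding continuous_on_eq_continuous_within
  proof
    fix z :: "real \<times> real" assume z: "z \<in> UNIV \<times> {..0}"
    obtain x t where e: "z = (x, t)" by (cases z)
    obtain n where n: "{(\<bar>x\<bar> + 1, t - 1)} \<subseteq> window n"
      using window_exhausts[of "{(\<bar>x\<bar> + 1, t - 1)}"] z e by auto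
    let ?U = "{- real n<..<real n} \<times> {- real n<..<real n}"
    have zw: "z \<in> window n" "z \<in> ?U" using n z by (auto simp: e window_def)
    have "n > 0" using n by (auto simp: window_def intro: gr0I)
    then have "at z within (UNIV \<times> {..0}) \<inter> ?U = at z within window n \<inter> ?U"
      by (intro arg_cong[where f = "\<lambda>S. at z within S"]) (auto simp: window_def)
    then have "at z within UNIV \<times> {..0} = at z within window n"
      by (intro at_within_nhd[OF zw(2)]) (use \<open>n > 0\<close> in \<open>auto simp: window_def intro: open_Times\<close>)
    then show "continuous (at z within UNIV \<times> {..0}) (\<lambda>(x, t). G i k x t)"
      using cw[of n] zw by (simp add: continuous_on_eq_continuous_within)
  qed
qed

lemma pd_G: assumes t: "t \<le> 0" shows "pd {..0} i k (G 0 0) x t = G i k x t"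
proof -
  have 1: "pd {..0} i 0 (G 0 0) x t = G i 0 x t" if "t \<le> 0" for x t
  proof (induction i arbitrary: x)
    case (Suc i)
    have "pd {..0} (Suc i) 0 (G 0 0) x t = dx (pd {..0} i 0 (G 0 0)) x t" by (simp add: pd_def)
    also have "\<dots> = dx (G i 0) x t" by (rule dx_cong) (rule Suc.IH)
    also have "\<dots> = G (Suc i) 0 x t" unfolding dx_def by (rule vector_derivative_at[OF G_dx[OF that]])
    finally show ?case .
  qed (simp add: pd_def)
  have "\<And>x t. t \<le> 0 \<Longrightarrow> pd {..0} i k (G 0 0) x t = G i k x t"
  proof (induction k)
    case (Suc k)
    have "(pd {..0} i k (G 0 0) x has_vector_derivative G i (Suc k) x t) (at t within {..0})"
      by (rule has_vector_derivative_transform[OF _ _ G_dt[OF Suc.prems]]) (use Suc in auto)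
    from vector_derivative_within[OF at_within_nonpos[OF Suc.prems] this]
    show ?case by (simp add: pd_def dt_def)
  qed (rule 1)
  then show ?thesis using t .
qed

lemma smooth_family_G: "smooth_family {..0} (G 0 0)"
  unfolding smooth_family_def
proof (intro allI conjI ballI)
  fix i k x and t :: real assume "t \<in> {..0}"
  then have t: "t \<le> 0" by simp
  have "(\<lambda>y. pd {..0} i k (G 0 0) y t) = (\<lambda>y. G i k y t)" using pd_G[OF t] by auto
  then show "(\<lambda>y. pd {..0} i k (G 0 0) y t) differentiable at x"
    using G_dx[OF t] by (auto intro: differentiableI_vector)
  have "(pd {..0} i k (G 0 0) x has_vector_derivative G i (Suc k) x t) (at t within {..0})"
    by (rule has_vector_derivative_transform[OF _ _ G_dt[OF t]]) (use t pd_G in auto)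
  then show "pd {..0} i k (G 0 0) x differentiable at t within {..0}"
    by (rule differentiableI_vector)
next
  fix i k
  show "continuous_on (UNIV \<times> {..0}) (\<lambda>(x, t). pd {..0} i k (G 0 0) x t)"
    by (rule continuous_on_eq[OF G_cont]) (auto simp: pd_G)
qed

lemma converges_smoothly_G:
  assumes IJ: "\<And>j. J j \<subseteq> I j"
  shows "converges_smoothly I h {..0} (G 0 0)"
  unfolding converges_smoothly_def
proof (intro allI impI conjI)
  fix C :: "(real \<times> real) set" assume C: "compact C" "C \<subseteq> UNIV \<times> {..0}"
  then obtain n where n: "C \<subseteq> window n" using window_exhausts compact_imp_bounded by metis
  have "\<forall>\<^sub>F j in sequentially. C \<subseteq> UNIV \<times> J j"
    using exhaust[of n] by eventually_elim (use n in \<open>auto simp: window_def\<close>)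
  then show "\<forall>\<^sub>F j in sequentially. C \<subseteq> UNIV \<times> I j"
    by eventually_elim (use IJ in auto)
  fix i k
  have "uniform_limit C (\<lambda>j (x, t). pD i k (h j) x t) (\<lambda>(x, t). G i k x t) sequentially"
    by (rule uniform_limit_on_subset[OF lim n])
  moreover have "\<forall>\<^sub>F j in sequentially. \<forall>z\<in>C. (case z of (x, t) \<Rightarrow> pD i k (h j) x t) = (case z of (x, t) \<Rightarrow> pd (I j) i k (h j) x t)"
    using \<open>\<forall>\<^sub>F j in sequentially. C \<subseteq> UNIV \<times> J j\<close>
  proof eventually_elim
    case (elim j)
    show ?case
    proof (clarify)
      fix x t assume "(x, t) \<in> C"
      then have "t \<in> J j" using elim by auto
      then show "pD i k (h j) x t = pd (I j) i k (h j) x t" by (rule pd_eq_pD[OF J IJ, symmetric])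
    qed
  qed
  moreover have "\<forall>z\<in>C. (case z of (x, t) \<Rightarrow> G i k x t) = (case z of (x, t) \<Rightarrow> pd {..0} i k (G 0 0) x t)"
    using C(2) pd_G by fastforce
  ultimately show "uniform_limit C (\<lambda>j (s, t). pd (I j) i k (h j) s t) (\<lambda>(s, t). pd {..0} i k (G 0 0) s t) sequentially"
    by (subst (asm) uniform_limit_cong) auto
qed

lemma arclength_csf_G:
  assumes "\<And>j. pinned_flow (J j) (h j)"
  shows "arclength_csf {..0} (G 0 0)"
proof -
  have dxG: "dx (G 0 0) x t = G (Suc 0) 0 x t" if "t \<le> 0" for x t
    using pd_G[OF that, of "Suc 0" 0 x] by (simp add: pd_def)
  have dxxG: "dx (dx (G 0 0)) x t = G 2 0 x t" if "t \<le> 0" for x t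
    using pd_G[OF that, of 2 0 x] by (simp add: pd_def numeral_2_eq_2)
  have dtG: "dt {..0} (G 0 0) x t = G 0 (Suc 0) x t" if "t \<le> 0" for x t
    using pd_G[OF that, of 0 "Suc 0" x] by (simp add: pd_def)
  have unitG: "norm (G (Suc 0) 0 x t) = 1" if t: "t \<le> 0" for x t
  proof (rule LIMSEQ_unique)
    show "(\<lambda>j. norm (pD (Suc 0) 0 (h j) x t)) \<longlonglongrightarrow> norm (G (Suc 0) 0 x t)" by (intro tendsto_norm pointwise t)
    show "(\<lambda>j. norm (pD (Suc 0) 0 (h j) x t)) \<longlonglongrightarrow> 1"
      by (rule tendsto_eventually, rule eventually_mono[OF ev_in[OF t]])
         (use assms in \<open>simp add: pd_def pinned_flow_def\<close>)
  qed
  have eqG: "G 0 (Suc 0) x t = G 2 0 x t + (G 0 (Suc 0) x t \<bullet> G (Suc 0) 0 x t) *\<^sub>R G (Suc 0) 0 x t" if t: "t \<le> 0" for x t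
  proof (rule LIMSEQ_unique)
    show "(\<lambda>j. pD 0 (Suc 0) (h j) x t) \<longlonglongrightarrow> G 0 (Suc 0) x t" by (intro pointwise t)
    have "(\<lambda>j. pD 2 0 (h j) x t + (pD 0 (Suc 0) (h j) x t \<bullet> pD (Suc 0) 0 (h j) x t) *\<^sub>R pD (Suc 0) 0 (h j) x t)
       \<longlonglongrightarrow> G 2 0 x t + (G 0 (Suc 0) x t \<bullet> G (Suc 0) 0 x t) *\<^sub>R G (Suc 0) 0 x t"
      by (intro tendsto_intros pointwise t)
    moreover have "\<forall>\<^sub>F j in sequentially. pD 2 0 (h j) x t + (pD 0 (Suc 0) (h j) x t \<bullet> pD (Suc 0) 0 (h j) x t) *\<^sub>R pD (Suc 0) 0 (h j) x t = pD 0 (Suc 0) (h j) x t"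
      by (rule eventually_mono[OF ev_in[OF t]])
         (use assms in \<open>simp add: pd_def pinned_flow_def numeral_2_eq_2\<close>)
    ultimately show "(\<lambda>j. pD 0 (Suc 0) (h j) x t) \<longlonglongrightarrow> G 2 0 x t + (G 0 (Suc 0) x t \<bullet> G (Suc 0) 0 x t) *\<^sub>R G (Suc 0) 0 x t"
      by (rule Lim_transform_eventually)
  qed
  have "curv_vec (G 0 0) x t = G 2 0 x t" if t: "t \<le> 0" for x t
  proof -
    have "dx (ds (G 0 0) (G 0 0)) x t = dx (dx (G 0 0)) x t"
      by (rule dx_cong) (simp add: ds_def dxG[OF t] unitG[OF t])
    then show ?thesis
      unfolding curv_vec_def by (subst ds_def) (simp add: dxG[OF t] unitG[OF t] dxxG[OF t])
  qed
  then show ?thesis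
    unfolding arclength_csf_def using smooth_family_G
    by (auto simp: dxG dtG unitG) (metis eqG add_diff_cancel_right')
qed

end

section \<open>The rescaled flows\<close>

lemma cont_subset: "U \<subseteq> J \<Longrightarrow> cont J f \<Longrightarrow> cont U f"
  unfolding cont_def by (erule continuous_on_subset) auto

text \<open>
  A family that is smooth in the sense of \<open>smooth_family\<close> has the derivatives \<open>pd J i k f\<close> only in the order in which they are
  formed; symmetry of mixed derivatives makes this collection closed under both partial derivatives.
\<close>

lemma smooth_family_imp_smooth:
  fixes f :: "real \<Rightarrow> real \<Rightarrow> 'a::euclidean_space"
  assumes f: "smooth_family J f" and U: "open U" "U \<subseteq> J"
  shows "smooth U f"
proof -
  have within: "at t within J = at t" if "t \<in> U" for t
    by (rule at_within_nhd[OF that U(1)]) (use U in auto)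
  have c: "cont U (pd J i k f)" for i k
    using f U(2) unfolding smooth_family_def by (intro cont_subset[OF U(2)]) (simp add: cont_def)
  have t: "is_dt U (pd J i k f) (pd J i (Suc k) f)" for i k
    unfolding is_dt_def
  proof (intro allI ballI)
    fix x t assume t: "t \<in> U"
    then have "pd J i k f x differentiable at t within J" using f U(2) by (auto simp: smooth_family_def)
    then have "(pd J i k f x has_vector_derivative dt J (pd J i k f) x t) (at t within J)"
      by (simp add: vector_derivative_works dt_def)
    then show "(pd J i k f x has_vector_derivative pd J i (Suc k) f x t) (at t)"
      by (simp add: pd_def within[OF t])
  qed
  have x: "is_dx U (pd J i k f) (pd J (Suc i) k f)" for i k
  proof (induction k)
    case 0
    show ?case
      unfolding is_dx_def
    proof (intro allI ballI)
      fix x t assume t: "t \<in> U"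
      then have "(\<lambda>y. pd J i 0 f y t) differentiable at x" using f U(2) by (auto simp: smooth_family_def)
      then have "((\<lambda>y. pd J i 0 f y t) has_vector_derivative dx (pd J i 0 f) x t) (at x)"
        by (simp add: vector_derivative_works dx_def)
      then show "((\<lambda>y. pd J i 0 f y t) has_vector_derivative pd J (Suc i) 0 f x t) (at x)"
        by (simp add: pd_def)
    qed
  next
    case (Suc k)
    show ?case by (rule mixed_partials[OF U(1) Suc.IH t t c c])
  qed
  show ?thesis
  proof (rule smooth_coinduct[where X = "\<lambda>h. \<exists>i k. h = pd J i k f"])
    show "\<exists>i k. f = pd J i k f" by (intro exI[of _ 0]) (simp add: pd_def)
    fix h assume "\<exists>i k. h = pd J i k f"
    then show "cont U h \<and> (\<exists>g g'. is_dx U h g \<and> is_dt U h g' \<and> (\<exists>i k. g = pd J i k f) \<and> (\<exists>i k. g' = pd J i k f))"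
      using c t x by blast
  qed
qed

lemma periodic_dx:
  assumes "\<And>x. g (x + c) t = g x t" shows "dx g (x + c) t = dx g x t"
proof -
  have "((\<lambda>y. g y t) has_vector_derivative D) (at (x + c)) \<longleftrightarrow> ((\<lambda>y. g y t) has_vector_derivative D) (at x)" for D
  proof
    assume "((\<lambda>y. g y t) has_vector_derivative D) (at (x + c))"
    then have "((\<lambda>y. g y t) \<circ> (\<lambda>y. y + c) has_vector_derivative 1 *\<^sub>R D) (at x)"
      by (intro vector_diff_chain_at) (auto intro!: derivative_eq_intros)
    then show "((\<lambda>y. g y t) has_vector_derivative D) (at x)" using assms by (simp add: o_def)
  next
    assume "((\<lambda>y. g y t) has_vector_derivative D) (at x)"
    then have "((\<lambda>y. g y t) \<circ> (\<lambda>y. y - c) has_vector_derivative 1 *\<^sub>R D) (at (x + c))"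
      by (intro vector_diff_chain_at) (auto intro!: derivative_eq_intros)
    moreover have "g (y - c) t = g y t" for y using assms[of "y - c"] by simp
    ultimately show "((\<lambda>y. g y t) has_vector_derivative D) (at (x + c))" by (simp add: o_def)
  qed
  then show ?thesis by (simp add: dx_def vector_derivative_def)
qed

lemma pinned_flow_cong:
  assumes "pinned_flow J f" "\<And>s t. t \<in> J \<Longrightarrow> f s t = g s t"
  shows "pinned_flow J g"
proof -
  interpret pinned_flow J f by fact
  have dx: "dx g s t = dx f s t" if "t \<in> J" for s t by (rule dx_cong) (simp add: assms(2)[OF that])
  have dxx: "dx (dx g) s t = dx (dx f) s t" if "t \<in> J" for s t by (rule dx_cong) (simp add: dx[OF that])
  have dT: "dT g s t = dT f s t" if "t \<in> J" for s t by (rule dT_cong[OF J _ that]) (simp add: assms(2))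
  show ?thesis
  proof
    show "smooth J g" by (rule smooth_cong[OF J assms(2) f])
    fix a b assume ab: "{a..b} \<subseteq> J"
    show "\<exists>M. \<forall>t\<in>{a..b}. \<exists>P. 0 < P \<and> P \<le> M \<and> (\<forall>s. g (s + P) t = g s t)"
      using periodic[OF ab] assms(2) ab by (metis subsetD)
  qed (use J unit flow pinned in \<open>auto simp: dx dxx dT\<close>)
qed

subsection \<open>A closed flow, parametrised by arclength\<close>

locale closed_flow =
  fixes U :: "real set" and g :: "real \<Rightarrow> real \<Rightarrow> 'a::euclidean_space" and p :: real
  assumes U: "open U" and g: "smooth U g"
    and immersed: "\<And>x t. t \<in> U \<Longrightarrow> dx g x t \<noteq> 0"
    and closed: "\<And>x t. t \<in> U \<Longrightarrow> g (x + 2 * pi) t = g x t"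
    and csf: "\<And>x t. t \<in> U \<Longrightarrow> dT g x t = curv_vec g x t"
begin

abbreviation v :: "real \<Rightarrow> real \<Rightarrow> real" where "v x t \<equiv> norm (dx g x t)"

lemma smooth_v: "smooth U v"
  by (rule smooth_norm[OF immersed smooth_dx[OF U g]])

lemma v_periodic: "t \<in> U \<Longrightarrow> v (x + 2 * pi) t = v x t"
  using periodic_dx[of g "2 * pi" t x] closed by simp

sublocale speed U v p
proof
  show "\<exists>c>0. \<forall>x. c \<le> v x t" if t: "t \<in> U" for t
  proof -
    have "continuous_on {0..2*pi} (\<lambda>x. v x t)"
      by (intro cont_compose[OF smooth_cont[OF smooth_v]] continuous_intros t)
    then have "\<exists>x0\<in>{0..2*pi}. \<forall>x\<in>{0..2*pi}. v x0 t \<le> v x t"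
      by (intro continuous_attains_inf) auto
    then obtain x0 where x0: "\<And>x. x \<in> {0..2*pi} \<Longrightarrow> v x0 t \<le> v x t" by blast
    have "v x0 t \<le> v x t" for x
    proof -
      obtain x' where "x' \<in> {0..2*pi}" "v x' t = v x t"
        using periodic_reduce[of "\<lambda>x. v x t" "2 * pi" x, OF v_periodic[OF t]] by auto
      then show ?thesis using x0[of x'] by simp
    qed
    then show ?thesis using immersed[OF t, of x0] by (intro exI[of _ "v x0 t"]) auto
  qed
qed (rule U smooth_v)+

lemma ds_eq_P: "ds g h = P h"
  by (simp add: fun_eq_iff ds_def P_def)

lemma curv_vec_eq: "curv_vec g = P (P g)"
  by (simp add: curv_vec_def ds_eq_P)

lemma smooth_curv_vec: "smooth U (curv_vec g)"
  unfolding curv_vec_eq by (intro smooth_P g)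

lemma arclength_eq: assumes t: "t \<in> U" shows "arclength g p t x = len x t"
proof -
  have c: "continuous_on S (\<lambda>y. v y t)" for S
    by (intro cont_compose[OF smooth_cont[OF smooth_v]] continuous_intros t)
  have "((\<lambda>x. arclength g p t x - len x t) has_vector_derivative v x t - v x t) (at x)" for x
  proof (intro has_vector_derivative_diff)
    define a where "a = min x p - 1"
    define b where "b = max x p + 1"
    have "((\<lambda>u. LBINT y=p..u. v y t) has_vector_derivative v x t) (at x within {a..b})"
      by (rule interval_integral_FTC2[OF _ _ c]) (auto simp: a_def b_def)
    moreover have "at x within {a..b} = at x"
      by (rule at_within_interior) (auto simp: a_def b_def interior_atLeastAtMost_real)
    ultimately show "((\<lambda>x. arclength g p t x) has_vector_derivative v x t) (at x)"
      by (simp add: arclength_def)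
    show "((\<lambda>x. len x t) has_vector_derivative v x t) (at x)"
      using is_dx_len t by (simp add: is_dx_def)
  qed
  then have "arclength g p t x - len x t = arclength g p t p - len p t"
    by (intro zero_dx_imp_const[of "\<lambda>x. arclength g p t x - len x t"]) simp
  then show ?thesis by (simp add: arclength_def)
qed

lemma by_arclength_eq: "t \<in> U \<Longrightarrow> by_arclength g p s t = sharp g s t"
proof -
  assume t: "t \<in> U"
  have "arclength g p t = (\<lambda>x. len x t)" using arclength_eq[OF t] by auto
  then show ?thesis by (simp add: by_arclength_def sharp_def X_def)
qed

text \<open>
  Going once around the curve adds its length.
\<close>

lemma len_shift: assumes t: "t \<in> U" shows "len (x + 2 * pi) t = len x t + len (p + 2 * pi) t"
proof -
  have "((\<lambda>x. len (x + 2 * pi) t - len x t) has_real_derivative v (x + 2 * pi) t - v x t) (at x)" for x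
    using DERIV_shift[of "\<lambda>x. len x t" "v (x + 2 * pi) t" x "2 * pi"] len_DERIV[OF t]
    by (intro DERIV_diff) auto
  then have "len (x + 2 * pi) t - len x t = len (p + 2 * pi) t - len p t"
    by (intro zero_dx_imp_const[of "\<lambda>x. len (x + 2 * pi) t - len x t"])
       (simp add: v_periodic[OF t] has_real_derivative_iff_has_vector_derivative)
  then show ?thesis by simp
qed

lemma X_shift: assumes t: "t \<in> U" shows "X (s + len (p + 2 * pi) t) t = X s t + 2 * pi"
proof -
  have "len (X s t + 2 * pi) t = s + len (p + 2 * pi) t"
    using len_shift[OF t, of "X s t"] len_X[OF t] by simp
  then show ?thesis using X_len[OF t] by metis
qed

lemma dx_sharp: "smooth U h \<Longrightarrow> t \<in> U \<Longrightarrow> dx (sharp h) s t = sharp (P h) s t"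
  by (rule dx_eqI[OF sharp_derivs(1)])

lemma dxx_sharp: "t \<in> U \<Longrightarrow> dx (dx (sharp g)) s t = curv_vec g (X s t) t"
proof -
  assume t: "t \<in> U"
  have "dx (dx (sharp g)) s t = dx (sharp (P g)) s t" by (rule dx_cong) (rule dx_sharp[OF g t])
  also have "\<dots> = sharp (P (P g)) s t" by (rule dx_sharp[OF smooth_P[OF g] t])
  finally show ?thesis by (simp add: sharp_def curv_vec_eq)
qed

lemma norm_P: "t \<in> U \<Longrightarrow> norm (P g x t) = 1"
  using immersed[of t x] by (simp add: P_def)

text \<open>
  The derivative of a field of unit vectors is orthogonal to it.
\<close>

lemma P_curv: assumes t: "t \<in> U" shows "curv_vec g x t \<bullet> P g x t = 0"
proof -
  have "((\<lambda>x. P g x t \<bullet> P g x t) has_vector_derivative (P g x t \<bullet> dx (P g) x t + dx (P g) x t \<bullet> P g x t)) (at x)"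
    by (rule bounded_bilinear.has_vector_derivative[OF bounded_bilinear_inner]) (rule smooth_dxD[OF smooth_P[OF g] t])+
  moreover have "(\<lambda>x. P g x t \<bullet> P g x t) = (\<lambda>x. 1)" using norm_P[OF t] by (simp add: fun_eq_iff norm_eq_1)
  moreover have "((\<lambda>x. 1 :: real) has_vector_derivative 0) (at x)" by simp
  ultimately have "P g x t \<bullet> dx (P g) x t + dx (P g) x t \<bullet> P g x t = 0"
    by (intro vector_derivative_unique_at[of "\<lambda>x. 1 :: real"]) simp_all
  then have "dx (P g) x t \<bullet> P g x t = 0" by (simp add: inner_commute)
  then show ?thesis unfolding curv_vec_eq by (subst P_def) simp
qed

text \<open>
  Reparametrisation adds the tangential velocity \<open>- dT len\<close> to the normal velocity of the flow. It
  vanishes at the base point, since arclength is measured from there at all times, and the length, which is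
  the period, is bounded on compact time intervals by continuity.
\<close>

lemma pinned_flow_sharp: "pinned_flow U (sharp g)"
proof
  fix s t assume t: "t \<in> U"
  have dxf: "dx (sharp g) s t = P g (X s t) t" for s
    using dx_sharp[OF g t] by (simp add: sharp_def)
  show "norm (dx (sharp g) s t) = 1" by (simp add: dxf norm_P[OF t])
  have dtf: "dT (sharp g) s t = curv_vec g (X s t) t - dT len (X s t) t *\<^sub>R P g (X s t) t" for s
    using dT_eqI[OF sharp_derivs(2)[OF g] t, of s] by (simp add: sharp_def Q_def csf[OF t])
  have al: "dT (sharp g) s t \<bullet> dx (sharp g) s t = - dT len (X s t) t" for s
    using norm_P[OF t] by (simp add: dxf dtf inner_diff_left P_curv[OF t] norm_eq_1)
  show "dT (sharp g) s t = dx (dx (sharp g)) s t + (dT (sharp g) s t \<bullet> dx (sharp g) s t) *\<^sub>R dx (sharp g) s t"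
    unfolding al by (simp add: dtf dxf dxx_sharp[OF t])
  have "len p = (\<lambda>t. 0)" by (simp add: fun_eq_iff)
  then have "dT len p t = 0" by (simp add: dt_def)
  then show "dT (sharp g) 0 t \<bullet> dx (sharp g) 0 t = 0" unfolding al by (simp add: X_0[OF t])
next
  fix a b assume ab: "{a..b} \<subseteq> U"
  have "continuous_on {a..b} (\<lambda>t. len (p + 2 * pi) t)"
    by (intro cont_compose[OF smooth_cont[OF smooth_len]] continuous_intros) (use ab in auto)
  then have "bounded ((\<lambda>t. len (p + 2 * pi) t) ` {a..b})"
    by (intro compact_imp_bounded compact_continuous_image) auto
  then obtain M where "\<forall>z\<in>(\<lambda>t. len (p + 2 * pi) t) ` {a..b}. norm z \<le> M" unfolding bounded_iff by blast
  then have M: "\<bar>len (p + 2 * pi) t\<bar> \<le> M" if "t \<in> {a..b}" for t using that by simp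
  show "\<exists>M. \<forall>t\<in>{a..b}. \<exists>P. 0 < P \<and> P \<le> M \<and> (\<forall>s. sharp g (s + P) t = sharp g s t)"
  proof (rule exI[of _ M], rule ballI)
    fix t assume t': "t \<in> {a..b}"
    then have t: "t \<in> U" using ab by blast
    have "len p t < len (p + 2 * pi) t" by (rule len_strict_mono[OF t]) simp
    then show "\<exists>P>0. P \<le> M \<and> (\<forall>s. sharp g (s + P) t = sharp g s t)"
      using M[OF t'] X_shift[OF t] closed[OF t]
      by (intro exI[of _ "len (p + 2 * pi) t"]) (auto simp: sharp_def)
  qed
qed (rule U smooth_sharp[OF g])+

lemma pinned_flow_by_arclength: "pinned_flow U (by_arclength g p)"
  by (rule pinned_flow_cong[OF pinned_flow_sharp]) (simp add: by_arclength_eq)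

lemma dxx_by_arclength: "t \<in> U \<Longrightarrow> dx (dx (by_arclength g p)) s t = curv_vec g (X s t) t"
proof -
  assume t: "t \<in> U"
  have "dx (dx (by_arclength g p)) s t = dx (dx (sharp g)) s t"
    by (intro dx_cong) (simp add: by_arclength_eq[OF t])
  then show ?thesis by (simp add: dxx_sharp[OF t])
qed

end

subsection \<open>Scaling and convergence\<close>

text \<open>
  The supremum is a genuine one: by continuity and periodicity the curvature is bounded at each time.
\<close>

lemma (in closed_flow) curvature_le_Sup:
  assumes t: "t \<in> U" shows "(curvature g x t)\<^sup>2 \<le> (SUP x. (curvature g x t)\<^sup>2)"
proof (rule cSUP_upper)
  have per: "ds g h (x + 2 * pi) t = ds g h x t" if "\<And>x. h (x + 2 * pi) t = h x t" for h x
    using periodic_dx[of h "2 * pi" t x] that v_periodic[OF t, of x] by (simp add: ds_def)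
  have kper: "curvature g (x + 2 * pi) t = curvature g x t" for x
    unfolding curvature_def curv_vec_def by (simp add: per closed[OF t])
  have "continuous_on {0..2*pi} (\<lambda>x. (curvature g x t)\<^sup>2)"
    unfolding curvature_def
    by (intro continuous_intros cont_compose[OF smooth_cont[OF smooth_curv_vec]] t)
  then have "bounded ((\<lambda>x. (curvature g x t)\<^sup>2) ` {0..2*pi})"
    by (intro compact_imp_bounded compact_continuous_image) auto
  then obtain M where "\<forall>z\<in>(\<lambda>x. (curvature g x t)\<^sup>2) ` {0..2*pi}. norm z \<le> M" unfolding bounded_iff by blast
  then have M: "(curvature g x t)\<^sup>2 \<le> M" if "x \<in> {0..2*pi}" for x using that by auto
  have "(curvature g x t)\<^sup>2 \<le> M" for x
  proof -
    obtain x' where "x' \<in> {0..2*pi}" "curvature g x' t = curvature g x t"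
      using periodic_reduce[of "\<lambda>x. curvature g x t" "2 * pi" x, OF kper] by auto
    then show ?thesis using M[of x'] by simp
  qed
  then show "bdd_above (range (\<lambda>x. (curvature g x t)\<^sup>2))" by (auto simp: bdd_above_def)
qed simp

lemma closed_csf_imp_closed_flow:
  fixes \<gamma> :: "real \<Rightarrow> real \<Rightarrow> 'a::euclidean_space"
  assumes \<gamma>: "closed_csf J \<gamma>" and U: "open U" "U \<subseteq> J"
  shows "closed_flow U \<gamma>"
proof
  show "smooth U \<gamma>" using \<gamma> U by (intro smooth_family_imp_smooth[of J]) (auto simp: closed_csf_def)
  show "dT \<gamma> x t = curv_vec \<gamma> x t" if t: "t \<in> U" for x t
  proof -
    have "dt J \<gamma> x t = dT \<gamma> x t" using pd_eq_pD[OF U t, of 0 1 \<gamma> x] by (simp add: pd_def)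
    then show ?thesis using \<gamma> U t unfolding closed_csf_def by (metis subsetD)
  qed
qed (use \<gamma> U in \<open>auto simp: closed_csf_def immersed_def\<close>)

text \<open>
  Parabolic scaling: lengths are multiplied by \<open>l\<close>, times by \<open>l\<^sup>2\<close> and hence curvatures by \<open>1/l\<close>.
\<close>

lemma closed_flow_rescale:
  fixes \<gamma> :: "real \<Rightarrow> real \<Rightarrow> 'a::euclidean_space" and L :: "'a \<Rightarrow> 'a"
    and b :: 'a and \<tau> :: real
  assumes \<gamma>: "closed_flow J \<gamma>" and L: "bounded_linear L" "\<And>x. norm (L x) = norm x" and l: "l > 0"
  defines "g \<equiv> \<lambda>x t. l *\<^sub>R (L (\<gamma> x (\<tau> + t / l\<^sup>2)) + b)"
  defines "U \<equiv> {t. \<tau> + t / l\<^sup>2 \<in> J}"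
  shows "closed_flow U g"
    and "\<And>x t. t \<in> U \<Longrightarrow> curv_vec g x t = (1 / l) *\<^sub>R L (curv_vec \<gamma> x (\<tau> + t / l\<^sup>2))"
proof -
  interpret G: closed_flow J \<gamma> 0 by (fact \<gamma>)
  define c where "c = 1 / l\<^sup>2"
  have lc: "l * c = 1 / l" using l by (simp add: c_def power2_eq_square)
  have g: "g = (\<lambda>x t. l *\<^sub>R (L (\<gamma> x (\<tau> + t * c)) + b))" by (simp add: g_def c_def)
  have U: "U = (\<lambda>t. \<tau> + t * c) -` J" by (auto simp: U_def c_def)
  have oU: "open U" unfolding U by (intro open_vimage G.U continuous_intros)
  have "smooth U (\<lambda>x t. \<gamma> x (\<tau> + t * c))" unfolding U by (rule smooth_time_affine[OF G.U G.g])
  then have sm: "smooth U g"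
    unfolding g by (intro smooth_linear[OF oU bounded_linear_scaleR_right] smooth_add smooth_const smooth_linear[OF oU L(1)])
  have dxg: "dx g x t = l *\<^sub>R L (dx \<gamma> x (\<tau> + t * c))" if t: "t \<in> U" for x t
  proof -
    have "((\<lambda>y. \<gamma> y (\<tau> + t * c)) has_vector_derivative dx \<gamma> x (\<tau> + t * c)) (at x)"
      using t U by (intro smooth_dxD[OF G.g]) auto
    from bounded_linear.has_vector_derivative[OF L(1) this]
    have "((\<lambda>y. g y t) has_vector_derivative l *\<^sub>R (L (dx \<gamma> x (\<tau> + t * c)) + 0)) (at x)"
      unfolding g
      by (intro bounded_linear.has_vector_derivative[OF bounded_linear_scaleR_right] has_vector_derivative_add
          has_vector_derivative_const)
    then show ?thesis by (simp add: dx_def vector_derivative_at)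
  qed
  have norm_dx: "norm (dx g x t) = l * norm (dx \<gamma> x (\<tau> + t * c))" if "t \<in> U" for x t
    using l by (simp add: dxg[OF that] L(2))
  have ds: "ds g g x t = L (ds \<gamma> \<gamma> x (\<tau> + t * c))" if t: "t \<in> U" for x t
    using l by (simp add: ds_def dxg[OF t] L(2) linear_scale[OF bounded_linear.linear[OF L(1)]] divide_inverse)
  have kv: "curv_vec g x t = (1 / l) *\<^sub>R L (curv_vec \<gamma> x (\<tau> + t * c))" if t: "t \<in> U" for x t
  proof -
    have tJ: "\<tau> + t * c \<in> J" using t U by simp
    have s: "smooth J (ds \<gamma> \<gamma>)" unfolding G.ds_eq_P by (rule G.smooth_P[OF G.g])
    have "dx (ds g g) x t = dx (\<lambda>x s. L (ds \<gamma> \<gamma> x s)) x (\<tau> + t * c)"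
      by (simp add: dx_def ds[OF t])
    also have "\<dots> = L (dx (ds \<gamma> \<gamma>) x (\<tau> + t * c))" by (rule dx_linear[OF s L(1) tJ])
    finally have "dx (ds g g) x t = L (dx (ds \<gamma> \<gamma>) x (\<tau> + t * c))" .
    then show ?thesis
      unfolding curv_vec_def by (subst (1 3) ds_def) (simp add: norm_dx[OF t] linear_scale[OF bounded_linear.linear[OF L(1)]] divide_inverse)
  qed
  then show "curv_vec g x t = (1 / l) *\<^sub>R L (curv_vec \<gamma> x (\<tau> + t / l\<^sup>2))" if "t \<in> U" for x t
    using that by (simp add: c_def)
  show "closed_flow U g"
  proof
    show "open U" "smooth U g" by (fact oU sm)+
    fix x t assume t: "t \<in> U"
    then have tJ: "\<tau> + t * c \<in> J" using U by simp
    show "dx g x t \<noteq> 0" using norm_dx[OF t, of x] G.immersed[OF tJ, of x] l by auto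
    show "g (x + 2 * pi) t = g x t" by (simp add: g G.closed[OF tJ])
    have "((\<lambda>t. \<tau> + t * c) has_vector_derivative c) (at t)" by (auto intro!: derivative_eq_intros)
    from vector_diff_chain_at[OF this smooth_dTD[OF G.U G.g tJ]]
    have "((\<lambda>t. \<gamma> x (\<tau> + t * c)) has_vector_derivative c *\<^sub>R dT \<gamma> x (\<tau> + t * c)) (at t)"
      by (simp add: o_def)
    from bounded_linear.has_vector_derivative[OF L(1) this]
    have "((\<lambda>t. g x t) has_vector_derivative l *\<^sub>R (L (c *\<^sub>R dT \<gamma> x (\<tau> + t * c)) + 0)) (at t)"
      unfolding g
      by (intro bounded_linear.has_vector_derivative[OF bounded_linear_scaleR_right] has_vector_derivative_add
          has_vector_derivative_const)
    then have "dT g x t = l *\<^sub>R L (c *\<^sub>R dT \<gamma> x (\<tau> + t * c))" by (simp add: dt_def vector_derivative_at)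
    then show "dT g x t = curv_vec g x t"
      using l lc by (simp add: kv[OF t] G.csf[OF tJ] linear_scale[OF bounded_linear.linear[OF L(1)]])
  qed
qed

text \<open>
  If the curve ran in a line with direction \<open>u\<close>, then \<open>c1 0\<close> and \<open>c2\<close> would both be multiples of \<open>u\<close>; but they are
  orthogonal, because \<open>c1\<close> has constant length, and nonzero.
\<close>

lemma curved_imp_not_collinear:
  fixes c :: "real \<Rightarrow> 'a::real_inner"
  assumes c: "\<And>s. (c has_vector_derivative c1 s) (at s)" and c1: "(c1 has_vector_derivative c2) (at 0)"
    and unit: "\<And>s. norm (c1 s) = 1" and c2: "c2 \<noteq> 0"
  shows "\<not> collinear (range c)"
proof
  assume "collinear (range c)"
  then obtain u where u: "\<And>s. \<exists>k. c s - c 0 = k *\<^sub>R u" unfolding collinear_def by blast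
  have orth: "w \<bullet> c1 s = 0" "w \<bullet> c2 = 0" if w: "w \<bullet> u = 0" for w s
  proof -
    have "w \<bullet> c s = w \<bullet> c 0" for s
    proof -
      obtain k where "c s - c 0 = k *\<^sub>R u" using u by blast
      then have "w \<bullet> (c s - c 0) = 0" using w by simp
      then show ?thesis by (simp add: inner_diff_right)
    qed
    then have "(\<lambda>s. w \<bullet> c s) = (\<lambda>s. w \<bullet> c 0)" by auto
    moreover have "((\<lambda>s. w \<bullet> c s) has_vector_derivative w \<bullet> c1 s) (at s)" for s
      by (rule bounded_linear.has_vector_derivative[OF bounded_linear_inner_right c])
    ultimately have "((\<lambda>s. w \<bullet> c 0) has_vector_derivative w \<bullet> c1 s) (at s)" for s by simp
    from vector_derivative_unique_at[OF this has_vector_derivative_const] show 1: "w \<bullet> c1 s = 0" for s .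
    have "((\<lambda>s. w \<bullet> c1 s) has_vector_derivative w \<bullet> c2) (at 0)"
      by (rule bounded_linear.has_vector_derivative[OF bounded_linear_inner_right c1])
    then have "((\<lambda>s. 0 :: real) has_vector_derivative w \<bullet> c2) (at 0)" by (simp add: 1)
    from vector_derivative_unique_at[OF this has_vector_derivative_const] show "w \<bullet> c2 = 0" .
  qed
  have par: "(u \<bullet> u) *\<^sub>R z = (z \<bullet> u) *\<^sub>R u" if z: "\<And>w. w \<bullet> u = 0 \<Longrightarrow> w \<bullet> z = 0" for z
  proof -
    define w where "w = (u \<bullet> u) *\<^sub>R z - (z \<bullet> u) *\<^sub>R u"
    have wu: "w \<bullet> u = 0" by (simp add: w_def inner_diff_left)
    have "w \<bullet> w = (u \<bullet> u) * (w \<bullet> z) - (z \<bullet> u) * (w \<bullet> u)"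
      by (subst (2) w_def) (simp add: inner_diff_right)
    then have "w = 0" using z[OF wu] wu by simp
    then show ?thesis by (simp add: w_def)
  qed
  have p1: "(u \<bullet> u) *\<^sub>R c1 0 = (c1 0 \<bullet> u) *\<^sub>R u" and p2: "(u \<bullet> u) *\<^sub>R c2 = (c2 \<bullet> u) *\<^sub>R u"
    using par orth by blast+
  have "c1 0 \<noteq> 0" using unit[of 0] by auto
  then have "u \<noteq> 0" using orth(1)[of "c1 0" 0] by auto
  then have uu: "u \<bullet> u \<noteq> 0" by simp
  have "((\<lambda>s. c1 s \<bullet> c1 s) has_vector_derivative (c1 0 \<bullet> c2 + c2 \<bullet> c1 0)) (at 0)"
    by (rule bounded_bilinear.has_vector_derivative[OF bounded_bilinear_inner c1 c1])
  then have "((\<lambda>s. 1 :: real) has_vector_derivative (c1 0 \<bullet> c2 + c2 \<bullet> c1 0)) (at 0)"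
    using unit by (simp add: norm_eq_1)
  from vector_derivative_unique_at[OF this has_vector_derivative_const]
  have o: "c1 0 \<bullet> c2 = 0" by (simp add: inner_commute)
  have "((u \<bullet> u) *\<^sub>R c1 0) \<bullet> ((u \<bullet> u) *\<^sub>R c2) = (c1 0 \<bullet> u) * (c2 \<bullet> u) * (u \<bullet> u)"
    unfolding p1 p2 by simp
  then have "c1 0 \<bullet> u = 0 \<or> c2 \<bullet> u = 0" using o uu by simp
  then have "c1 0 = 0 \<or> c2 = 0" using p1 p2 uu by auto
  then show False using \<open>c1 0 \<noteq> 0\<close> c2 by blast
qed

theorem theorem4p3:
  fixes \<gamma> :: "real \<Rightarrow> real \<Rightarrow> real ^ 'n"
    and \<omega> :: real
    and p \<tau> :: "nat \<Rightarrow> real"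
    and A :: "nat \<Rightarrow> real ^ 'n ^ 'n"
    and b :: "nat \<Rightarrow> real ^ 'n"
    and e :: "nat \<Rightarrow> 'n"
  assumes "CARD('n) \<ge> 2"
    and "singularity_at \<omega> \<gamma>"
    and "essential_blow_up \<omega> \<gamma> p \<tau>"
    and "bij_betw e {..<CARD('n)} UNIV"
    and "\<And>j. rotation_matrix (A j)"
    and "\<And>j. frame_normalised e (\<lambda>s. rescaled \<gamma> (p j) (\<tau> j) (A j) (b j) s 0)"
  shows "\<exists>r \<gamma>_lim. strict_mono (r :: nat \<Rightarrow> nat) \<and>
           arclength_csf {..0} \<gamma>_lim \<and>
           converges_smoothly
             (\<lambda>j. rescaled_times \<omega> \<gamma> (p (r j)) (\<tau> (r j)))
             (\<lambda>j. rescaled \<gamma> (p (r j)) (\<tau> (r j)) (A (r j)) (b (r j)))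
             {..0} \<gamma>_lim \<and>
           \<not> collinear (range (\<lambda>s. \<gamma>_lim s 0))"
proof -
  have \<omega>: "0 < \<omega>" "closed_csf {0..<\<omega>} \<gamma>" using assms(2) by (auto simp: singularity_at_def)
  have G: "closed_flow {0<..<\<omega>} \<gamma>" by (rule closed_csf_imp_closed_flow[OF \<omega>(2)]) auto
  obtain \<rho> where \<rho>: "\<rho> > 0" "\<And>j t. t \<in> {0..<\<tau> j} \<Longrightarrow>
      \<rho> * (SUP x. (curvature \<gamma> x t)\<^sup>2) \<le> (curvature \<gamma> (p j) (\<tau> j))\<^sup>2"
    using assms(3) by (auto simp: essential_blow_up_def)
  have bu: "\<And>j. \<tau> j \<in> {0..<\<omega>}" "\<tau> \<longlonglongrightarrow> \<omega>"
    "filterlim (\<lambda>j. (curvature \<gamma> (p j) (\<tau> j))\<^sup>2) at_top sequentially"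
    using assms(3) by (auto simp: essential_blow_up_def blow_up_sequence_def)
  have "\<forall>\<^sub>F j in sequentially. 0 < \<tau> j \<and> 0 < (curvature \<gamma> (p j) (\<tau> j))\<^sup>2"
    by (rule eventually_conj[OF order_tendstoD(1)[OF bu(2) \<omega>(1)]
        bu(3)[unfolded filterlim_at_top_dense, rule_format]])
  \<comment> \<open>Before \<open>N\<close> the scaling factor may vanish or the base time be the initial one; such terms are dropped.\<close>
  then obtain N where N: "\<And>j. j \<ge> N \<Longrightarrow> 0 < \<tau> j \<and> 0 < (curvature \<gamma> (p j) (\<tau> j))\<^sup>2"
    unfolding eventually_sequentially by blast
  define l where "l = (\<lambda>j. curvature \<gamma> (p (j + N)) (\<tau> (j + N)))"
  define T where "T = (\<lambda>j. \<tau> (j + N))"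
  have l: "l j > 0" for j
    using N[of "j + N"] by (auto simp: l_def curvature_def)
  have T: "0 < T j" "T j < \<omega>" for j using N[of "j + N"] bu(1)[of "j + N"] by (auto simp: T_def)
  define g where "g = (\<lambda>j x t. l j *\<^sub>R (A (j + N) *v \<gamma> x (T j + t / (l j)\<^sup>2) + b (j + N)))"
  define f where "f = (\<lambda>j. rescaled \<gamma> (p (j + N)) (\<tau> (j + N)) (A (j + N)) (b (j + N)))"
  define U where "U = (\<lambda>j. {t. T j + t / (l j)\<^sup>2 \<in> {0<..<\<omega>}})"
  have f: "f j = by_arclength (g j) (p (j + N))" for j
    by (simp add: f_def rescaled_def Let_def g_def l_def T_def)
  have U: "U j = {- ((l j)\<^sup>2) * T j <..< (l j)\<^sup>2 * (\<omega> - T j)}" for j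
    using l[of j] by (auto simp: U_def field_simps)
  have rot: "norm (A j *v x) = norm x" for j x
  proof -
    have "orthogonal_transformation ((*v) (A j))"
      using assms(5)[of j] by (simp add: rotation_matrix_def orthogonal_transformation_matrix)
    then show ?thesis by (rule orthogonal_transformation_norm)
  qed
  have lin: "bounded_linear ((*v) (A j))" for j by (rule matrix_vector_mul_bounded_linear)
  have cf: "closed_flow (U j) (g j)" for j
    using closed_flow_rescale(1)[OF G lin rot l] unfolding g_def U_def .
  have kv: "curv_vec (g j) x t = (1 / l j) *\<^sub>R (A (j + N) *v curv_vec \<gamma> x (T j + t / (l j)\<^sup>2))" if "t \<in> U j" for j x t
    using closed_flow_rescale(2)[OF G lin rot l] that unfolding g_def U_def by blast
  have knorm: "norm (curv_vec (g j) x t) = curvature \<gamma> x (T j + t / (l j)\<^sup>2) / l j" if "t \<in> U j" for j x t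
    using l[of j] by (simp add: kv[OF that] rot curvature_def)
  have U0: "0 \<in> U j" for j using T[of j] by (simp add: U_def)
  define K where "K = sqrt (1 / \<rho>)"
  have bound: "norm (curv_vec (g j) x t) \<le> K" if t: "t \<in> U j" "t < 0" for j x t
  proof -
    define \<sigma> where "\<sigma> = T j + t / (l j)\<^sup>2"
    have \<sigma>: "\<sigma> \<in> {0<..<\<omega>}" "\<sigma> < T j" using t l[of j] by (auto simp: U_def \<sigma>_def divide_neg_pos)
    have "\<rho> * (curvature \<gamma> x \<sigma>)\<^sup>2 \<le> \<rho> * (SUP x. (curvature \<gamma> x \<sigma>)\<^sup>2)"
      using \<rho>(1) closed_flow.curvature_le_Sup[OF G \<sigma>(1)] by (intro mult_left_mono) auto
    also have "\<dots> \<le> (l j)\<^sup>2" using \<rho>(2)[of \<sigma> "j + N"] \<sigma> by (auto simp: l_def T_def)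
    finally have "(curvature \<gamma> x \<sigma> / l j)\<^sup>2 \<le> 1 / \<rho>"
      using \<rho>(1) l[of j] by (simp add: power_divide field_simps)
    then show ?thesis unfolding knorm[OF t(1)] \<sigma>_def[symmetric] K_def by (rule real_le_rsqrt)
  qed
  \<comment> \<open>The time intervals of the rescaled flows extend backwards without bound.\<close>
  have lT: "filterlim (\<lambda>j. (l j)\<^sup>2 * T j) at_top sequentially"
  proof -
    have "filterlim (\<lambda>j. \<tau> j * (curvature \<gamma> (p j) (\<tau> j))\<^sup>2) at_top sequentially"
      by (rule filterlim_tendsto_pos_mult_at_top[OF bu(2) \<omega>(1) bu(3)])
    then have "filterlim (\<lambda>j. \<tau> (j + N) * (curvature \<gamma> (p (j + N)) (\<tau> (j + N)))\<^sup>2) at_top sequentially"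
      by (rule filterlim_compose) (rule filterlim_add_const_nat_at_top)
    then show ?thesis by (simp add: l_def T_def mult.commute)
  qed
  interpret F: flow_sequence U f K
  proof (intro flow_sequence.intro exhausting.intro flow_sequence_axioms.intro)
    show "open (U j)" for j by (simp add: U)
    show "\<forall>\<^sub>F j in sequentially. {- real n..0} \<subseteq> U j" for n
    proof -
      have "\<forall>\<^sub>F j in sequentially. real n < (l j)\<^sup>2 * T j" using lT by (auto simp: filterlim_at_top_dense)
      then show ?thesis
      proof eventually_elim
        case (elim j)
        have "0 < (l j)\<^sup>2 * (\<omega> - T j)" using l[of j] T[of j] by simp
        then show ?case using elim by (auto simp: U)
      qed
    qed
    show "pinned_flow (U j) (f j)" for j
      unfolding f by (rule closed_flow.pinned_flow_by_arclength[OF cf])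
    show "f j 0 0 = 0" for j
      using assms(6)[of "j + N"] by (simp add: frame_normalised_def f_def)
    \<comment> \<open>The essential condition speaks of earlier times only; at time \<open>0\<close> the bound holds by continuity.\<close>
    show "norm (dx (dx (f j)) s t) \<le> K" if t: "t \<in> U j" "t \<le> 0" for j s t
    proof (cases "t < 0")
      case True
      then show ?thesis unfolding f closed_flow.dxx_by_arclength[OF cf t(1)] by (intro bound t)
    next
      case False
      then have t0: "t = 0" using t by simp
      interpret pinned_flow "U j" "f j"
        unfolding f by (rule closed_flow.pinned_flow_by_arclength[OF cf])
      have "isCont (dx (dx (f j)) s) 0"
        using smooth_dTD[OF J smooth_dx[OF J smooth_dx[OF J f]] U0] has_vector_derivative_continuous by blast
      then have "((\<lambda>t. norm (dx (dx (f j)) s t)) \<longlongrightarrow> norm (dx (dx (f j)) s 0)) (at_left 0)"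
        by (intro tendsto_norm) (auto simp: isCont_def intro: tendsto_within_subset)
      moreover have "\<forall>\<^sub>F t in at_left 0. norm (dx (dx (f j)) s t) \<le> K"
      proof -
        have "\<forall>\<^sub>F t in at_left 0. t \<in> {- ((l j)\<^sup>2) * T j<..<0}"
          by (rule eventually_at_left_real) (use l[of j] T[of j] in simp)
        then show ?thesis
        proof eventually_elim
          case (elim t)
          have "0 < (l j)\<^sup>2 * (\<omega> - T j)" using l[of j] T[of j] by simp
          then have "t \<in> U j" "t < 0" using elim by (auto simp: U)
          then show ?case unfolding \<open>\<And>j. f j = by_arclength (g j) (p (j + N))\<close> closed_flow.dxx_by_arclength[OF cf \<open>t \<in> U j\<close>]
            by (rule bound)
        qed
      qed
      ultimately show ?thesis unfolding t0 by (rule tendsto_upperbound) simp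
    qed
  qed
  obtain r G where r: "strict_mono (r :: nat \<Rightarrow> nat)"
    "\<And>i k n. uniform_limit (window n) (\<lambda>j (x, t). pD i k (f (r j)) x t) (\<lambda>(x, t). G i k x t) sequentially"
    using F.convergent_subsequence by blast
  interpret L: smooth_limit "\<lambda>j. f (r j)" "\<lambda>j. U (r j)" G
  proof (rule smooth_limit.intro)
    show "\<forall>\<^sub>F j in sequentially. {- real n..0} \<subseteq> U (r j)" for n
      using F.exhaust by (rule eventually_compose_filterlim) (rule filterlim_subseq[OF r(1)])
  qed (use F.J F.smooth_flow r(2) in auto)
  have csf: "arclength_csf {..0} (G 0 0)" by (rule L.arclength_csf_G) (rule F.flows)
  have "converges_smoothly (\<lambda>j. rescaled_times \<omega> \<gamma> (p (r j + N)) (\<tau> (r j + N))) (\<lambda>j. f (r j)) {..0} (G 0 0)"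
    by (rule L.converges_smoothly_G) (auto simp: U rescaled_times_def Let_def l_def T_def)
  then have conv: "converges_smoothly (\<lambda>j. rescaled_times \<omega> \<gamma> (p (r j + N)) (\<tau> (r j + N)))
     (\<lambda>j. rescaled \<gamma> (p (r j + N)) (\<tau> (r j + N)) (A (r j + N)) (b (r j + N))) {..0} (G 0 0)"
    by (simp add: f_def)
  have "norm (G 2 0 0 0) = 1"
  proof (rule LIMSEQ_unique)
    show "(\<lambda>j. norm (pD 2 0 (f (r j)) 0 0)) \<longlonglongrightarrow> norm (G 2 0 0 0)" by (intro tendsto_norm L.pointwise) simp
    have "norm (pD 2 0 (f j) 0 0) = 1" for j
    proof -
      interpret C: closed_flow "U j" "g j" "p (j + N)" by (fact cf)
      have "pD 2 0 (f j) 0 0 = dx (dx (f j)) 0 0" by (simp add: pd_def numeral_2_eq_2)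
      also have "\<dots> = curv_vec (g j) (p (j + N)) 0"
        unfolding f using C.dxx_by_arclength[OF U0, of 0] by (simp add: C.X_0[OF U0])
      finally have "norm (pD 2 0 (f j) 0 0) = curvature \<gamma> (p (j + N)) (T j) / l j" by (simp add: knorm[OF U0])
      then show ?thesis using l[of j] by (simp add: l_def T_def)
    qed
    then show "(\<lambda>j. norm (pD 2 0 (f (r j)) 0 0)) \<longlonglongrightarrow> 1" by simp
  qed
  then have "\<not> collinear (range (\<lambda>s. G 0 0 s 0))"
  proof (intro curved_imp_not_collinear)
    show "((\<lambda>s. G 0 0 s 0) has_vector_derivative G (Suc 0) 0 s 0) (at s)" for s by (rule L.G_dx) simp
    show "((\<lambda>s. G (Suc 0) 0 s 0) has_vector_derivative G 2 0 0 0) (at 0)"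
      using L.G_dx[of 0 "Suc 0" 0 0] by (simp add: numeral_2_eq_2)
    have "dx (G 0 0) s 0 = G (Suc 0) 0 s 0" for s
      unfolding dx_def by (rule vector_derivative_at[OF L.G_dx]) simp
    then show "norm (G (Suc 0) 0 s 0) = 1" for s
      using csf unfolding arclength_csf_def by (metis atMost_iff order_refl)
  qed auto
  moreover have "strict_mono (\<lambda>j. r j + N)" using r(1) by (simp add: strict_mono_def)
  ultimately show ?thesis using csf conv by (intro exI[of _ "\<lambda>j. r j + N"] exI[of _ "G 0 0"]) simp
qed

end
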